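(* Let $n\ge1$ and let $m>m_1>\dots>m_n>0$ be integers. The monodromy representation of the Mellin system associated with $(m;m_1,\dots,m_n)$ is always reducible, i.e., the solution space at a generic point has a nonzero proper subspace invariant under the monodromy.
   Context: Put $m_j' = m-m_j$ and $\theta_j = x_j\,\partial/\partial x_j$. The Mellin system associated with $(m;m_1,\dots,m_n)$ (i.e., with the algebraic equation $y^m + x_1y^{m_1}+\dots+x_ny^{m_n}-1=0$) is the following system of $n$ linear partial differential equations for $y(x)=y(x_1,\dots,x_n)$: $$\prod_{k=0}^{m_j-1}(m_1\theta_1+\dots+m_n\theta_n+mk+1)\prod_{k=0}^{m_j'-1}(m_1'\theta_1+\dots+m_n'\theta_n+mk-1)\,y(x) = (-1)^{m_j}m^m\frac{\partial^m y(x)}{\partial x_j^m},\quad j=1,\dots,n.$$ Its monodromy representation is the representation of the fundamental group of the complement of the singular locus in $\mathbb{C}^n$ on the finite-dimensional space of local analytic solutions at a base point, given by analytic continuation along loops. *)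

theory Defs
  imports "HOL-Analysis.Analysis" "HOL-Library.Poly_Mapping"
begin

text \<open>
  Points of complex n-space are vectors of type \<open>complex ^ 'n\<close>; the linear order on the index type
  \<open>'n\<close> plays the role of the usual order on the indices 1, ..., n.
\<close>

type_synonym 'n point = "complex ^ 'n"
type_synonym 'n cfun = "'n point \<Rightarrow> complex"

text \<open>Holomorphy in several variables: the real Frechet derivative exists and is complex linear.\<close>

definition holo_on :: "('n::finite) cfun \<Rightarrow> 'n point set \<Rightarrow> bool" where
  "holo_on f S \<longleftrightarrow>
     open S \<and> (\<forall>x\<in>S. \<exists>D. (f has_derivative D) (at x) \<and> (\<forall>c v. D (c *s v) = c * D v))"

definition pd :: "'n::finite \<Rightarrow> 'n cfun \<Rightarrow> 'n cfun" where
  "pd j f x = deriv (\<lambda>z. f (x + z *s axis j 1)) 0"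

definition mpd :: "('n::{finite,linorder} \<Rightarrow> nat) \<Rightarrow> 'n cfun \<Rightarrow> 'n cfun" where
  "mpd \<beta> f = fold (\<lambda>j. pd j ^^ \<beta> j) (sorted_list_of_set UNIV) f"

definition theta :: "'n::finite \<Rightarrow> 'n cfun \<Rightarrow> 'n cfun" where
  "theta j f x = x $ j * pd j f x"


subsection \<open>The Mellin system\<close>

text \<open>The operator \<open>a\<^sub>1 \<theta>\<^sub>1 + \<dots> + a\<^sub>n \<theta>\<^sub>n + c\<close>.\<close>

definition theta_lin :: "('n::finite \<Rightarrow> nat) \<Rightarrow> complex \<Rightarrow> 'n cfun \<Rightarrow> 'n cfun" where
  "theta_lin a c f x = (\<Sum>i\<in>UNIV. of_nat (a i) * theta i f x) + c * f x"

text \<open>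
  Left-hand side minus right-hand side of the j-th equation; \<open>fold\<close> composes the factors,
  which commute with one another.
\<close>

definition mellin_op :: "nat \<Rightarrow> ('n::finite \<Rightarrow> nat) \<Rightarrow> 'n \<Rightarrow> 'n cfun \<Rightarrow> 'n cfun" where
  "mellin_op m ms j f x =
     fold (\<lambda>k. theta_lin ms (of_nat (m * k) + 1)) [0..<ms j]
       (fold (\<lambda>k. theta_lin (\<lambda>i. m - ms i) (of_nat (m * k) - 1)) [0..<m - ms j] f) x
     - (-1) ^ ms j * of_nat (m ^ m) * (pd j ^^ m) f x"


subsection \<open>The singular locus\<close>

text \<open>
  A Weyl algebra element in normally ordered form: the coefficient at \<open>(\<alpha>, \<beta>)\<close> is that of
  \<open>x\<^sup>\<alpha> \<partial>\<^sup>\<beta>\<close>.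
\<close>

type_synonym 'n weyl = "(('n \<Rightarrow> nat) \<times> ('n \<Rightarrow> nat)) \<Rightarrow>\<^sub>0 complex"

definition weyl_apply :: "('n::{finite,linorder}) weyl \<Rightarrow> 'n cfun \<Rightarrow> 'n cfun" where
  "weyl_apply P f x =
     (\<Sum>(\<alpha>, \<beta>)\<in>Poly_Mapping.keys P.
        Poly_Mapping.lookup P (\<alpha>, \<beta>) * (\<Prod>i\<in>UNIV. x $ i ^ \<alpha> i) * mpd \<beta> f x)"

definition weyl_order :: "('n::finite) weyl \<Rightarrow> nat" where
  "weyl_order P = Max (insert 0 ((\<lambda>(\<alpha>, \<beta>). \<Sum>i\<in>UNIV. \<beta> i) ` Poly_Mapping.keys P))"

definition principal_symbol ::
  "('n::finite) weyl \<Rightarrow> 'n point \<Rightarrow> 'n point \<Rightarrow> complex" where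
  "principal_symbol P x \<xi> =
     (\<Sum>(\<alpha>, \<beta>)\<in>{(\<alpha>, \<beta>)\<in>Poly_Mapping.keys P. (\<Sum>i\<in>UNIV. \<beta> i) = weyl_order P}.
        Poly_Mapping.lookup P (\<alpha>, \<beta>) * (\<Prod>i\<in>UNIV. x $ i ^ \<alpha> i) * (\<Prod>i\<in>UNIV. \<xi> $ i ^ \<beta> i))"

text \<open>
  The left ideal generated by a family of operators. The Weyl algebra acts faithfully on
  holomorphic functions, so identities between its elements are expressed through this action.
\<close>

definition left_ideal ::
  "('n::{finite,linorder} \<Rightarrow> 'n cfun \<Rightarrow> 'n cfun) \<Rightarrow> 'n weyl set" where
  "left_ideal G = {P. \<exists>Q. \<forall>S f. holo_on f S \<longrightarrow>
     (\<forall>x\<in>S. weyl_apply P f x = (\<Sum>j\<in>UNIV. weyl_apply (Q j) (G j f) x))}"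

definition char_variety ::
  "('n::{finite,linorder} \<Rightarrow> 'n cfun \<Rightarrow> 'n cfun) \<Rightarrow> ('n point \<times> 'n point) set" where
  "char_variety G = {(x, \<xi>). \<forall>P\<in>left_ideal G. principal_symbol P x \<xi> = 0}"

definition singular_locus ::
  "('n::{finite,linorder} \<Rightarrow> 'n cfun \<Rightarrow> 'n cfun) \<Rightarrow> 'n point set" where
  "singular_locus G = {x. \<exists>\<xi>. \<xi> \<noteq> 0 \<and> (x, \<xi>) \<in> char_variety G}"


subsection \<open>Germs, solution spaces and monodromy\<close>

definition germ :: "('n::finite) point \<Rightarrow> 'n cfun \<Rightarrow> 'n cfun set" where
  "germ p f = {g. \<forall>\<^sub>F x in nhds p. g x = f x}"

definition solution_germs ::
  "('n::finite \<Rightarrow> 'n cfun \<Rightarrow> 'n cfun) \<Rightarrow> 'n point \<Rightarrow> 'n cfun set set" where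
  "solution_germs G p =
     {germ p f | f. \<exists>S. p \<in> S \<and> holo_on f S \<and> (\<forall>j. \<forall>x\<in>S. G j f x = 0)}"

definition germ_subspace :: "('n::finite) point \<Rightarrow> 'n cfun set set \<Rightarrow> bool" where
  "germ_subspace p W \<longleftrightarrow> germ p (\<lambda>_. 0) \<in> W \<and>
     (\<forall>f g a b. germ p f \<in> W \<longrightarrow> germ p g \<in> W \<longrightarrow> germ p (\<lambda>x. a * f x + b * g x) \<in> W)"

text \<open>
  \<open>\<psi>\<close> is the analytic continuation of \<open>\<phi>\<close> along \<open>\<gamma>\<close>, witnessed by holomorphic functions
  \<open>F t\<close> near \<open>\<gamma> t\<close> whose germs agree locally along the path.
\<close>

definition analytic_continuation ::
  "(real \<Rightarrow> ('n::finite) point) \<Rightarrow> 'n cfun set \<Rightarrow> 'n cfun set \<Rightarrow> bool" where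
  "analytic_continuation \<gamma> \<phi> \<psi> \<longleftrightarrow> (\<exists>F :: real \<Rightarrow> 'n cfun.
     (\<forall>t\<in>{0..1}. \<exists>S. \<gamma> t \<in> S \<and> holo_on (F t) S) \<and>
     (\<forall>t\<in>{0..1}. \<forall>\<^sub>F s in at t within {0..1}. germ (\<gamma> s) (F s) = germ (\<gamma> s) (F t)) \<and>
     \<phi> = germ (\<gamma> 0) (F 0) \<and> \<psi> = germ (\<gamma> 1) (F 1))"

text \<open>Continuation is unique by the identity theorem; it depends only on the homotopy class
  of the loop in the complement of the singular locus.\<close>

definition monodromy :: "(real \<Rightarrow> ('n::finite) point) \<Rightarrow> 'n cfun set \<Rightarrow> 'n cfun set" where
  "monodromy \<gamma> \<phi> = (THE \<psi>. analytic_continuation \<gamma> \<phi> \<psi>)"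

definition monodromy_invariant ::
  "('n::{finite,linorder} \<Rightarrow> 'n cfun \<Rightarrow> 'n cfun) \<Rightarrow> 'n point \<Rightarrow> 'n cfun set set \<Rightarrow> bool" where
  "monodromy_invariant G p W \<longleftrightarrow>
     (\<forall>\<gamma>. path \<gamma> \<longrightarrow> pathstart \<gamma> = p \<longrightarrow> pathfinish \<gamma> = p \<longrightarrow>
        path_image \<gamma> \<subseteq> - singular_locus G \<longrightarrow> (\<forall>\<phi>\<in>W. monodromy \<gamma> \<phi> \<in> W))"

definition monodromy_reducible ::
  "('n::{finite,linorder} \<Rightarrow> 'n cfun \<Rightarrow> 'n cfun) \<Rightarrow> 'n point \<Rightarrow> bool" where
  "monodromy_reducible G p \<longleftrightarrow>
     (\<exists>W. W \<subseteq> solution_germs G p \<and> germ_subspace p W \<and>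
          W \<noteq> {germ p (\<lambda>_. 0)} \<and> W \<noteq> solution_germs G p \<and> monodromy_invariant G p W)"

end

theory Submission
  imports Defs "HOL-Complex_Analysis.Conformal_Mappings"
    "HOL-Computational_Algebra.Fundamental_Theorem_Algebra"
begin

text \<open>
  A root \<open>y\<close> of \<open>P(w) = w\<^sup>m + \<Sum>x\<^sub>j w\<^bsup>ms j\<^esup> - 1\<close> is the integral of \<open>w P'/P\<close> over a small circle, divided by
  \<open>2\<pi>i\<close>. Differentiation and integration by parts act on the integrals of \<open>w\<^sup>s/P\<^sup>k\<close> by simple shifts of
  \<open>(s, k)\<close>, so that both sides of the Mellin system reduce to the same integral. If \<open>ms j < m - 1\<close> for all
  \<open>j\<close>, then the sum of the roots vanishes and \<open>\<Sum>y log y\<close> is a solution as well.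

  A multiple root at \<open>p\<close> forces \<open>p\<close> into the singular locus: the derivatives of a nearby root blow up along a
  line through \<open>p\<close>, and the leading term is the principal symbol at a fixed covector. Hence off the singular
  locus the roots continue along all paths, and their span is monodromy invariant. It is a proper subspace:
  it omits a root of \<open>w\<^sup>m + \<zeta> \<Sum>x\<^sub>j w\<^bsup>ms j\<^esup> - 1\<close> (with \<open>\<zeta>\<close> a primitive \<open>m\<close>-th root of unity) if some \<open>ms j\<close> is
  not prime to \<open>m\<close>, and \<open>\<Sum>y log y\<close> otherwise. Both claims are moved along a line to the origin, where they are
  read off from one derivative. In the remaining case \<open>ms j = m - 1\<close> the sum of the roots is
  \<open>- x\<^sub>j\<close>, and the line that it spans is invariant and proper.
\<close>

subsection \<open>Gradients\<close>

text \<open>The singular locus is defined through all operators of the left ideal, and their symbols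
  are not explicitly known. What is known about such an operator is that it annihilates every root,
  so membership in the locus has to be read off from the growth of the roots. The case distinction
  answers two obstacles. For n = 1 and an exponent prime to m, a substitution w = omega v with
  omega^m = 1 absorbs the twist by zeta, and the twisted roots are multiples of the original ones; a
  solution outside the span must then come from elsewhere, namely from the logarithm. The logarithm
  in turn produces correction terms, all controlled by the sum of the roots. That sum is minus the
  coefficient of w^(m-1), which vanishes identically when no exponent equals m - 1. The origin is
  the place of comparison because the equation there is w^m = 1 and the relations between the
  integrals lose their sums over x_j: they become short recursions in (s, k) whose factors can be
  checked to be nonzero.\<close>

definition has_gradient :: "('n::finite) cfun \<Rightarrow> ('n \<Rightarrow> complex) \<Rightarrow> 'n point \<Rightarrow> bool" where
  "has_gradient f D x \<longleftrightarrow> (f has_derivative (\<lambda>v. \<Sum>j\<in>UNIV. v $ j * D j)) (at x)"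

lemma cvec_expansion: "(v :: complex ^ 'n::finite) = (\<Sum>j\<in>UNIV. v $ j *s axis j 1)"
  by (simp add: vec_eq_iff axis_def vector_scalar_mult_def if_distrib cong: if_cong)

lemma holo_on_iff_has_gradient:
  "holo_on f S \<longleftrightarrow> open S \<and> (\<forall>x\<in>S. \<exists>D. has_gradient f D x)"
proof -
  have eq: "(\<exists>D. (f has_derivative D) (at x) \<and> (\<forall>c v. D (c *s v) = c * D v)) \<longleftrightarrow>
        (\<exists>D. has_gradient f D x)" for x
  proof
    assume "\<exists>D. (f has_derivative D) (at x) \<and> (\<forall>c v. D (c *s v) = c * D v)"
    then obtain D where D: "(f has_derivative D) (at x)" "\<And>c v. D (c *s v) = c * D v" by blast
    interpret D: bounded_linear D using D(1) by (rule has_derivative_bounded_linear)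
    have "D = (\<lambda>v. \<Sum>j\<in>UNIV. v $ j * D (axis j 1))"
    proof
      fix v
      have "D v = D (\<Sum>j\<in>UNIV. v $ j *s axis j 1)" using cvec_expansion[of v] by simp
      then show "D v = (\<Sum>j\<in>UNIV. v $ j * D (axis j 1))" by (simp add: D.sum D(2))
    qed
    then show "\<exists>D. has_gradient f D x" using D(1) unfolding has_gradient_def by metis
  next
    assume "\<exists>D. has_gradient f D x"
    then obtain D where D: "has_gradient f D x" ..
    show "\<exists>D. (f has_derivative D) (at x) \<and> (\<forall>c v. D (c *s v) = c * D v)"
    proof (intro exI[where x="\<lambda>v. \<Sum>j\<in>UNIV. v $ j * D j"] conjI allI)
      show "(f has_derivative (\<lambda>v. \<Sum>j\<in>UNIV. v $ j * D j)) (at x)"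
        using D by (simp add: has_gradient_def)
      show "(\<Sum>j\<in>UNIV. (c *s v) $ j * D j) = c * (\<Sum>j\<in>UNIV. v $ j * D j)" for c v
        by (simp add: sum_distrib_left mult.assoc)
    qed
  qed
  show ?thesis by (simp only: holo_on_def eq)
qed

lemma has_derivative_line:
  fixes v :: "complex ^ 'n::finite"
  shows "((\<lambda>z. x + z *s v) has_derivative (\<lambda>z. z *s v)) (at z0)"
proof -
  have bl: "bounded_linear (\<lambda>z::complex. z *s v)"
    unfolding linear_conv_bounded_linear[symmetric]
    by (rule linearI) (simp_all add: vec_eq_iff distrib_right)
  show ?thesis
    using has_derivative_add[OF has_derivative_const bounded_linear_imp_has_derivative[OF bl]]
    by simp
qed

lemma isCont_line: "isCont (\<lambda>z. x + z *s v) (z0::complex)"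
  using has_derivative_line has_derivative_continuous by blast

lemma has_gradient_line:
  assumes "has_gradient f D (x + z0 *s v)"
  shows "((\<lambda>z. f (x + z *s v)) has_field_derivative (\<Sum>j\<in>UNIV. v $ j * D j)) (at z0)"
proof -
  have "((\<lambda>z. f (x + z *s v)) has_derivative (\<lambda>z. \<Sum>j\<in>UNIV. (z *s v) $ j * D j)) (at z0)"
    using has_derivative_compose[OF has_derivative_line assms[unfolded has_gradient_def]] .
  moreover have "(\<lambda>z. \<Sum>j\<in>UNIV. (z *s v) $ j * D j) = (*) (\<Sum>j\<in>UNIV. v $ j * D j)"
    by (auto simp: sum_distrib_left algebra_simps)
  ultimately show ?thesis by (simp add: has_field_derivative_def)
qed

lemma pd_has_gradient:
  assumes "has_gradient f D x" shows "pd j f x = D j"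
proof -
  have "((\<lambda>z. f (x + z *s axis j 1)) has_field_derivative (\<Sum>i\<in>UNIV. axis j 1 $ i * D i)) (at 0)"
    by (rule has_gradient_line) (use assms in simp)
  moreover have "(\<Sum>i\<in>UNIV. axis j 1 $ i * D i) = (\<Sum>i\<in>UNIV. if i = j then D i else 0)"
    by (intro sum.cong) (auto simp: axis_def)
  ultimately show ?thesis unfolding pd_def by (simp add: DERIV_imp_deriv)
qed

lemma has_gradient_const: "has_gradient (\<lambda>_. c) (\<lambda>_. 0) x"
  by (simp add: has_gradient_def)

lemma has_gradient_coord:
  fixes i :: "'n::finite"
  shows "has_gradient (\<lambda>x. x $ i) (\<lambda>j. if j = i then 1 else 0) x"
proof -
  have "((\<lambda>x::complex^'n. x $ i) has_derivative (\<lambda>v. v $ i)) (at x)"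
    by (rule bounded_linear_imp_has_derivative[OF bounded_linear_vec_nth])
  moreover have "(\<Sum>j\<in>UNIV. v $ j * (if j = i then 1 else 0)) = v $ i" for v :: "complex^'n"
  proof -
    have "(\<Sum>j\<in>UNIV. v $ j * (if j = i then 1 else 0)) = (\<Sum>j\<in>UNIV. if j = i then v $ j else 0)"
      by (intro sum.cong) auto
    then show ?thesis by simp
  qed
  ultimately show ?thesis by (simp only: has_gradient_def)
qed

lemma has_gradient_add:
  "has_gradient f D x \<Longrightarrow> has_gradient g E x \<Longrightarrow> has_gradient (\<lambda>x. f x + g x) (\<lambda>j. D j + E j) x"
  unfolding has_gradient_def
  by (drule (1) has_derivative_add) (simp add: sum.distrib algebra_simps)

lemma has_gradient_mult:
  assumes "has_gradient f D x" "has_gradient g E x"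
  shows "has_gradient (\<lambda>x. f x * g x) (\<lambda>j. f x * E j + D j * g x) x"
  using has_derivative_mult[OF assms[unfolded has_gradient_def]] unfolding has_gradient_def
  by (simp add: sum.distrib algebra_simps sum_distrib_left)

lemma has_gradient_sum:
  assumes "\<And>i. i \<in> I \<Longrightarrow> has_gradient (f i) (D i) x"
  shows "has_gradient (\<lambda>x. \<Sum>i\<in>I. f i x) (\<lambda>j. \<Sum>i\<in>I. D i j) x"
proof -
  have "((\<lambda>x. \<Sum>i\<in>I. f i x) has_derivative (\<lambda>v. \<Sum>i\<in>I. \<Sum>j\<in>UNIV. v $ j * D i j)) (at x)"
    using assms by (intro has_derivative_sum) (auto simp: has_gradient_def)
  moreover have "(\<Sum>i\<in>I. \<Sum>j\<in>UNIV. v $ j * D i j) = (\<Sum>j\<in>UNIV. v $ j * (\<Sum>i\<in>I. D i j))" for v :: "complex ^ 'b"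
    by (subst sum.swap) (simp add: sum_distrib_left)
  ultimately show ?thesis by (simp add: has_gradient_def)
qed

lemma has_gradient_cmult:
  "has_gradient f D x \<Longrightarrow> has_gradient (\<lambda>x. c * f x) (\<lambda>j. c * D j) x"
  using has_gradient_mult[OF has_gradient_const] by fastforce

text \<open>This replaces differentiation under the integral sign: once an increment is written with
  the factors x_j - x0_j in front, only the continuity of the remaining integrals is left to
  prove.\<close>

lemma has_gradient_Caratheodory:
  assumes "open S" "x0 \<in> S"
    and eq: "\<And>x. x \<in> S \<Longrightarrow> f x - f x0 = (\<Sum>j\<in>UNIV. (x $ j - x0 $ j) * G j x)"
    and cont: "\<And>j. continuous (at x0) (G j)"
  shows "has_gradient f (\<lambda>j. G j x0) x0"
  unfolding has_gradient_def has_derivative_at2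
proof (intro conjI)
  show "bounded_linear (\<lambda>v. \<Sum>j\<in>UNIV. v $ j * G j x0)"
    by (intro bounded_linear_sum bounded_linear_mult_const[OF bounded_linear_vec_nth, unfolded o_def])
  show "((\<lambda>y. (1 / norm (y - x0)) *\<^sub>R (f y - (f x0 + (\<Sum>j\<in>UNIV. (y - x0) $ j * G j x0)))) \<longlongrightarrow> 0) (at x0)"
  proof (rule Lim_null_comparison)
    show "((\<lambda>y. \<Sum>j\<in>UNIV. norm (G j y - G j x0)) \<longlongrightarrow> 0) (at x0)"
      using cont by (intro tendsto_null_sum tendsto_norm_zero LIM_zero)
        (auto simp: continuous_at)
    have "\<forall>\<^sub>F y in at x0. y \<in> S" using assms(1,2) by (rule eventually_at_in_open')
    then show "\<forall>\<^sub>F y in at x0. norm ((1 / norm (y - x0)) *\<^sub>R (f y - (f x0 + (\<Sum>j\<in>UNIV. (y - x0) $ j * G j x0)))) \<le> (\<Sum>j\<in>UNIV. norm (G j y - G j x0))"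
    proof eventually_elim
      case (elim y)
      have "f y - (f x0 + (\<Sum>j\<in>UNIV. (y - x0) $ j * G j x0)) = (\<Sum>j\<in>UNIV. (y - x0) $ j * (G j y - G j x0))"
        using eq[OF elim] by (simp add: right_diff_distrib sum_subtractf)
      also have "norm \<dots> \<le> (\<Sum>j\<in>UNIV. norm (y - x0) * norm (G j y - G j x0))"
        by (intro sum_norm_le)
           (auto simp: norm_mult intro!: mult_right_mono simp del: vector_minus_component
              intro: Finite_Cartesian_Product.norm_nth_le)
      finally have "norm (f y - (f x0 + (\<Sum>j\<in>UNIV. (y - x0) $ j * G j x0))) \<le> norm (y - x0) * (\<Sum>j\<in>UNIV. norm (G j y - G j x0))"
        by (simp add: sum_distrib_left)
      then show ?case
        by (cases "y = x0") (simp_all only: norm_scaleR, simp_all add: divide_le_eq mult.commute sum_nonneg)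
    qed
  qed
qed

subsection \<open>Locality of differential operators\<close>

text \<open>Operators get iterated, and each further derivative needs equality on a neighbourhood;
  hence identities are carried along on a fixed open set.\<close>

definition agree_on :: "('n::finite) point set \<Rightarrow> 'n cfun \<Rightarrow> 'n cfun \<Rightarrow> bool" where
  "agree_on S f g \<longleftrightarrow> open S \<and> (\<forall>x\<in>S. f x = g x)"

lemma pd_cong:
  assumes "agree_on S f g" shows "agree_on S (pd j f) (pd j g)"
  unfolding agree_on_def
proof (intro conjI ballI)
  show "open S" using assms by (simp add: agree_on_def)
  fix x assume x: "x \<in> S"
  have "((\<lambda>z. x + z *s axis j 1) \<longlongrightarrow> x) (nhds (0::complex))"
    using isCont_line[where x=x and v="axis j 1" and ?z0.0=0]
      tendsto_at_iff_tendsto_nhds[of "\<lambda>z. x + z *s axis j 1" 0] by (simp add: isCont_def)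
  then have "\<forall>\<^sub>F z in nhds 0. x + z *s axis j 1 \<in> S"
    by (rule topological_tendstoD) (use assms x in \<open>auto simp: agree_on_def\<close>)
  then have "\<forall>\<^sub>F z in nhds 0. f (x + z *s axis j 1) = g (x + z *s axis j 1)"
    by eventually_elim (use assms in \<open>auto simp: agree_on_def\<close>)
  then show "pd j f x = pd j g x" unfolding pd_def by (rule deriv_cong_ev) simp
qed

lemma pd_pow_cong: "agree_on S f g \<Longrightarrow> agree_on S ((pd j ^^ k) f) ((pd j ^^ k) g)"
  by (induction k) (auto intro: pd_cong)

lemma theta_lin_cong:
  assumes "agree_on S f g" shows "agree_on S (theta_lin a c f) (theta_lin a c g)"
proof -
  have "pd j f x = pd j g x" if "x \<in> S" for j x
    using pd_cong[OF assms] that by (simp add: agree_on_def)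
  then show ?thesis using assms by (simp add: agree_on_def theta_lin_def theta_def)
qed

lemma fold_cong_agree:
  assumes "\<And>i f g. agree_on S f g \<Longrightarrow> agree_on S (L i f) (L i g)" "agree_on S f g"
  shows "agree_on S (fold L xs f) (fold L xs g)"
  using assms(2) by (induction xs arbitrary: f g) (auto intro: assms(1))

lemma mpd_cong: "agree_on S f g \<Longrightarrow> agree_on S (mpd \<beta> f) (mpd \<beta> g)"
  unfolding mpd_def by (rule fold_cong_agree) (auto intro: pd_pow_cong)

lemma mellin_op_cong:
  fixes j :: "'n::finite"
  assumes "agree_on S f g" "x \<in> S" shows "mellin_op m ms j f x = mellin_op m ms j g x"
proof -
  have 1: "agree_on S (fold (\<lambda>k. theta_lin ms (of_nat (m * k) + 1)) [0..<ms j]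
       (fold (\<lambda>k. theta_lin (\<lambda>i. m - ms i) (of_nat (m * k) - 1)) [0..<m - ms j] f))
     (fold (\<lambda>k. theta_lin ms (of_nat (m * k) + 1)) [0..<ms j]
       (fold (\<lambda>k. theta_lin (\<lambda>i. m - ms i) (of_nat (m * k) - 1)) [0..<m - ms j] g))"
    by (intro fold_cong_agree theta_lin_cong assms)
  then show ?thesis using assms pd_pow_cong[OF assms(1), where j=j and k=m]
    unfolding mellin_op_def agree_on_def by simp
qed

lemma pd_zero: "pd j (\<lambda>_. 0) = (\<lambda>_. 0)"
  by (rule ext) (use pd_has_gradient[OF has_gradient_const] in auto)

lemma mpd_zero: "mpd \<beta> (\<lambda>_. 0) = (\<lambda>_. 0)"
proof -
  have *: "(pd j ^^ k) (\<lambda>_. 0) = (\<lambda>_. 0)" for j :: "'a" and k by (induction k) (auto simp: pd_zero)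
  have "fold (\<lambda>j. pd j ^^ \<beta> j) xs (\<lambda>_. 0) = (\<lambda>_. 0)" for xs
    by (induction xs) (auto simp: *)
  then show ?thesis by (simp add: mpd_def)
qed

lemma weyl_apply_zero:
  assumes "agree_on S f (\<lambda>_. 0)" "x \<in> S" shows "weyl_apply Q f x = 0"
proof -
  have "mpd \<beta> f x = 0" for \<beta>
    using mpd_cong[OF assms(1), of \<beta>] assms(2) by (simp add: agree_on_def mpd_zero)
  then show ?thesis unfolding weyl_apply_def by (intro sum.neutral) auto
qed

lemma holo_on_subset: "holo_on f S \<Longrightarrow> open T \<Longrightarrow> T \<subseteq> S \<Longrightarrow> holo_on f T"
  by (auto simp: holo_on_def)

lemma holo_on_continuous: "holo_on f S \<Longrightarrow> continuous_on S f"
  unfolding holo_on_def by (meson continuous_at_imp_continuous_on has_derivative_continuous)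

subsection \<open>Germs and the identity theorem\<close>

lemma germ_eq_iff: "germ p f = germ p g \<longleftrightarrow> (\<forall>\<^sub>F x in nhds p. f x = g x)"
proof
  assume "germ p f = germ p g"
  moreover have "f \<in> germ p f" by (simp add: germ_def)
  ultimately show "\<forall>\<^sub>F x in nhds p. f x = g x" by (simp add: germ_def)
next
  assume *: "\<forall>\<^sub>F x in nhds p. f x = g x"
  show "germ p f = germ p g" unfolding germ_def
  proof (intro Collect_cong iffI)
    fix h assume "\<forall>\<^sub>F x in nhds p. h x = f x"
    then show "\<forall>\<^sub>F x in nhds p. h x = g x" using * by eventually_elim simp
  next
    fix h assume "\<forall>\<^sub>F x in nhds p. h x = g x"
    then show "\<forall>\<^sub>F x in nhds p. h x = f x" using * by eventually_elim simp
  qed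
qed

lemma germ_eqI: "open S \<Longrightarrow> p \<in> S \<Longrightarrow> (\<And>x. x \<in> S \<Longrightarrow> f x = g x) \<Longrightarrow> germ p f = germ p g"
  unfolding germ_eq_iff eventually_nhds by blast

lemma holo_on_diff: "holo_on f S \<Longrightarrow> holo_on g S \<Longrightarrow> holo_on (\<lambda>x. f x - g x) S"
  using has_gradient_add[OF _ has_gradient_cmult[of _ _ _ "-1"]]
  unfolding holo_on_iff_has_gradient by (simp, blast)

text \<open>Reduction to one variable: on the complex line through \<open>x1\<close> and
  \<open>x\<close>, the parameters that lead into the ball form a convex open set, where the
  classical identity theorem applies.\<close>

lemma holo_ball_identity_zero:
  assumes h: "holo_on f (ball q e)" and x: "x1 \<in> ball q e" "x \<in> ball q e"
    and z: "\<forall>\<^sub>F y in nhds x1. f y = 0"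
  shows "f x = 0"
proof -
  define l where "l z = x1 + z *s (x - x1)" for z :: complex
  have cl: "continuous_on UNIV l"
    unfolding l_def continuous_on_eq_continuous_at[OF open_UNIV] using isCont_line by blast
  define U where "U = l -` ball q e"
  have oU: "open U" unfolding U_def using cl by (simp add: open_vimage continuous_on_eq_continuous_at)
  have cU: "convex U"
    unfolding convex_alt
  proof (intro ballI allI impI)
    fix a b :: complex and u :: real assume *: "a \<in> U" "b \<in> U" "0 \<le> u \<and> u \<le> 1"
    have "l ((1 - u) *\<^sub>R a + u *\<^sub>R b) = (1 - u) *\<^sub>R l a + u *\<^sub>R l b"
      unfolding l_def vec_eq_iff vector_add_component vector_scaleR_component
        vector_smult_component vector_minus_component
      by (simp add: scaleR_conv_of_real algebra_simps)
    then show "(1 - u) *\<^sub>R a + u *\<^sub>R b \<in> U"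
      using * convexD_alt[OF convex_ball, of "l a" q e "l b" u] by (simp add: U_def)
  qed
  have 01: "0 \<in> U" "1 \<in> U" using x by (auto simp: U_def l_def)
  have hol: "(\<lambda>z. f (l z)) holomorphic_on U"
    unfolding holomorphic_on_open[OF oU]
  proof
    fix z assume "z \<in> U"
    then obtain D where "has_gradient f D (l z)" using h unfolding holo_on_iff_has_gradient U_def by blast
    then show "\<exists>f'. ((\<lambda>z. f (l z)) has_field_derivative f') (at z)"
      unfolding l_def using has_gradient_line by blast
  qed
  have "filterlim l (nhds x1) (nhds 0)"
  proof -
    have "l \<midarrow>0\<rightarrow> l 0" using cl continuous_on_eq_continuous_at[of UNIV l] by (auto simp: isCont_def)
    moreover have "l 0 = x1" by (simp add: l_def)
    ultimately show ?thesis using tendsto_at_iff_tendsto_nhds[of l 0] by simp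
  qed
  then have "\<forall>\<^sub>F z in nhds 0. f (l z) = 0"
    using z filterlim_iff[THEN iffD1, THEN spec[where x="\<lambda>y. f y = 0"]] by blast
  then obtain V where V: "open V" "0 \<in> V" "\<And>z. z \<in> V \<Longrightarrow> f (l z) = 0"
    unfolding eventually_nhds by blast
  have "f (l 1) = 0"
  proof (rule analytic_continuation_open[of "U \<inter> V" U "\<lambda>z. f (l z)" "\<lambda>_. 0" 1])
    show "connected U" using cU by (rule convex_connected)
  qed (use V oU 01 hol in auto)
  then show ?thesis by (simp add: l_def)
qed

lemma holo_ball_identity:
  assumes "holo_on f (ball q e)" "holo_on g (ball q e)" "x1 \<in> ball q e"
    and "germ x1 f = germ x1 g" "x \<in> ball q e"
  shows "f x = g x"
  using holo_ball_identity_zero[OF holo_on_diff[OF assms(1,2)] assms(3,5)] assms(4)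
  by (simp add: germ_eq_iff)

subsection \<open>Normalised circle integrals\<close>

definition circ_int :: "complex \<Rightarrow> real \<Rightarrow> (complex \<Rightarrow> complex) \<Rightarrow> complex" where
  "circ_int c r f = contour_integral (circlepath c r) f / (2 * of_real pi * \<i>)"

lemma circ_int_integral:
  "circ_int c r f = integral {0..1} (\<lambda>t. f (c + of_real r * cis (2*pi*t)) * (of_real r * cis (2*pi*t)))"
proof -
  have "contour_integral (circlepath c r) f =
    integral {0..1} (\<lambda>t. (2 * of_real pi * \<i>) * (f (c + of_real r * cis (2*pi*t)) * (of_real r * cis (2*pi*t))))"
    unfolding contour_integral_integral vector_derivative_circlepath
    by (intro integral_cong) (simp add: circlepath cis_conv_exp algebra_simps)
  then show ?thesis by (simp add: circ_int_def)
qed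

lemma circ_int_cong: "0 \<le> r \<Longrightarrow> (\<And>w. w \<in> sphere c r \<Longrightarrow> f w = g w) \<Longrightarrow> circ_int c r f = circ_int c r g"
  unfolding circ_int_def by (subst contour_integral_cong[of _ "circlepath c r" f g]) auto

lemma circ_int_add:
  assumes "continuous_on (sphere c r) f" "continuous_on (sphere c r) g" "0 \<le> r"
  shows "circ_int c r (\<lambda>w. f w + g w) = circ_int c r f + circ_int c r g"
  unfolding circ_int_def using assms
  by (subst contour_integral_add)
     (auto intro!: contour_integrable_continuous_circlepath simp: add_divide_distrib)

lemma circ_int_cmult: "circ_int c r (\<lambda>w. k * f w) = k * circ_int c r f"
  unfolding circ_int_integral by (simp add: mult.assoc)

lemma circ_int_diff:
  assumes "continuous_on (sphere c r) f" "continuous_on (sphere c r) g" "0 \<le> r"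
  shows "circ_int c r (\<lambda>w. f w - g w) = circ_int c r f - circ_int c r g"
  unfolding circ_int_def using assms
  by (subst contour_integral_diff)
     (auto intro!: contour_integrable_continuous_circlepath simp: diff_divide_distrib)

lemma circ_int_sum:
  assumes "\<And>i. i \<in> I \<Longrightarrow> continuous_on (sphere c r) (f i)" "0 \<le> r" "finite I"
  shows "circ_int c r (\<lambda>w. \<Sum>i\<in>I. f i w) = (\<Sum>i\<in>I. circ_int c r (f i))"
  using assms(3,1)
proof (induction I rule: finite_induct)
  case empty
  show ?case by (simp add: circ_int_integral)
next
  case (insert i I)
  then show ?case using assms(2) by (simp add: circ_int_add continuous_on_sum)
qed

lemma circ_int_primitive:
  assumes "\<And>w. w \<in> sphere c r \<Longrightarrow> (F has_field_derivative f w) (at w)" "0 \<le> r"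
  shows "circ_int c r f = 0"
proof -
  have "(f has_contour_integral (F (pathfinish (circlepath c r)) - F (pathstart (circlepath c r)))) (circlepath c r)"
    by (rule contour_integral_primitive[of "sphere c r"])
       (use assms in \<open>auto intro: has_field_derivative_at_within\<close>)
  then show ?thesis by (simp add: circ_int_def contour_integral_unique)
qed

lemma circ_int_Cauchy:
  assumes "f holomorphic_on ball c R" "r < R" "y \<in> ball c r"
  shows "circ_int c r (\<lambda>w. f w / (w - y)) = f y"
proof -
  have "cball c r \<subseteq> ball c R" using assms(2) by auto
  then have "continuous_on (cball c r) f" "f holomorphic_on ball c r"
    using assms(1) by (meson continuous_on_subset holomorphic_on_imp_continuous_on)
      (use assms in \<open>auto elim!: holomorphic_on_subset\<close>)
  then have "((\<lambda>w. f w / (w - y)) has_contour_integral (2 * of_real pi * \<i> * f y)) (circlepath c r)"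
    by (rule Cauchy_integral_circlepath) (use assms(3) in \<open>auto simp: dist_norm norm_minus_commute\<close>)
  then show ?thesis by (simp add: circ_int_def contour_integral_unique)
qed

lemma circ_int_holomorphic:
  assumes "f holomorphic_on ball c R" "0 \<le> r" "r < R"
  shows "circ_int c r f = 0"
proof -
  have "(f has_contour_integral 0) (circlepath c r)"
    by (rule Cauchy_theorem_disc_simple[OF assms(1)]) (use assms in auto)
  then show ?thesis by (simp add: circ_int_def contour_integral_unique)
qed

lemma circ_int_continuous:
  fixes f :: "'a::topological_space \<Rightarrow> complex \<Rightarrow> complex"
  assumes "continuous_on (X \<times> sphere c r) (\<lambda>(x, w). f x w)" "0 \<le> r"
  shows "continuous_on X (\<lambda>x. circ_int c r (f x))"
proof -
  define h where "h = (\<lambda>(x::'a, t::real). (x, c + of_real r * cis (2*pi*t)))"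
  have h: "continuous_on (X \<times> cbox 0 1) h"
    unfolding h_def case_prod_unfold by (intro continuous_intros)
  have "continuous_on (X \<times> cbox 0 1) (\<lambda>z. (\<lambda>(x, w). f x w) (h z))"
    by (rule continuous_on_compose2[OF assms(1) h])
       (use assms(2) in \<open>auto simp: h_def dist_norm norm_mult\<close>)
  then have "continuous_on (X \<times> cbox 0 1) (\<lambda>(x, t). f x (c + of_real r * cis (2*pi*t)) * (of_real r * cis (2*pi*t)))"
    unfolding h_def case_prod_unfold by (auto intro!: continuous_intros)
  from integral_continuous_on_param[OF this] show ?thesis by (simp add: circ_int_integral)
qed

lemma circ_int_scale:
  "circ_int (a + of_real \<tau> * u) (\<tau> * \<rho>) f = of_real \<tau> * circ_int u \<rho> (\<lambda>z. f (a + of_real \<tau> * z))"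
  unfolding circ_int_integral by (simp flip: integral_mult_right add: algebra_simps)

text \<open>Tube lemma: circles that avoid the zeros for one parameter avoid them for all nearby
  parameters.\<close>

lemma nonzero_near_compact:
  fixes H :: "'a::euclidean_space \<Rightarrow> complex \<Rightarrow> complex"
  assumes "continuous_on UNIV (\<lambda>z. H (fst z) (snd z))" "compact C" "\<And>w. w \<in> C \<Longrightarrow> H x w \<noteq> 0"
  obtains X where "open X" "x \<in> X" "\<And>y w. y \<in> X \<Longrightarrow> w \<in> C \<Longrightarrow> H y w \<noteq> 0"
proof -
  have op: "open {z. H (fst z) (snd z) \<noteq> 0}"
    by (intro open_Collect_neq assms(1) continuous_intros)
  have "{x} \<times> C \<subseteq> {z. H (fst z) (snd z) \<noteq> 0}" using assms(3) by auto
  then obtain X W where "open X" "x \<in> X" "C \<subseteq> W" "X \<times> W \<subseteq> {z. H (fst z) (snd z) \<noteq> 0}"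
    using tube_lemma_right[of euclidean euclidean "{z. H (fst z) (snd z) \<noteq> 0}" C x] op assms(2)
    by (auto simp: compactin_euclidean_iff)
  then show ?thesis using that[of X] by fastforce
qed

subsection \<open>Integrals of powers of the polynomial\<close>

text \<open>The Mellin system is invariant under \<open>x\<^sub>j \<mapsto> eps\<^sub>j x\<^sub>j\<close> with \<open>eps\<^sub>j\<^sup>m = 1\<close>, so each such twist of the
  algebraic equation yields solutions.\<close>

locale mellin_equation =
  fixes m :: nat and ms :: "'n::{finite,linorder} \<Rightarrow> nat" and eps :: "'n \<Rightarrow> complex"
  assumes ms_less: "\<And>j. ms j < m" and ms_pos: "\<And>j. 0 < ms j"
    and eps_pow: "\<And>j. eps j ^ m = 1"
begin

definition cp :: "'n point \<Rightarrow> complex \<Rightarrow> complex" where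
  "cp x w = w ^ m + (\<Sum>j\<in>UNIV. eps j * x $ j * w ^ ms j) - 1"

definition cp' :: "'n point \<Rightarrow> complex \<Rightarrow> complex" where
  "cp' x w = of_nat m * w ^ (m - 1) + (\<Sum>j\<in>UNIV. eps j * x $ j * (of_nat (ms j) * w ^ (ms j - 1)))"

lemma m_pos: "0 < m" using ms_less[of undefined] by simp

lemma m_ge2: "2 \<le> m" using ms_less[of undefined] ms_pos[of undefined] by simp

lemma eps_nonzero: "eps j \<noteq> 0"
  using eps_pow[of j] m_pos by (metis power_0_left less_numeral_extra(3) zero_neq_one)

lemma cp_deriv: "(cp x has_field_derivative cp' x w) (at w)"
proof -
  have "((\<lambda>w. w ^ m + (\<Sum>j\<in>UNIV. eps j * x $ j * w ^ ms j) - 1) has_field_derivative cp' x w) (at w)"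
    unfolding cp'_def by (auto intro!: derivative_eq_intros sum.cong)
  then show ?thesis by (simp add: cp_def[abs_def])
qed

lemma cp_continuous_compose:
  "continuous_on X f \<Longrightarrow> continuous_on X g \<Longrightarrow> continuous_on X (\<lambda>z. cp (f z) (g z))"
  unfolding cp_def by (intro continuous_intros)

lemma cp_diff: "cp x w - cp y w = (\<Sum>j\<in>UNIV. (x $ j - y $ j) * (eps j * w ^ ms j))"
  by (simp add: cp_def algebra_simps sum_subtractf)

text \<open>The circles stay fixed while x moves; on this set every integrand is continuous along
  them.\<close>

definition circ_dom :: "complex set \<Rightarrow> real \<Rightarrow> 'n point set" where
  "circ_dom A r = {x. \<forall>a\<in>A. \<forall>w\<in>sphere a r. cp x w \<noteq> 0}"

lemma open_circ_dom:
  assumes "finite A" shows "open (circ_dom A r)"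
proof -
  define C where "C = (\<Union>a\<in>A. sphere a r)"
  have "compact C" unfolding C_def using assms by (intro compact_UN) auto
  show ?thesis
    unfolding open_contains_ball
  proof
    fix x assume x: "x \<in> circ_dom A r"
    have cont: "continuous_on UNIV (\<lambda>z. cp (fst z) (snd z))"
      by (intro cp_continuous_compose continuous_intros)
    have "cp x w \<noteq> 0" if "w \<in> C" for w using x that by (auto simp: circ_dom_def C_def)
    then obtain X where X: "open X" "x \<in> X" "\<And>y w. y \<in> X \<Longrightarrow> w \<in> C \<Longrightarrow> cp y w \<noteq> 0"
      using nonzero_near_compact[OF cont \<open>compact C\<close>] by blast
    then have "X \<subseteq> circ_dom A r" unfolding circ_dom_def C_def by blast
    then show "\<exists>e>0. ball x e \<subseteq> circ_dom A r" using X(1,2) by (meson open_contains_ball order_trans)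
  qed
qed

text \<open>The numerator may depend on the circle, since different discs carry different constants
  and different branches of the logarithm.\<close>

definition K :: "complex set \<Rightarrow> real \<Rightarrow> (complex \<Rightarrow> complex \<Rightarrow> complex) \<Rightarrow> nat \<Rightarrow> 'n cfun" where
  "K A r g k x = (\<Sum>a\<in>A. circ_int a r (\<lambda>w. g a w / cp x w ^ k))"

end

section \<open>Relations between the circle integrals\<close>

locale mellin_circles = mellin_equation m ms eps
  for m and ms :: "'n::{finite,linorder} \<Rightarrow> nat" and eps +
  fixes A :: "complex set" and r R :: real
  assumes finA: "finite A" and r_pos: "0 < r" and rR: "r < R"
begin

abbreviation "cdom \<equiv> circ_dom A r"

definition hol_family :: "(complex \<Rightarrow> complex \<Rightarrow> complex) \<Rightarrow> bool" where
  "hol_family g \<longleftrightarrow> (\<forall>a\<in>A. g a holomorphic_on ball a R)"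

lemma hol_family_cont: "hol_family g \<Longrightarrow> a \<in> A \<Longrightarrow> continuous_on (sphere a r) (g a)"
  unfolding hol_family_def
  by (rule continuous_on_subset[OF holomorphic_on_imp_continuous_on]) (use rR in auto)

lemma hol_family_mult: "hol_family f \<Longrightarrow> hol_family g \<Longrightarrow> hol_family (\<lambda>a w. f a w * g a w)"
  unfolding hol_family_def by (auto intro!: holomorphic_intros)

lemma hol_family_power: "hol_family (\<lambda>a w. w ^ k)"
  unfolding hol_family_def by (auto intro!: holomorphic_intros)

lemma hol_family_const: "hol_family (\<lambda>a w. c a)"
  unfolding hol_family_def by (auto intro!: holomorphic_intros)

lemmas hol_family_intros = hol_family_mult hol_family_power hol_family_const

lemma K_integrand_cont:
  assumes "hol_family g" "x \<in> cdom" "a \<in> A"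
  shows "continuous_on (sphere a r) (\<lambda>w. g a w / cp x w ^ k)"
  using assms by (intro continuous_intros cp_continuous_compose hol_family_cont)
    (auto simp: circ_dom_def)

lemma K_add:
  assumes "hol_family f" "hol_family g" "x \<in> cdom"
  shows "K A r (\<lambda>a w. f a w + g a w) k x = K A r f k x + K A r g k x"
  unfolding K_def sum.distrib[symmetric] add_divide_distrib
  by (intro sum.cong refl circ_int_add K_integrand_cont) (use assms r_pos in auto)

lemma K_diff:
  assumes "hol_family f" "hol_family g" "x \<in> cdom"
  shows "K A r (\<lambda>a w. f a w - g a w) k x = K A r f k x - K A r g k x"
  unfolding K_def sum_subtractf[symmetric] diff_divide_distrib
  by (intro sum.cong refl circ_int_diff K_integrand_cont) (use assms r_pos in auto)

lemma K_cmult: "K A r (\<lambda>a w. c * g a w) k x = c * K A r g k x"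
  unfolding K_def sum_distrib_left
  by (intro sum.cong refl) (simp add: circ_int_cmult[symmetric] mult.assoc)

lemma K_sum:
  assumes "\<And>i. i \<in> I \<Longrightarrow> hol_family (f i)" "x \<in> cdom" "finite I"
  shows "K A r (\<lambda>a w. \<Sum>i\<in>I. f i a w) k x = (\<Sum>i\<in>I. K A r (f i) k x)"
  unfolding K_def sum_divide_distrib
  by (subst sum.swap, intro sum.cong refl circ_int_sum K_integrand_cont) (use assms r_pos in auto)

lemma K_cong:
  "(\<And>a w. a \<in> A \<Longrightarrow> w \<in> sphere a r \<Longrightarrow> f a w / cp x w ^ k = g a w / cp x w ^ l) \<Longrightarrow> K A r f k x = K A r g l x"
  unfolding K_def by (intro sum.cong refl circ_int_cong) (use r_pos in auto)

lemma K_0: "hol_family g \<Longrightarrow> K A r g 0 x = 0"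
  unfolding K_def hol_family_def
  by (intro sum.neutral ballI) (use r_pos rR in \<open>auto intro!: circ_int_holomorphic[of _ _ R]\<close>)

text \<open>Numerator and denominator are multiplied by \<open>cp x w\<close>.\<close>

lemma K_expand:
  assumes "hol_family g" "x \<in> cdom"
  shows "K A r g k x = K A r (\<lambda>a w. w ^ m * g a w) (Suc k) x
    + (\<Sum>j\<in>UNIV. eps j * x $ j * K A r (\<lambda>a w. w ^ ms j * g a w) (Suc k) x) - K A r g (Suc k) x"
proof -
  have "K A r g k x = K A r (\<lambda>a w. (w ^ m * g a w
      + (\<Sum>j\<in>UNIV. eps j * x $ j * (w ^ ms j * g a w))) - g a w) (Suc k) x"
  proof (rule K_cong)
    fix a w assume "a \<in> A" "w \<in> sphere a r"
    then have nz: "cp x w \<noteq> 0" using assms(2) by (auto simp: circ_dom_def)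
    have "(w ^ m * g a w + (\<Sum>j\<in>UNIV. eps j * x $ j * (w ^ ms j * g a w))) - g a w
      = g a w * cp x w"
      by (simp add: cp_def algebra_simps sum_distrib_left)
    then show "g a w / cp x w ^ k = ((w ^ m * g a w
      + (\<Sum>j\<in>UNIV. eps j * x $ j * (w ^ ms j * g a w))) - g a w) / cp x w ^ Suc k"
      using nz by simp
  qed
  also have "\<dots> = K A r (\<lambda>a w. w ^ m * g a w) (Suc k) x
    + (\<Sum>j\<in>UNIV. K A r (\<lambda>a w. eps j * x $ j * (w ^ ms j * g a w)) (Suc k) x) - K A r g (Suc k) x"
    using assms by (subst K_diff, (auto simp: hol_family_def intro!: holomorphic_intros)[3],
       subst K_add, (auto simp: hol_family_def intro!: holomorphic_intros)[3],
       subst K_sum) (auto simp: hol_family_def intro!: holomorphic_intros)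
  finally show ?thesis by (simp add: K_cmult)
qed

text \<open>The derivative of \<open>g a w / cp x w ^ k\<close> has integral 0 over a closed
  circle.\<close>

lemma K_by_parts:
  assumes g: "\<And>a w. a \<in> A \<Longrightarrow> w \<in> ball a R \<Longrightarrow> (g a has_field_derivative g' a w) (at w)"
    and g': "hol_family g'" and x: "x \<in> cdom"
  shows "K A r g' k x = of_nat k * (of_nat m * K A r (\<lambda>a w. w ^ (m - 1) * g a w) (Suc k) x
    + (\<Sum>j\<in>UNIV. eps j * x $ j * (of_nat (ms j) * K A r (\<lambda>a w. w ^ (ms j - 1) * g a w) (Suc k) x)))"
proof -
  have hg: "hol_family g" unfolding hol_family_def
    using g unfolding holomorphic_on_open[OF open_ball] by blast
  note hi = hol_family_intros hg g'
  define G where "G a w = of_nat m * (w ^ (m - 1) * g a w) +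
     (\<Sum>j\<in>UNIV. (eps j * x $ j * of_nat (ms j)) * (w ^ (ms j - 1) * g a w))" for a w
  have G: "G a w = cp' x w * g a w" for a w
    by (simp add: G_def cp'_def algebra_simps sum_distrib_left)
  have hG: "hol_family G" unfolding hol_family_def G_def
    using hg by (auto simp: hol_family_def intro!: holomorphic_intros)
  have "0 = (\<Sum>a\<in>A. circ_int a r (\<lambda>w. g' a w / cp x w ^ k - of_nat k * (G a w / cp x w ^ Suc k)))"
  proof (rule sum.neutral[symmetric], intro ballI)
    fix a assume a: "a \<in> A"
    show "circ_int a r (\<lambda>w. g' a w / cp x w ^ k - of_nat k * (G a w / cp x w ^ Suc k)) = 0"
    proof (rule circ_int_primitive[where F="\<lambda>w. g a w / cp x w ^ k"])
      fix w assume w: "w \<in> sphere a r"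
      then have nz: "cp x w \<noteq> 0" using x a by (auto simp: circ_dom_def)
      have "w \<in> ball a R" using w rR by auto
      from g[OF a this] cp_deriv[of x w]
      have "((\<lambda>w. g a w / cp x w ^ k) has_field_derivative
          (g' a w * cp x w ^ k - g a w * (of_nat k * cp x w ^ (k - 1) * cp' x w)) / (cp x w ^ k * cp x w ^ k)) (at w)"
        using nz by (auto intro!: derivative_eq_intros simp: power_eq_0_iff)
      moreover have "(g' a w * cp x w ^ k - g a w * (of_nat k * cp x w ^ (k - 1) * cp' x w)) / (cp x w ^ k * cp x w ^ k)
         = g' a w / cp x w ^ k - of_nat k * (G a w / cp x w ^ Suc k)"
        using nz by (cases k) (simp_all add: G field_simps)
      ultimately show "((\<lambda>w. g a w / cp x w ^ k) has_field_derivative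
          g' a w / cp x w ^ k - of_nat k * (G a w / cp x w ^ Suc k)) (at w)" by simp
    qed (use r_pos in simp)
  qed
  also have "\<dots> = (\<Sum>a\<in>A. circ_int a r (\<lambda>w. g' a w / cp x w ^ k) - of_nat k * circ_int a r (\<lambda>w. G a w / cp x w ^ Suc k))"
    unfolding circ_int_cmult[symmetric]
    using r_pos by (intro sum.cong refl circ_int_diff) (auto intro!: K_integrand_cont continuous_on_mult continuous_on_const g' hG x
         simp del: power_Suc times_divide_eq_right)
  also have "\<dots> = K A r g' k x - of_nat k * K A r G (Suc k) x"
    unfolding K_def by (simp add: sum_subtractf sum_distrib_left del: power_Suc)
  finally have 1: "K A r g' k x = of_nat k * K A r G (Suc k) x" by simp
  have "K A r G (Suc k) x = of_nat m * K A r (\<lambda>a w. w ^ (m - 1) * g a w) (Suc k) x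
     + (\<Sum>j\<in>UNIV. (eps j * x $ j * of_nat (ms j)) * K A r (\<lambda>a w. w ^ (ms j - 1) * g a w) (Suc k) x)"
    unfolding G_def
    apply (subst K_add)
    using hg x apply (auto simp: hol_family_def intro!: holomorphic_intros)[3]
    apply (subst K_sum)
    using hg x apply (auto simp: hol_family_def intro!: holomorphic_intros)[3]
    by (simp add: K_cmult)
  with 1 show ?thesis by (simp add: mult.assoc)
qed

text \<open>The increment of 1/P^k between x0 and y is -(P_y - P_x0) times a sum of k mixed products
  of 1/P_y and 1/P_x0. The first factor is linear in y - x0, the second is continuous in y and
  collapses to k / P_x0^(k+1) at y = x0.\<close>

lemma has_gradient_K:
  assumes g: "hol_family g" and x: "x0 \<in> cdom"
  shows "has_gradient (K A r g k)
     (\<lambda>j. - of_nat k * eps j * K A r (\<lambda>a w. w ^ ms j * g a w) (Suc k) x0) x0"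
proof -
  define G where "G j x = - eps j * (\<Sum>a\<in>A. circ_int a r (\<lambda>w. w ^ ms j * g a w *
      (\<Sum>i<k. 1 / (cp x w ^ Suc i * cp x0 w ^ (k - i)))))" for j x
  have cont: "continuous_on cdom (G j)" for j
    unfolding G_def
  proof (intro continuous_on_sum continuous_on_mult continuous_on_const circ_int_continuous)
    fix a assume a: "a \<in> A"
    have "continuous_on (cdom \<times> sphere a r) (\<lambda>z. g a (snd z))"
      by (rule continuous_on_compose2[OF hol_family_cont[OF g a]]) (auto intro: continuous_intros)
    then show "continuous_on (cdom \<times> sphere a r) (\<lambda>(x, w). w ^ ms j * g a w *
      (\<Sum>i<k. 1 / (cp x w ^ Suc i * cp x0 w ^ (k - i))))"
      unfolding case_prod_unfold
      by (intro continuous_intros cp_continuous_compose)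
         (use a x in \<open>auto simp: circ_dom_def\<close>)
  qed (use r_pos in simp)
  have "has_gradient (K A r g k) (\<lambda>j. G j x0) x0"
  proof (rule has_gradient_Caratheodory[of cdom x0 "K A r g k" G])
    show "open cdom" by (rule open_circ_dom[OF finA])
    show "x0 \<in> cdom" by (rule x)
    show "continuous (at x0) (G j)" for j
      using cont[of j] \<open>open cdom\<close> x by (simp add: continuous_on_eq_continuous_at)
    fix y assume y: "y \<in> cdom"
    have "K A r g k y - K A r g k x0 = (\<Sum>a\<in>A. circ_int a r (\<lambda>w. g a w / cp y w ^ k - g a w / cp x0 w ^ k))"
    proof -
      have "circ_int a r (\<lambda>w. g a w / cp y w ^ k - g a w / cp x0 w ^ k) =
        circ_int a r (\<lambda>w. g a w / cp y w ^ k) - circ_int a r (\<lambda>w. g a w / cp x0 w ^ k)" if "a \<in> A" for a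
        using that r_pos g x y by (intro circ_int_diff K_integrand_cont) auto
      then show ?thesis by (simp add: K_def sum_subtractf)
    qed
    also have "\<dots> = (\<Sum>a\<in>A. circ_int a r (\<lambda>w. \<Sum>j\<in>UNIV. ((y $ j - x0 $ j) * (- eps j)) * (w ^ ms j * g a w *
      (\<Sum>i<k. 1 / (cp y w ^ Suc i * cp x0 w ^ (k - i))))))"
    proof (intro sum.cong refl circ_int_cong)
      fix a w assume a: "a \<in> A" and w: "w \<in> sphere a r"
      then have nz: "cp x0 w \<noteq> 0" "cp y w \<noteq> 0" using x y by (auto simp: circ_dom_def)
      have "1 / cp y w ^ k - 1 / cp x0 w ^ k = (1 / cp y w) ^ k - (1 / cp x0 w) ^ k"
        by (simp add: power_one_over)
      also have "\<dots> = (1 / cp y w - 1 / cp x0 w) * (\<Sum>i<k. (1 / cp x0 w) ^ (k - Suc i) * (1 / cp y w) ^ i)"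
        by (rule power_diff_sumr2)
      also have "1 / cp y w - 1 / cp x0 w = - (cp y w - cp x0 w) * (1 / (cp y w * cp x0 w))"
        using nz by (simp add: field_simps)
      also have "\<dots> * (\<Sum>i<k. (1 / cp x0 w) ^ (k - Suc i) * (1 / cp y w) ^ i)
        = - (cp y w - cp x0 w) * (\<Sum>i<k. 1 / (cp y w ^ Suc i * cp x0 w ^ (k - i)))"
        unfolding mult.assoc sum_distrib_left[of "1 / (cp y w * cp x0 w)"]
        using nz by (intro arg_cong2[where f="(*)"] refl sum.cong)
          (auto simp: power_one_over divide_simps Suc_diff_Suc[symmetric])
      finally have E: "1 / cp y w ^ k - 1 / cp x0 w ^ k =
          - (cp y w - cp x0 w) * (\<Sum>i<k. 1 / (cp y w ^ Suc i * cp x0 w ^ (k - i)))" .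
      have "g a w / cp y w ^ k - g a w / cp x0 w ^ k = (1 / cp y w ^ k - 1 / cp x0 w ^ k) * g a w"
        by (simp add: left_diff_distrib)
      also note E
      finally have "g a w / cp y w ^ k - g a w / cp x0 w ^ k =
          - (cp y w - cp x0 w) * (\<Sum>i<k. 1 / (cp y w ^ Suc i * cp x0 w ^ (k - i))) * g a w" .
      then show "g a w / cp y w ^ k - g a w / cp x0 w ^ k = (\<Sum>j\<in>UNIV. ((y $ j - x0 $ j) * (- eps j)) * (w ^ ms j * g a w *
      (\<Sum>i<k. 1 / (cp y w ^ Suc i * cp x0 w ^ (k - i)))))"
        unfolding cp_diff sum_negf[symmetric] sum_distrib_right[of _ UNIV]
        by (simp only: mult_ac minus_mult_left minus_mult_right)
    qed (use r_pos in simp)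
    also have "\<dots> = (\<Sum>a\<in>A. \<Sum>j\<in>UNIV. ((y $ j - x0 $ j) * (- eps j)) * circ_int a r (\<lambda>w. w ^ ms j * g a w *
      (\<Sum>i<k. 1 / (cp y w ^ Suc i * cp x0 w ^ (k - i)))))"
      unfolding circ_int_cmult[symmetric] using x y r_pos
      by (intro sum.cong refl circ_int_sum continuous_intros cp_continuous_compose hol_family_cont[OF g])
         (auto simp: circ_dom_def)
    also have "\<dots> = (\<Sum>j\<in>UNIV. (y $ j - x0 $ j) * G j y)"
      unfolding G_def by (subst sum.swap) (simp add: sum_distrib_left mult_ac)
    finally show "K A r g k y - K A r g k x0 = (\<Sum>j\<in>UNIV. (y $ j - x0 $ j) * G j y)" .
  qed
  moreover have "G j x0 = - of_nat k * eps j * K A r (\<lambda>a w. w ^ ms j * g a w) (Suc k) x0" for j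
  proof -
    have "(\<Sum>a\<in>A. circ_int a r (\<lambda>w. w ^ ms j * g a w * (\<Sum>i<k. 1 / (cp x0 w ^ Suc i * cp x0 w ^ (k - i)))))
      = (\<Sum>a\<in>A. circ_int a r (\<lambda>w. of_nat k * (w ^ ms j * g a w / cp x0 w ^ Suc k)))"
    proof (intro sum.cong refl circ_int_cong)
      fix a w
      have "(\<Sum>i<k. 1 / (cp x0 w ^ Suc i * cp x0 w ^ (k - i))) = (\<Sum>i<k. 1 / cp x0 w ^ Suc k)"
        by (intro sum.cong refl) (simp add: power_add[symmetric] del: power_Suc)
      then show "w ^ ms j * g a w * (\<Sum>i<k. 1 / (cp x0 w ^ Suc i * cp x0 w ^ (k - i))) = of_nat k * (w ^ ms j * g a w / cp x0 w ^ Suc k)"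
        by simp
    qed (use r_pos in simp)
    then have "G j x0 = - eps j * (\<Sum>a\<in>A. circ_int a r (\<lambda>w. of_nat k * (w ^ ms j * g a w / cp x0 w ^ Suc k)))"
      unfolding G_def by (simp only:)
    then show ?thesis unfolding circ_int_cmult sum_distrib_left[symmetric] K_def by simp
  qed
  ultimately show ?thesis by simp
qed

end

lemma theta_lin_has_gradient:
  "has_gradient f D x \<Longrightarrow> theta_lin a c f x = (\<Sum>i\<in>UNIV. of_nat (a i) * (x $ i * D i)) + c * f x"
  by (simp add: theta_lin_def theta_def pd_has_gradient)

lemma agree_on_trans: "agree_on S f g \<Longrightarrow> agree_on S g h \<Longrightarrow> agree_on S f h"
  by (simp add: agree_on_def)

text \<open>On each disc, \<open>h\<close> is a constant (\<open>kap = 0\<close>) or a constant plus a multiple of a branch of the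
  logarithm; \<open>h'\<close> is its derivative.\<close>

locale mellin_functional = mellin_circles m ms eps A r R
  for m and ms :: "'n::{finite,linorder} \<Rightarrow> nat" and eps and A and r R +
  fixes h h' :: "complex \<Rightarrow> complex \<Rightarrow> complex" and kap :: complex
  assumes h_deriv: "\<And>a w. a \<in> A \<Longrightarrow> w \<in> ball a R \<Longrightarrow> (h a has_field_derivative h' a w) (at w)"
    and h'_eq: "\<And>a w. a \<in> A \<Longrightarrow> w \<in> ball a R \<Longrightarrow> w * h' a w = kap"
begin

definition T :: "nat \<Rightarrow> nat \<Rightarrow> 'n cfun" where "T s k = K A r (\<lambda>a w. w ^ s * h a w) k"
definition U :: "nat \<Rightarrow> nat \<Rightarrow> 'n cfun" where "U s k = K A r (\<lambda>a w. w ^ s * 1) k"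

lemma hol_h: "hol_family h"
  unfolding hol_family_def holomorphic_on_open[OF open_ball] using h_deriv by blast

lemma hol_T: "hol_family (\<lambda>a w. w ^ s * h a w)"
  by (intro hol_family_intros hol_h)

lemma T_0: "T s 0 x = 0"
  unfolding T_def by (rule K_0[OF hol_T])

lemma T_expand:
  assumes "x \<in> cdom"
  shows "T s k x = T (s + m) (Suc k) x + (\<Sum>j\<in>UNIV. eps j * x $ j * T (s + ms j) (Suc k) x) - T s (Suc k) x"
  using K_expand[OF hol_T[of s] assms, of k]
  by (simp add: T_def power_add mult_ac)

text \<open>Integration by parts for \<open>w ^ Suc s * h a w\<close>. The rule
  \<open>w * h' = kap\<close> makes its derivative \<open>(s + 1) * w ^ s * h + kap * w ^ s\<close>,
  so a logarithm leaves a trace free of logarithms, namely \<open>U\<close>.\<close>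

lemma T_by_parts:
  assumes "x \<in> cdom"
  shows "of_nat (Suc s) * T s k x + kap * U s k x
    = of_nat k * (of_nat m * T (s + m) (Suc k) x + (\<Sum>j\<in>UNIV. eps j * x $ j * (of_nat (ms j) * T (s + ms j) (Suc k) x)))"
proof -
  have hp: "hol_family (\<lambda>a w. of_nat (Suc s) * (w ^ s * h a w))" "hol_family (\<lambda>a w. kap * (w ^ s * 1))"
    by (intro hol_family_intros hol_h)+
  have "of_nat (Suc s) * T s k x + kap * U s k x = K A r (\<lambda>a w. of_nat (Suc s) * (w ^ s * h a w) + kap * (w ^ s * 1)) k x"
    using K_add[OF hp assms, of k] by (simp add: T_def U_def K_cmult)
  also have "\<dots> = of_nat k * (of_nat m * K A r (\<lambda>a w. w ^ (m - 1) * (w ^ Suc s * h a w)) (Suc k) x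
    + (\<Sum>j\<in>UNIV. eps j * x $ j * (of_nat (ms j) * K A r (\<lambda>a w. w ^ (ms j - 1) * (w ^ Suc s * h a w)) (Suc k) x)))"
  proof (rule K_by_parts)
    show "hol_family (\<lambda>a w. of_nat (Suc s) * (w ^ s * h a w) + kap * (w ^ s * 1))"
      using hp by (auto simp: hol_family_def intro!: holomorphic_on_add)
    fix a w assume *: "a \<in> A" "w \<in> ball a R"
    have "((\<lambda>w. w ^ Suc s * h a w) has_field_derivative w ^ Suc s * h' a w + of_nat (Suc s) * w ^ s * h a w) (at w)"
      by (auto intro!: derivative_eq_intros h_deriv[OF *] simp del: power_Suc)
    moreover have "w ^ Suc s * h' a w + of_nat (Suc s) * w ^ s * h a w = of_nat (Suc s) * (w ^ s * h a w) + kap * (w ^ s * 1)"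
      using h'_eq[OF *] by (simp add: algebra_simps)
    ultimately show "((\<lambda>w. w ^ Suc s * h a w) has_field_derivative of_nat (Suc s) * (w ^ s * h a w) + kap * (w ^ s * 1)) (at w)"
      by (simp only:)
  qed (rule assms)
  finally have E: "of_nat (Suc s) * T s k x + kap * U s k x = of_nat k * (of_nat m * K A r (\<lambda>a w. w ^ (m - 1) * (w ^ Suc s * h a w)) (Suc k) x
    + (\<Sum>j\<in>UNIV. eps j * x $ j * (of_nat (ms j) * K A r (\<lambda>a w. w ^ (ms j - 1) * (w ^ Suc s * h a w)) (Suc k) x)))" .
  have e1: "(\<lambda>a w. w ^ (m - 1) * (w ^ Suc s * h a w)) = (\<lambda>a w. w ^ (s + m) * h a w)"
    using m_pos by (auto simp: mult.assoc[symmetric] power_add[symmetric] add.commute simp del: power_Suc intro!: ext)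
  have e2: "(\<lambda>a w. w ^ (ms j - 1) * (w ^ Suc s * h a w)) = (\<lambda>a w. w ^ (s + ms j) * h a w)" for j
    using ms_pos[of j] by (auto simp: mult.assoc[symmetric] power_add[symmetric] add.commute simp del: power_Suc intro!: ext)
  show ?thesis using E unfolding e1 e2 T_def .
qed

lemma has_gradient_T:
  assumes "x \<in> cdom"
  shows "has_gradient (T s k) (\<lambda>j. - of_nat k * eps j * T (s + ms j) (Suc k) x) x"
proof -
  have "(\<lambda>a w. w ^ ms j * (w ^ s * h a w)) = (\<lambda>a w. w ^ (s + ms j) * h a w)" for j
    by (auto simp: power_add mult_ac)
  then show ?thesis using has_gradient_K[OF hol_T[of s] assms, of k] by (simp only: T_def)
qed

definition U0 :: "'n cfun" where
  "U0 x = of_nat m * U m 1 x + (\<Sum>i\<in>UNIV. eps i * x $ i * (of_nat (ms i) * U (ms i) 1 x))"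

text \<open>The sum over all circles of the contour integral of \<open>w (h - kap) P'/P\<close>.\<close>

definition Y :: "'n cfun" where
  "Y x = of_nat m * T m 1 x + (\<Sum>i\<in>UNIV. eps i * x $ i * (of_nat (ms i) * T (ms i) 1 x)) - kap * U0 x"

end

text \<open>\<open>U\<close> is the instance h = 1, kap = 0 of \<open>T\<close>; all relations
  proved for \<open>T\<close> thereby hold for \<open>U\<close> without correction term.\<close>

sublocale mellin_functional \<subseteq> one: mellin_functional m ms eps A r R "\<lambda>_ _. 1" "\<lambda>_ _. 0" 0
  rewrites "mellin_functional.T m ms eps A r (\<lambda>_ _. 1) = mellin_functional.U m ms eps A r"
proof -
  show i: "mellin_functional m ms eps A r R (\<lambda>_ _. 1) (\<lambda>_ _. 0) 0" by unfold_locales auto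
  show "mellin_functional.T m ms eps A r (\<lambda>_ _. 1) = mellin_functional.U m ms eps A r"
    by (intro ext) (simp add: mellin_functional.T_def[OF i] U_def)
qed

context mellin_functional
begin

text \<open>The explicit factor x_j contributes \<open>ms j\<close> times \<open>T (ms j) 1\<close>,
  and integration by parts with s = \<open>ms j\<close> and k = 1 takes away \<open>ms j + 1\<close>
  times the same integral together with a \<open>U\<close>-term.\<close>

lemma has_gradient_Y':
  assumes x: "x \<in> cdom"
  shows "has_gradient (\<lambda>x. of_nat m * T m 1 x + (\<Sum>i\<in>UNIV. eps i * x $ i * (of_nat (ms i) * T (ms i) 1 x)))
     (\<lambda>j. - eps j * (T (ms j) 1 x + kap * U (ms j) 1 x)) x"
proof -
  have "has_gradient (\<lambda>x. of_nat m * T m 1 x + (\<Sum>i\<in>UNIV. (eps i * x $ i) * (of_nat (ms i) * T (ms i) 1 x)))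
     (\<lambda>j. of_nat m * (- of_nat 1 * eps j * T (m + ms j) (Suc 1) x) +
       (\<Sum>i\<in>UNIV. (eps i * x $ i) * (of_nat (ms i) * (- of_nat 1 * eps j * T (ms i + ms j) (Suc 1) x))
          + (eps i * (if j = i then 1 else 0)) * (of_nat (ms i) * T (ms i) 1 x))) x"
    by (intro has_gradient_add has_gradient_cmult has_gradient_sum has_gradient_mult has_gradient_T[OF x]
          has_gradient_coord)
  moreover have "of_nat m * (- of_nat 1 * eps j * T (m + ms j) (Suc 1) x) +
       (\<Sum>i\<in>UNIV. (eps i * x $ i) * (of_nat (ms i) * (- of_nat 1 * eps j * T (ms i + ms j) (Suc 1) x))
          + (eps i * (if j = i then 1 else 0)) * (of_nat (ms i) * T (ms i) 1 x))
     = - eps j * (T (ms j) 1 x + kap * U (ms j) 1 x)" (is "?L = _") for j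
  proof -
    have d: "(\<Sum>i\<in>UNIV. (eps i * (if j = i then 1 else 0)) * (of_nat (ms i) * T (ms i) 1 x))
        = eps j * (of_nat (ms j) * T (ms j) 1 x)"
    proof -
      have "(\<Sum>i\<in>UNIV. (eps i * (if j = i then 1 else 0)) * (of_nat (ms i) * T (ms i) 1 x))
        = (\<Sum>i\<in>UNIV. if j = i then eps i * (of_nat (ms i) * T (ms i) 1 x) else 0)"
        by (intro sum.cong) auto
      then show ?thesis by simp
    qed
    have "?L = eps j * (of_nat (ms j) * T (ms j) 1 x)
       - eps j * (of_nat m * T (ms j + m) (Suc 1) x + (\<Sum>i\<in>UNIV. eps i * x $ i * (of_nat (ms i) * T (ms j + ms i) (Suc 1) x)))"
      unfolding sum.distrib d
      by (simp add: sum_negf sum_distrib_left algebra_simps)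
    also have "\<dots> = eps j * (of_nat (ms j) * T (ms j) 1 x) - eps j * (of_nat (Suc (ms j)) * T (ms j) 1 x + kap * U (ms j) 1 x)"
      using T_by_parts[OF x, of "ms j" 1] by simp
    finally show ?thesis by (simp add: algebra_simps)
  qed
  ultimately show ?thesis by simp
qed

end

context mellin_functional
begin

lemma has_gradient_U0:
  assumes x: "x \<in> cdom"
  shows "has_gradient U0 (\<lambda>j. - eps j * U (ms j) 1 x) x"
  using one.has_gradient_Y'[OF x] unfolding U0_def[abs_def] by simp

text \<open>Because \<open>w * h' = kap\<close>, the function w (h - kap) is a primitive of h. So Y
  is formally minus the integral of h log P, and its derivatives are those of -log P integrated
  against h. This explains the summand \<open>- kap * U0\<close> in \<open>Y\<close>.\<close>

lemma has_gradient_Y: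
  assumes x: "x \<in> cdom"
  shows "has_gradient Y (\<lambda>j. - eps j * T (ms j) 1 x) x"
proof -
  have "has_gradient (\<lambda>x. (of_nat m * T m 1 x + (\<Sum>i\<in>UNIV. eps i * x $ i * (of_nat (ms i) * T (ms i) 1 x)))
      + (- kap) * U0 x)
     (\<lambda>j. - eps j * (T (ms j) 1 x + kap * U (ms j) 1 x) + (- kap) * (- eps j * U (ms j) 1 x)) x"
    by (intro has_gradient_add has_gradient_cmult has_gradient_U0 has_gradient_Y' x)
  then show ?thesis by (simp add: Y_def[abs_def] algebra_simps)
qed

lemma holo_on_Y: "holo_on Y cdom"
  unfolding holo_on_iff_has_gradient using open_circ_dom[OF finA] has_gradient_Y by blast

text \<open>Differentiation in x_j raises the order b by 1 and the exponent s by
  \<open>ms j\<close>. At order 0 the exponent is ignored, whence the side condition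
  \<open>b = 0 \<longrightarrow> s = 0\<close> in what follows.\<close>

definition level :: "nat \<Rightarrow> nat \<Rightarrow> 'n cfun" where
  "level s b = (if b = 0 then Y else (\<lambda>x. (-1) ^ b * fact (b - 1) * T s b x))"

lemma has_gradient_level:
  assumes "x \<in> cdom" "b = 0 \<longrightarrow> s = 0"
  shows "has_gradient (level s b) (\<lambda>j. eps j * level (s + ms j) (Suc b) x) x"
proof (cases b)
  case 0
  then show ?thesis using has_gradient_Y[OF assms(1)] assms(2) by (simp add: level_def)
next
  case (Suc k)
  have "has_gradient (\<lambda>x. ((-1) ^ b * fact (b - 1)) * T s b x)
     (\<lambda>j. ((-1) ^ b * fact (b - 1)) * (- of_nat b * eps j * T (s + ms j) (Suc b) x)) x"
    by (intro has_gradient_cmult has_gradient_T assms)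
  moreover have "((-1) ^ b * fact (b - 1)) * (- of_nat b * eps j * T (s + ms j) (Suc b) x)
      = eps j * level (s + ms j) (Suc b) x" for j
    using Suc by (simp add: level_def algebra_simps)
  ultimately show ?thesis using Suc by (simp add: level_def)
qed

lemma pd_pow_level:
  assumes "b = 0 \<longrightarrow> s = 0"
  shows "agree_on cdom ((pd j ^^ k) (\<lambda>x. c * level s b x)) (\<lambda>x. c * eps j ^ k * level (s + k * ms j) (b + k) x)"
proof (induction k)
  case 0
  show ?case using open_circ_dom[OF finA] by (simp add: agree_on_def)
next
  case (Suc k)
  have "pd j (\<lambda>x. c * eps j ^ k * level (s + k * ms j) (b + k) x) x =
     c * eps j ^ Suc k * level (s + Suc k * ms j) (b + Suc k) x" if x: "x \<in> cdom" for x
    using pd_has_gradient[OF has_gradient_cmult[OF has_gradient_level[OF x, of "b + k" "s + k * ms j"], of "c * eps j ^ k"], of j] assms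
    by (simp add: add_ac mult_ac)
  then have "agree_on cdom (pd j (\<lambda>x. c * eps j ^ k * level (s + k * ms j) (b + k) x))
     (\<lambda>x. c * eps j ^ Suc k * level (s + Suc k * ms j) (b + Suc k) x)"
    using open_circ_dom[OF finA] by (simp only: agree_on_def) simp
  from agree_on_trans[OF pd_cong[OF Suc, of j] this] show ?case by simp
qed

lemma mpd_Y:
  "agree_on cdom (mpd \<beta> Y)
    (\<lambda>x. (\<Prod>j\<in>UNIV. eps j ^ \<beta> j) * level (\<Sum>j\<in>UNIV. \<beta> j * ms j) (\<Sum>j\<in>UNIV. \<beta> j) x)"
proof -
  have "b = 0 \<longrightarrow> s = 0 \<Longrightarrow> distinct xs \<Longrightarrow> agree_on cdom (fold (\<lambda>j. pd j ^^ \<beta> j) xs (\<lambda>x. c * level s b x))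
    (\<lambda>x. (c * (\<Prod>j\<in>set xs. eps j ^ \<beta> j)) * level (s + (\<Sum>j\<in>set xs. \<beta> j * ms j)) (b + (\<Sum>j\<in>set xs. \<beta> j)) x)" for xs s b c
  proof (induction xs arbitrary: s b c)
    case Nil
    show ?case using open_circ_dom[OF finA] by (simp add: agree_on_def)
  next
    case (Cons j xs)
    have 1: "agree_on cdom (fold (\<lambda>j. pd j ^^ \<beta> j) (j # xs) (\<lambda>x. c * level s b x))
      (fold (\<lambda>j. pd j ^^ \<beta> j) xs (\<lambda>x. (c * eps j ^ \<beta> j) * level (s + \<beta> j * ms j) (b + \<beta> j) x))"
      unfolding fold_Cons o_def
      by (intro fold_cong_agree pd_pow_cong pd_pow_level) (use Cons.prems in auto)
    have 2: "b + \<beta> j = 0 \<longrightarrow> s + \<beta> j * ms j = 0" using Cons.prems by auto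
    from agree_on_trans[OF 1 Cons.IH[OF 2]] Cons.prems show ?case
      by (simp add: add_ac mult_ac)
  qed
  from this[of 0 0 "sorted_list_of_set UNIV" 1] show ?thesis
    by (simp add: mpd_def level_def cong: sum.cong)
qed

end

subsection \<open>Solutions of the Mellin system\<close>

lemma theta_lin_zero: "theta_lin a c (\<lambda>_. 0) = (\<lambda>_. 0)"
  by (rule ext) (simp add: theta_lin_has_gradient[OF has_gradient_const])

lemma theta_lin_cmult:
  assumes "has_gradient f D x"
  shows "theta_lin a c (\<lambda>x. k * f x) x = k * theta_lin a c f x"
  using theta_lin_has_gradient[OF assms] theta_lin_has_gradient[OF has_gradient_cmult[OF assms]]
  by (simp add: sum_distrib_left algebra_simps)

context mellin_functional
begin

text \<open>The weighted Euler derivative is -k times the x-sum of \<open>T_by_parts\<close>. The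
  constant c = s + 1 cancels both terms in \<open>T s k\<close>; this is the source of the constants
  m k + 1 in the Mellin system.\<close>

lemma theta_lin_ms_T:
  assumes x: "x \<in> cdom"
  shows "theta_lin ms c (T s k) x = of_nat k * of_nat m * T (s + m) (Suc k) x
     - (of_nat (Suc s) * T s k x + kap * U s k x) + c * T s k x"
proof -
  have "theta_lin ms c (T s k) x = - of_nat k * (\<Sum>j\<in>UNIV. eps j * x $ j * (of_nat (ms j) * T (s + ms j) (Suc k) x)) + c * T s k x"
    unfolding theta_lin_has_gradient[OF has_gradient_T[OF x]]
    by (simp add: sum_distrib_left algebra_simps sum_negf)
  then show ?thesis unfolding T_by_parts[OF x] by (simp add: algebra_simps)
qed

text \<open>The part with weight m is evaluated by \<open>T_expand\<close>, the part with weights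
  \<open>ms i\<close> by \<open>T_by_parts\<close>, and the terms in
  \<open>T (s + m) (Suc k)\<close> cancel. For s = 0 the constant c = m k - 1 leaves only a multiple
  of \<open>T 0 (Suc k)\<close>.\<close>

lemma theta_lin_ms'_T:
  assumes x: "x \<in> cdom"
  shows "theta_lin (\<lambda>i. m - ms i) c (T s k) x = (of_nat (Suc s) * T s k x + kap * U s k x)
     - of_nat (m * k) * (T s k x + T s (Suc k) x) + c * T s k x"
proof -
  define A where "A = (\<Sum>j\<in>UNIV. eps j * x $ j * T (s + ms j) (Suc k) x)"
  define B where "B = (\<Sum>j\<in>UNIV. eps j * x $ j * (of_nat (ms j) * T (s + ms j) (Suc k) x))"
  have "theta_lin (\<lambda>i. m - ms i) c (T s k) x = - of_nat k * (of_nat m * A - B) + c * T s k x"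
    unfolding theta_lin_has_gradient[OF has_gradient_T[OF x]] A_def B_def
    using ms_less by (simp add: of_nat_diff less_imp_le sum_distrib_left sum_subtractf[symmetric] sum_negf[symmetric] algebra_simps)
  moreover have "A = T s k x - T (s + m) (Suc k) x + T s (Suc k) x"
    unfolding A_def by (subst T_expand[OF x, of s k]) simp
  moreover have "of_nat (Suc s) * T s k x + kap * U s k x = of_nat k * (of_nat m * T (s + m) (Suc k) x + B)"
    unfolding B_def by (rule T_by_parts[OF x])
  ultimately show ?thesis by (simp add: algebra_simps)
qed

lemma theta_lin_ms'_Y:
  assumes x: "x \<in> cdom"
  shows "theta_lin (\<lambda>i. m - ms i) (-1) Y x = - of_nat m * T 0 1 x + kap * U0 x"
proof -
  define A where "A = (\<Sum>j\<in>UNIV. eps j * x $ j * T (ms j) 1 x)"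
  define B where "B = (\<Sum>j\<in>UNIV. eps j * x $ j * (of_nat (ms j) * T (ms j) 1 x))"
  have "theta_lin (\<lambda>i. m - ms i) (-1) Y x = - (of_nat m * A - B) - Y x"
    unfolding theta_lin_has_gradient[OF has_gradient_Y[OF x]] A_def B_def
    using ms_less by (simp add: of_nat_diff less_imp_le sum_distrib_left sum_subtractf[symmetric] sum_negf[symmetric] algebra_simps)
  moreover have "A = - T m 1 x + T 0 1 x"
    using T_expand[OF x, of 0 0] unfolding A_def by (simp add: T_0 algebra_simps)
  moreover have "Y x = of_nat m * T m 1 x + B - kap * U0 x"
    unfolding Y_def B_def ..
  ultimately show ?thesis by (simp add: algebra_simps)
qed

end

lemma theta_lin_eq_zero:
  assumes "open S" "\<And>x. x \<in> S \<Longrightarrow> f x = 0" "x \<in> S"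
  shows "theta_lin a c f x = 0"
  using theta_lin_cong[of S f "\<lambda>_. 0" a c] assms by (simp add: agree_on_def theta_lin_zero)

context mellin_functional
begin

context
  fixes S
  assumes S: "open S" "S \<subseteq> cdom" and U0_zero: "\<And>x. x \<in> S \<Longrightarrow> U0 x = 0"
begin

text \<open>A first order operator applied to a function that vanishes on an open set gives 0,
  whereas the relations for h = 1 evaluate it to a nonzero multiple of the next integral. So the
  vanishing of the sum of the roots spreads to all integrals that occur as correction terms.\<close>

lemma U_0_zero: "x \<in> S \<Longrightarrow> U 0 (Suc k) x = 0"
proof (induction k arbitrary: x)
  case 0
  have "one.Y = U0" by (rule ext) (simp add: one.Y_def U0_def)
  then have "of_nat m * U 0 1 x = 0"
    using one.theta_lin_ms'_Y[of x] theta_lin_eq_zero[OF S(1) U0_zero 0, where a="\<lambda>i. m - ms i" and c="-1"] 0 S(2)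
    by auto
  then show ?case using m_pos by simp
next
  case (Suc k)
  have "of_nat (m * Suc k) * U 0 (Suc (Suc k)) x = 0"
    using one.theta_lin_ms'_T[of x 0 0 "Suc k"] theta_lin_eq_zero[OF S(1) Suc.IH Suc.prems, where a="\<lambda>i. m - ms i" and c=0] Suc.prems S(2) Suc.IH[OF Suc.prems]
    by auto
  then show ?case using m_pos by (simp del: of_nat_mult of_nat_Suc of_nat_add mult_Suc_right)
qed

lemma U_m_zero: "x \<in> S \<Longrightarrow> U (m * i) (Suc k + i) x = 0"
proof (induction i arbitrary: x)
  case 0
  then show ?case using U_0_zero by simp
next
  case (Suc i)
  have "of_nat (Suc k + i) * of_nat m * U (m * i + m) (Suc (Suc k + i)) x = 0"
    using one.theta_lin_ms_T[of x 0 "m * i" "Suc k + i"] theta_lin_eq_zero[OF S(1) Suc.IH Suc.prems, where a=ms and c=0] Suc.prems S(2) Suc.IH[OF Suc.prems]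
    by auto
  then show ?case using m_pos by (simp add: add_ac del: of_nat_mult of_nat_Suc of_nat_add)
qed

end

context
  fixes S
  assumes S: "open S" "S \<subseteq> cdom" and kU0: "kap = 0 \<or> (\<forall>x\<in>S. U0 x = 0)"
begin

lemma kap_U: "x \<in> S \<Longrightarrow> kap * U (m * i) (Suc k + i) x = 0"
  using U_m_zero[OF S] kU0 by auto

lemma agree_theta_lin_T:
  assumes "\<And>x. x \<in> S \<Longrightarrow> theta_lin a c (T s k) x = d * T s' k' x"
  shows "agree_on S (theta_lin a c (\<lambda>x. q * T s k x)) (\<lambda>x. (q * d) * T s' k' x)"
proof -
  have "theta_lin a c (\<lambda>x. q * T s k x) x = (q * d) * T s' k' x" if "x \<in> S" for x
    using theta_lin_cmult[OF has_gradient_T[of x s k], of a c q] assms[OF that] S(2) that by auto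
  then show ?thesis using S(1) by (simp add: agree_on_def)
qed

text \<open>The factor with k = 0 turns \<open>Y\<close> into a multiple of \<open>T 0 1\<close>,
  and each later factor raises the order by 1 at exponent 0; the constants m k collect into the
  factorial.\<close>

lemma fold_inner:
  "agree_on S (fold (\<lambda>k. theta_lin (\<lambda>i. m - ms i) (of_nat (m * k) - 1)) [0..<Suc N] Y)
     (\<lambda>x. ((- of_nat m) ^ Suc N * fact N) * T 0 (Suc N) x)"
proof (induction N)
  case 0
  have "theta_lin (\<lambda>i. m - ms i) (-1) Y x = - of_nat m * T 0 1 x" if "x \<in> S" for x
    using theta_lin_ms'_Y[of x] S(2) that kU0 by auto
  then show ?case using S(1) by (simp add: agree_on_def)
next
  case (Suc N)
  have "theta_lin (\<lambda>i. m - ms i) (of_nat (m * Suc N) - 1) (T 0 (Suc N)) x = (- of_nat (m * Suc N)) * T 0 (Suc (Suc N)) x"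
    if "x \<in> S" for x
  proof -
    have "x \<in> cdom" using that S(2) by blast
    show ?thesis unfolding theta_lin_ms'_T[OF \<open>x \<in> cdom\<close>] using kap_U[OF that, of 0 N]
      by (auto simp: algebra_simps)
  qed
  note 1 = agree_theta_lin_T[OF this, where q = "(- of_nat m) ^ Suc N * fact N"]
  have "((- of_nat m) ^ Suc N * fact N) * (- of_nat (m * Suc N)) = (- of_nat m) ^ Suc (Suc N) * (fact (Suc N) :: complex)"
    by (simp add: algebra_simps)
  with 1
  have "agree_on S (theta_lin (\<lambda>i. m - ms i) (of_nat (m * Suc N) - 1) (\<lambda>x. ((- of_nat m) ^ Suc N * fact N) * T 0 (Suc N) x))
     (\<lambda>x. ((- of_nat m) ^ Suc (Suc N) * fact (Suc N)) * T 0 (Suc (Suc N)) x)"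
    by (simp only:)
  from agree_on_trans[OF theta_lin_cong[OF Suc] this]
  show ?case by (simp only: upt_Suc_append[OF le0[of "Suc N"]] fold_append fold_Cons fold_Nil o_def id_def)
qed

text \<open>Each factor raises the exponent by m and the order by 1; before the factor with index k
  is applied the exponent is m k, as its constant m k + 1 demands.\<close>

lemma fold_outer:
  assumes "agree_on S F (\<lambda>x. (q * fact N0) * T 0 (Suc N0) x)"
  shows "agree_on S (fold (\<lambda>k. theta_lin ms (of_nat (m * k) + 1)) [0..<N] F)
     (\<lambda>x. (q * of_nat m ^ N * fact (N0 + N)) * T (m * N) (Suc N0 + N) x)"
proof (induction N)
  case 0
  then show ?case using assms by simp
next
  case (Suc N)
  have "theta_lin ms (of_nat (m * N) + 1) (T (m * N) (Suc N0 + N)) x = (of_nat (Suc N0 + N) * of_nat m) * T (m * Suc N) (Suc N0 + Suc N) x"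
    if "x \<in> S" for x
  proof -
    have "x \<in> cdom" using that S(2) by blast
    from theta_lin_ms_T[OF this, of "of_nat (m * N) + 1" "m * N" "Suc N0 + N"] kap_U[OF that, of N N0]
    show ?thesis by (auto simp: algebra_simps)
  qed
  from agree_theta_lin_T[OF this, where q = "q * of_nat m ^ N * fact (N0 + N)"]
  have "agree_on S (theta_lin ms (of_nat (m * N) + 1) (\<lambda>x. (q * of_nat m ^ N * fact (N0 + N)) * T (m * N) (Suc N0 + N) x))
     (\<lambda>x. (q * of_nat m ^ Suc N * fact (N0 + Suc N)) * T (m * Suc N) (Suc N0 + Suc N) x)"
    by (simp add: mult_ac)
  from agree_on_trans[OF theta_lin_cong[OF Suc] this]
  show ?case by (simp only: upt_Suc_append[OF le0[of N]] fold_append fold_Cons fold_Nil o_def id_def)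
qed

text \<open>All m factors on the left and all m derivatives on the right end at
  \<open>T (m * ms j) m\<close>. Both sides carry (m-1)! m^m, and the signs agree because m -
  \<open>ms j\<close> and m + \<open>ms j\<close> have the same parity. The twist enters as
  \<open>eps j ^ m = 1\<close>.\<close>

theorem mellin_op_Y:
  assumes x: "x \<in> S"
  shows "mellin_op m ms j Y x = 0"
proof -
  obtain N0 where N0: "m - ms j = Suc N0" using ms_less[of j] by (metis Suc_diff_Suc)
  then have m: "m = Suc N0 + ms j" using ms_less[of j] by linarith
  have "agree_on S (fold (\<lambda>k. theta_lin (\<lambda>i. m - ms i) (of_nat (m * k) - 1)) [0..<m - ms j] Y)
     (\<lambda>x. ((- of_nat m) ^ Suc N0 * fact N0) * T 0 (Suc N0) x)"
    using fold_inner[of N0] N0 by simp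
  from fold_outer[OF this, of "ms j"] x
  have 1: "fold (\<lambda>k. theta_lin ms (of_nat (m * k) + 1)) [0..<ms j]
       (fold (\<lambda>k. theta_lin (\<lambda>i. m - ms i) (of_nat (m * k) - 1)) [0..<m - ms j] Y) x
     = ((- of_nat m) ^ Suc N0 * of_nat m ^ ms j * fact (N0 + ms j)) * T (m * ms j) m x"
    using m by (simp add: agree_on_def)
  have "agree_on cdom ((pd j ^^ m) (\<lambda>x. 1 * level 0 0 x)) (\<lambda>x. 1 * eps j ^ m * level (0 + m * ms j) (0 + m) x)"
    by (rule pd_pow_level) simp
  then have "(pd j ^^ m) (\<lambda>x. 1 * level 0 0 x) x = 1 * eps j ^ m * level (0 + m * ms j) (0 + m) x"
    using x S(2) by (auto simp: agree_on_def)
  moreover have "(\<lambda>x. 1 * level 0 0 x) = Y" by (simp add: level_def)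
  moreover have "m - 1 = N0 + ms j" using m by linarith
  then have "level (0 + m * ms j) (0 + m) x = (-1) ^ m * fact (N0 + ms j) * T (m * ms j) m x"
    using m_pos by (simp add: level_def)
  ultimately have 2: "(pd j ^^ m) Y x = (-1) ^ m * fact (N0 + ms j) * T (m * ms j) m x"
    by (simp add: eps_pow)
  have "(- of_nat m) ^ Suc N0 * of_nat m ^ ms j = (-1 :: complex) ^ Suc N0 * of_nat m ^ m"
  proof -
    have "(- of_nat m) ^ Suc N0 = (-1 :: complex) ^ Suc N0 * of_nat m ^ Suc N0"
      by (metis mult_minus1 power_mult_distrib)
    moreover have "of_nat m ^ m = of_nat m ^ Suc N0 * (of_nat m ^ ms j :: complex)"
      using arg_cong[OF m, of "(^) (of_nat m :: complex)"] by (simp only: power_add)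
    ultimately show ?thesis by (simp only: mult.assoc)
  qed
  then have e1: "(- of_nat m) ^ Suc N0 * of_nat m ^ ms j * fact (N0 + ms j) * T (m * ms j) m x
      = (-1) ^ Suc N0 * of_nat m ^ m * fact (N0 + ms j) * T (m * ms j) m x" by (simp only:)
  have e2: "(-1 :: complex) ^ ms j * (-1) ^ m = (-1) ^ Suc N0"
    by (subst m) (simp add: power_add mult_ac)
  have "(-1) ^ ms j * of_nat (m ^ m) * ((-1) ^ m * fact (N0 + ms j) * T (m * ms j) m x)
      = ((-1) ^ ms j * (-1) ^ m) * of_nat m ^ m * fact (N0 + ms j) * T (m * ms j) m x"
    by (simp only: of_nat_power mult_ac)
  then show ?thesis unfolding mellin_op_def 1 2 e1 e2 by simp
qed

end

end

subsection \<open>The discriminant and the singular locus\<close>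

context mellin_equation
begin

definition discriminant_locus :: "'n point set" where
  "discriminant_locus = {x. \<exists>w. cp x w = 0 \<and> cp' x w = 0}"

definition cpoly :: "'n point \<Rightarrow> complex poly" where
  "cpoly x = monom 1 m + (\<Sum>j\<in>UNIV. monom (eps j * x $ j) (ms j)) - 1"

lemma poly_cpoly: "poly (cpoly x) w = cp x w"
  by (simp add: cpoly_def cp_def poly_monom poly_sum)

lemma poly_pderiv_cpoly: "poly (pderiv (cpoly x)) w = cp' x w"
proof -
  have "(cp x has_field_derivative poly (pderiv (cpoly x)) w) (at w)"
    using poly_DERIV[of "cpoly x" w] by (simp add: poly_cpoly[abs_def])
  then show ?thesis using cp_deriv DERIV_unique by blast
qed

lemma cp_0: "cp x 0 = -1"
proof -
  have "(0 :: complex) ^ ms j = 0" for j using ms_pos[of j] by simp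
  note z = this
  show ?thesis unfolding cp_def z using m_pos by simp
qed

lemma cpoly_nonzero: "cpoly x \<noteq> 0"
  using cp_0[of x] poly_cpoly[of x 0] by auto

lemma root_nonzero: "cp x w = 0 \<Longrightarrow> w \<noteq> 0"
  using cp_0[of x] by auto

lemma factor_multiple_root:
  assumes "cp x w0 = 0" "cp' x w0 = 0"
  obtains d q where "2 \<le> d" "poly q w0 \<noteq> 0" "\<And>w. cp x w = (w - w0) ^ d * poly q w"
proof -
  obtain q where q: "cpoly x = [:- w0, 1:] ^ order w0 (cpoly x) * q" "\<not> [:- w0, 1:] dvd q"
    using order_decomp[OF cpoly_nonzero] by blast
  define d where "d = order w0 (cpoly x)"
  have q0: "poly q w0 \<noteq> 0" using q(2) by (simp add: poly_eq_0_iff_dvd)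
  have e: "cp x w = (w - w0) ^ d * poly q w" for w
    unfolding poly_cpoly[symmetric] d_def by (subst q(1)) (simp add: poly_power)
  have "d \<noteq> 0" using e[of w0] assms(1) q0 by (cases d) auto
  moreover have "d \<noteq> 1"
  proof
    assume d: "d = 1"
    have "((\<lambda>w. (w - w0) * poly q w) has_field_derivative poly q w0) (at w0)"
      by (auto intro!: derivative_eq_intros)
    moreover have "(\<lambda>w. (w - w0) * poly q w) = cp x" using e d by auto
    ultimately show False using cp_deriv[of x w0] assms(2) q0 DERIV_unique by metis
  qed
  ultimately show ?thesis using that[of d q] q0 e by force
qed

text \<open>
  If \<open>w0\<close> is a root of multiplicity \<open>d \<ge> 2\<close> at \<open>p\<close>, then along \<open>p + \<tau>\<^sup>d e\<^sub>j\<close> a root near \<open>w0\<close>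
  behaves like \<open>w0 + \<tau> u0\<close>, and its partial derivatives of order \<open>N\<close> blow up like
  \<open>\<tau>\<close> to the power \<open>1 - d N\<close>. An operator of order \<open>N\<close> that annihilates the root therefore has a
  principal symbol that vanishes at the covector \<open>(eps\<^sub>j w0\<^bsup>ms j\<^esup>)\<^sub>j\<close>.
\<close>

theorem discriminant_subset_singular:
  "discriminant_locus \<subseteq> singular_locus (mellin_op m ms)"
proof
  fix p assume "p \<in> discriminant_locus"
  then obtain w0 where w0: "cp p w0 = 0" "cp' p w0 = 0" by (auto simp: discriminant_locus_def)
  obtain d q where d: "2 \<le> d" and q: "poly q w0 \<noteq> 0" and fac: "\<And>w. cp p w = (w - w0) ^ d * poly q w"
    using factor_multiple_root[OF w0] by blast
  fix j0 :: 'n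
  define a b where "a = poly q w0" and "b = eps j0 * w0 ^ ms j0"
  have w0nz: "w0 \<noteq> 0" using root_nonzero[OF w0(1)] .
  have ab: "a \<noteq> 0" "b \<noteq> 0" using q w0nz eps_nonzero by (auto simp: a_def b_def)
  \<comment> \<open>With w = w0 + tau u, the shift by tau^d balances the factor (w - w0)^d: the
    whole polynomial becomes tau^d times \<open>H\<close>, which is regular at tau = 0.\<close>
  define X where "X \<tau> = p + of_real (\<tau> ^ d) *s axis j0 1" for \<tau> :: real
  define H where "H \<tau> u = u ^ d * poly q (w0 + of_real \<tau> * u) + eps j0 * (w0 + of_real \<tau> * u) ^ ms j0" for \<tau> :: real and u
  have Xj: "X \<tau> $ i = p $ i + (if i = j0 then of_real (\<tau> ^ d) else 0)" for \<tau> i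
    by (simp add: X_def axis_def)
  have cpX: "cp (X \<tau>) (w0 + of_real \<tau> * u) = of_real \<tau> ^ d * H \<tau> u" for \<tau> u
  proof -
    have "cp (X \<tau>) w - cp p w = of_real (\<tau> ^ d) * (eps j0 * w ^ ms j0)" for w
    proof -
      have "cp (X \<tau>) w - cp p w = (\<Sum>j\<in>UNIV. if j = j0 then of_real (\<tau> ^ d) * (eps j * w ^ ms j) else 0)"
        unfolding cp_diff by (intro sum.cong) (auto simp: Xj)
      then show ?thesis by simp
    qed
    from this[of "w0 + of_real \<tau> * u"]
    have "cp (X \<tau>) (w0 + of_real \<tau> * u) = cp p (w0 + of_real \<tau> * u) + of_real (\<tau> ^ d) * (eps j0 * (w0 + of_real \<tau> * u) ^ ms j0)"
      by (simp only: diff_eq_eq add.commute)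
    also have "cp p (w0 + of_real \<tau> * u) = of_real \<tau> ^ d * u ^ d * poly q (w0 + of_real \<tau> * u)"
      by (simp add: fac power_mult_distrib)
    finally show ?thesis by (simp only: H_def distrib_left of_real_power mult.assoc)
  qed
  have H0: "H 0 u = a * u ^ d + b" for u by (simp add: H_def a_def b_def)
  have "d \<noteq> 0" using d by simp
  \<comment> \<open>A simple zero of the limit polynomial \<open>a * u ^ d + b\<close>; it is the
    direction in which a root leaves w0.\<close>
  then obtain u0 where u0: "u0 ^ d = - b / a" by (rule exists_complex_root[of d "- b / a"]) metis
  have u0nz: "u0 \<noteq> 0"
  proof
    assume "u0 = 0"
    then have "- b / a = 0" using u0 \<open>d \<noteq> 0\<close> by (simp only: power_0_left if_False)
    then show False using ab by simp
  qed
  define G where "G u = a * (\<Sum>i<d. u0 ^ (d - Suc i) * u ^ i)" for u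
  have HG: "H 0 u = (u - u0) * G u" for u
  proof -
    have "H 0 u = a * (u ^ d - u0 ^ d)" using u0 ab by (simp add: H0 field_simps)
    then show ?thesis by (simp add: G_def power_diff_sumr2)
  qed
  have Gu0: "G u0 \<noteq> 0"
  proof -
    have "(\<Sum>i<d. u0 ^ (d - Suc i) * u0 ^ i) = (\<Sum>i<d. u0 ^ (d - 1))"
      by (intro sum.cong refl) (auto simp: power_add[symmetric])
    then show ?thesis using ab u0nz d by (simp add: G_def)
  qed
  have "continuous (at u0) G" unfolding G_def by (intro continuous_intros)
  then obtain \<rho>0 where \<rho>0: "\<rho>0 > 0" "\<And>u. dist u u0 < \<rho>0 \<Longrightarrow> G u \<noteq> 0"
    using continuous_at_avoid[of u0 G 0] Gu0 by (metis dist_commute)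
  define \<rho> where "\<rho> = \<rho>0 / 2"
  have \<rho>: "\<rho> > 0" "\<rho> < \<rho>0" using \<rho>0 by (auto simp: \<rho>_def)
  have H0nz: "H 0 u \<noteq> 0" if "u \<in> sphere u0 \<rho>" for u
    using that \<rho> \<rho>0(2)[of u] by (auto simp: HG dist_commute)
  have H_cont: "continuous_on UNIV (\<lambda>z. H (fst z) (snd z))"
    unfolding H_def by (intro continuous_intros)
  obtain V where V: "open V" "0 \<in> V" "\<And>\<tau> u. \<tau> \<in> V \<Longrightarrow> u \<in> sphere u0 \<rho> \<Longrightarrow> H \<tau> u \<noteq> 0"
    using nonzero_near_compact[OF H_cont compact_sphere, of u0 \<rho> 0] H0nz by blast
  define E where "E k = circ_int u0 \<rho> (\<lambda>u. 1 / H 0 u ^ k)" for k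
  have E1: "E 1 \<noteq> 0"
  proof -
    have "(\<lambda>u. 1 / G u) holomorphic_on ball u0 \<rho>0"
      using \<rho>0(2) by (intro holomorphic_intros) (auto simp: G_def dist_commute intro!: holomorphic_intros)
    from circ_int_Cauchy[OF this \<rho>(2), of u0] \<rho>(1)
    have "circ_int u0 \<rho> (\<lambda>u. 1 / G u / (u - u0)) = 1 / G u0" by simp
    then have "E 1 = 1 / G u0" unfolding E_def by (simp add: HG mult.commute)
    then show ?thesis using Gu0 by simp
  qed
  have H0_cont: "continuous_on (sphere u0 \<rho>) (\<lambda>u. 1 / H 0 u ^ k)" for k
    using H0nz by (intro continuous_intros) (auto simp: H0 intro!: continuous_intros)
  \<comment> \<open>Integrate the derivative of \<open>u / H 0 u ^ k\<close> and use that u times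
    the derivative of \<open>H 0\<close> is d (\<open>H 0 u\<close> - b).\<close>
  have Erec: "of_nat (k * d) * b * E (Suc k) = (of_nat (k * d) - 1) * E k" for k
  proof -
    have "circ_int u0 \<rho> (\<lambda>u. (1 - of_nat (k * d)) * (1 / H 0 u ^ k) + (of_nat (k * d) * b) * (1 / H 0 u ^ Suc k)) = 0"
    proof (rule circ_int_primitive[where F="\<lambda>u. u / H 0 u ^ k"])
      fix u assume u: "u \<in> sphere u0 \<rho>"
      note nz = H0nz[OF u]
      obtain d' where d': "d = Suc d'" using d by (cases d) auto
      have dH: "(H 0 has_field_derivative a * (of_nat d * u ^ (d - 1))) (at u)"
        unfolding H0 by (auto intro!: derivative_eq_intros)
      have "((\<lambda>u. u / H 0 u ^ k) has_field_derivative
         (1 * H 0 u ^ k - u * (of_nat k * H 0 u ^ (k - 1) * (a * (of_nat d * u ^ (d - 1))))) / (H 0 u ^ k * H 0 u ^ k)) (at u)"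
        using nz by (auto intro!: derivative_eq_intros dH simp: power_eq_0_iff)
      moreover have "(1 * H 0 u ^ k - u * (of_nat k * H 0 u ^ (k - 1) * (a * (of_nat d * u ^ (d - 1))))) / (H 0 u ^ k * H 0 u ^ k)
         = (1 - of_nat (k * d)) * (1 / H 0 u ^ k) + (of_nat (k * d) * b) * (1 / H 0 u ^ Suc k)"
      proof (cases k)
        case (Suc k')
        have au: "a * (u * u ^ d') = H 0 u - b" by (simp add: H0 d')
        have "u * (of_nat k * H 0 u ^ (k - 1) * (a * (of_nat d * u ^ (d - 1)))) = of_nat (k * d) * H 0 u ^ k' * (a * (u * u ^ d'))"
          using Suc d' by (simp del: of_nat_Suc mult_Suc mult_Suc_right)
        also have "\<dots> = of_nat (k * d) * H 0 u ^ k' * (H 0 u - b)" by (simp only: au)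
        finally have e: "u * (of_nat k * H 0 u ^ (k - 1) * (a * (of_nat d * u ^ (d - 1)))) = of_nat (k * d) * H 0 u ^ k' * (H 0 u - b)" .
        show ?thesis unfolding mult_1_left e using nz Suc
          by (simp add: divide_simps del: of_nat_Suc mult_Suc) (simp add: algebra_simps del: of_nat_Suc mult_Suc)
      qed (use nz in simp)
      ultimately show "((\<lambda>u. u / H 0 u ^ k) has_field_derivative
         (1 - of_nat (k * d)) * (1 / H 0 u ^ k) + (of_nat (k * d) * b) * (1 / H 0 u ^ Suc k)) (at u)" by (simp only:)
    qed (use \<rho> in simp)
    moreover have "circ_int u0 \<rho> (\<lambda>u. (1 - of_nat (k * d)) * (1 / H 0 u ^ k) + (of_nat (k * d) * b) * (1 / H 0 u ^ Suc k))
       = (1 - of_nat (k * d)) * E k + (of_nat (k * d) * b) * E (Suc k)"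
      unfolding E_def circ_int_cmult[symmetric]
      using \<rho> by (intro circ_int_add continuous_intros H0_cont) auto
    ultimately show ?thesis by (simp add: algebra_simps)
  qed
  have Enz: "E (Suc k) \<noteq> 0" for k
  proof (induction k)
    case 0
    then show ?case using E1 by simp
  next
    case (Suc k)
    \<comment> \<open>Here the multiplicity enters: for d = 1 the recursion would give E 2 = 0, and
      a simple root does not blow up.\<close>
    have "Suc k * d \<noteq> 1" using d by simp
    then have "of_nat (Suc k * d) \<noteq> (1 :: complex)" unfolding of_nat_eq_1_iff .
    then show ?case using Erec[of "Suc k"] Suc.IH by (metis mult_zero_right no_zero_divisors right_minus_eq)
  qed
  \<comment> \<open>The integrals \<open>T s k\<close> at \<open>X \<tau>\<close> with all powers of
    tau removed; they stay continuous at tau = 0.\<close>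
  define L where "L s k \<tau> = circ_int u0 \<rho> (\<lambda>u. (w0 + of_real \<tau> * u) ^ s / H \<tau> u ^ k)" for s k and \<tau> :: real
  have L_lim: "(L s k \<longlongrightarrow> w0 ^ s * E k) (at_right 0)" for s k
  proof -
    have "continuous_on V (L s k)" unfolding L_def
    proof (rule circ_int_continuous)
      have "continuous_on (V \<times> sphere u0 \<rho>) (\<lambda>z. H (fst z) (snd z))"
        using H_cont by (rule continuous_on_subset) simp
      then show "continuous_on (V \<times> sphere u0 \<rho>) (\<lambda>(\<tau>, u). (w0 + of_real \<tau> * u) ^ s / H \<tau> u ^ k)"
        unfolding case_prod_unfold by (intro continuous_intros) (use V(3) in auto)
    qed (use \<rho> in simp)
    then have "(L s k \<longlongrightarrow> L s k 0) (at 0)"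
      using V(1,2) by (simp add: continuous_on_eq_continuous_at isCont_def)
    moreover have "L s k 0 = w0 ^ s * E k"
      unfolding L_def E_def circ_int_cmult[symmetric] by simp
    ultimately show ?thesis using filterlim_at_split by metis
  qed
  have evV: "\<forall>\<^sub>F \<tau> in at_right 0. \<tau> \<in> V \<and> 0 < \<tau>"
    using V(1,2) by (auto simp: eventually_conj_iff eventually_at_right_less
       intro: eventually_at_in_open' eventually_at_split[THEN iffD1, THEN conjunct2])
  \<comment> \<open>The circle shrinks with tau around w0 + tau u0, so each tau has its own solution
    and its own domain; no common neighbourhood of p exists.\<close>
  have functional: "mellin_functional m ms eps {w0 + of_real \<tau> * u0} (\<tau> * \<rho>) (2 * (\<tau> * \<rho>)) (\<lambda>_ _. 1) (\<lambda>_ _. 0) 0"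
    if "0 < \<tau>" for \<tau>
    using that \<rho> by unfold_locales auto
  define Dom where "Dom \<tau> = circ_dom {w0 + of_real \<tau> * u0} (\<tau> * \<rho>)" for \<tau>
  have XDom: "X \<tau> \<in> Dom \<tau>" if "\<tau> \<in> V" "0 < \<tau>" for \<tau>
    unfolding Dom_def circ_dom_def
  proof (clarsimp)
    fix w assume w: "dist (w0 + complex_of_real \<tau> * u0) w = \<tau> * \<rho>" and z: "cp (X \<tau>) w = 0"
    define u where "u = (w - w0) / of_real \<tau>"
    have wu: "w = w0 + of_real \<tau> * u" using that by (simp add: u_def)
    have "dist (w0 + of_real \<tau> * u0) w = \<tau> * dist u0 u"
      using that(2) by (simp add: wu dist_norm right_diff_distrib[symmetric] norm_mult)
    then have "u \<in> sphere u0 \<rho>" using w that(2) by simp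
    then show False using V(3)[OF that(1)] z that(2) by (simp add: wu cpX)
  qed
  define T where "T \<tau> = mellin_functional.T m ms eps {w0 + of_real \<tau> * u0} (\<tau> * \<rho>) (\<lambda>_ _. 1)" for \<tau>
  define Y where "Y \<tau> = mellin_functional.Y m ms eps {w0 + of_real \<tau> * u0} (\<tau> * \<rho>) (\<lambda>_ _. 1) 0" for \<tau>
  have T_eq: "of_real \<tau> ^ (d * k) * T \<tau> s k (X \<tau>) = of_real \<tau> * L s k \<tau>" if "0 < \<tau>" for \<tau> s k
  proof -
    have "T \<tau> s k (X \<tau>) = of_real \<tau> * circ_int u0 \<rho> (\<lambda>u. (w0 + of_real \<tau> * u) ^ s / (of_real \<tau> ^ d * H \<tau> u) ^ k)"
      unfolding T_def mellin_functional.T_def[OF functional[OF that]] K_def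
      by (simp add: circ_int_scale cpX)
    also have "circ_int u0 \<rho> (\<lambda>u. (w0 + of_real \<tau> * u) ^ s / (of_real \<tau> ^ d * H \<tau> u) ^ k) =
       (1 / of_real \<tau> ^ (d * k)) * L s k \<tau>"
      unfolding L_def circ_int_cmult[symmetric] by (simp add: power_mult_distrib power_mult)
    finally show ?thesis using that by simp
  qed
  define C where "C N = (-1) ^ N * fact (N - 1) * E N" for N
  have C: "C (Suc k) \<noteq> 0" for k using Enz[of k] by (simp add: C_def)
  have tau0: "((\<lambda>\<tau>. complex_of_real \<tau>) \<longlongrightarrow> 0) (at_right 0)"
    by (rule tendsto_eq_intros refl)+ simp
  have Xlim: "(X \<longlongrightarrow> p) (at_right 0)"
  proof (rule vec_tendstoI)
    fix i
    have "((\<lambda>\<tau>. p $ i + (if i = j0 then of_real \<tau> ^ d else 0)) \<longlongrightarrow> p $ i + (if i = j0 then 0 ^ d else 0)) (at_right 0)"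
      using tau0 by (auto intro!: tendsto_intros)
    then show "((\<lambda>\<tau>. X \<tau> $ i) \<longlongrightarrow> p $ i) (at_right 0)"
      using d by (cases "i = j0") (simp_all add: Xj power_0_left)
  qed
  \<comment> \<open>The gradient of \<open>cp x w0\<close> in x, that is, the conormal of the
    hyperplane of parameters for which w0 is a root. It does not depend on
    \<open>j0\<close>.\<close>
  define \<xi> :: "'n point" where "\<xi> = (\<chi> j. eps j * w0 ^ ms j)"
  have xi_beta: "(\<Prod>i\<in>UNIV. \<xi> $ i ^ \<beta> i) = (\<Prod>i\<in>UNIV. eps i ^ \<beta> i) * w0 ^ (\<Sum>i\<in>UNIV. \<beta> i * ms i)" for \<beta>
    by (simp add: \<xi>_def power_mult_distrib prod.distrib power_sum power_mult[symmetric] mult.commute)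
  have mpd_eq: "mpd \<beta> (Y \<tau>) (X \<tau>) = (\<Prod>j\<in>UNIV. eps j ^ \<beta> j) *
      (if (\<Sum>j\<in>UNIV. \<beta> j) = 0 then Y \<tau> (X \<tau>)
       else (-1) ^ (\<Sum>j\<in>UNIV. \<beta> j) * fact ((\<Sum>j\<in>UNIV. \<beta> j) - 1) * T \<tau> (\<Sum>j\<in>UNIV. \<beta> j * ms j) (\<Sum>j\<in>UNIV. \<beta> j) (X \<tau>))"
    if "\<tau> \<in> V" "0 < \<tau>" for \<tau> \<beta>
    using mellin_functional.mpd_Y[OF functional[OF that(2)], of \<beta>] XDom[OF that]
    unfolding agree_on_def Dom_def Y_def[symmetric] mellin_functional.level_def[OF functional[OF that(2)]]
    by (auto simp: T_def Y_def)
  \<comment> \<open>The summands of \<open>Y\<close> may each grow like tau^(1-d); their leading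
    coefficients add up to a multiple of \<open>cp' p w0\<close>, which is 0.\<close>
  have Y_lim: "((\<lambda>\<tau>. of_real \<tau> ^ (d - 1) * Y \<tau> (X \<tau>)) \<longlongrightarrow> 0) (at_right 0)"
  proof -
    have "((\<lambda>\<tau>. of_nat m * L m 1 \<tau> + (\<Sum>i\<in>UNIV. eps i * X \<tau> $ i * (of_nat (ms i) * L (ms i) 1 \<tau>))) \<longlongrightarrow>
        of_nat m * (w0 ^ m * E 1) + (\<Sum>i\<in>UNIV. eps i * p $ i * (of_nat (ms i) * (w0 ^ ms i * E 1)))) (at_right 0)"
      by (intro tendsto_intros L_lim Xlim)
    moreover have "of_nat m * (w0 ^ m * E 1) + (\<Sum>i\<in>UNIV. eps i * p $ i * (of_nat (ms i) * (w0 ^ ms i * E 1))) = w0 * cp' p w0 * E 1"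
    proof -
      have "w0 ^ ms i = w0 * w0 ^ (ms i - 1)" for i using ms_pos[of i] by (cases "ms i") auto
      moreover have "w0 ^ m = w0 * w0 ^ (m - 1)" using m_pos by (cases m) auto
      ultimately show ?thesis by (simp add: cp'_def sum_distrib_left sum_distrib_right algebra_simps)
    qed
    ultimately have l: "((\<lambda>\<tau>. of_nat m * L m 1 \<tau> + (\<Sum>i\<in>UNIV. eps i * X \<tau> $ i * (of_nat (ms i) * L (ms i) 1 \<tau>))) \<longlongrightarrow> 0) (at_right 0)"
      using w0(2) by simp
    show ?thesis
    proof (rule Lim_transform_eventually[OF l])
      show "\<forall>\<^sub>F \<tau> in at_right 0. of_nat m * L m 1 \<tau> + (\<Sum>i\<in>UNIV. eps i * X \<tau> $ i * (of_nat (ms i) * L (ms i) 1 \<tau>))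
          = of_real \<tau> ^ (d - 1) * Y \<tau> (X \<tau>)"
        using evV
      proof eventually_elim
        case (elim \<tau>)
        have TL: "of_real \<tau> ^ (d - 1) * T \<tau> s 1 (X \<tau>) = L s 1 \<tau>" for s
        proof -
          have "(of_real \<tau> :: complex) ^ d = of_real \<tau> * of_real \<tau> ^ (d - 1)" using d by (cases d) auto
          then show ?thesis using T_eq[of \<tau> 1 s] elim by simp
        qed
        show ?case unfolding Y_def mellin_functional.Y_def[OF functional[OF conjunct2[OF elim]]] TL[symmetric]
          by (simp add: T_def sum_distrib_left algebra_simps)
      qed
    qed
  qed
  \<comment> \<open>The exponent d (N + 1) - 1 is the growth rate of the derivatives of order N + 1,
    so lower orders disappear in the limit. Order 0 is separate, since \<open>Y\<close> is not of
    the form \<open>T s k\<close>.\<close>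
  have mpd_lim: "((\<lambda>\<tau>. of_real \<tau> ^ (d * Suc N - 1) * mpd \<beta> (Y \<tau>) (X \<tau>)) \<longlongrightarrow>
      (if (\<Sum>i\<in>UNIV. \<beta> i) = Suc N then C (Suc N) * (\<Prod>i\<in>UNIV. \<xi> $ i ^ \<beta> i) else 0)) (at_right 0)"
    if le: "(\<Sum>i\<in>UNIV. \<beta> i) \<le> Suc N" for N \<beta>
  proof (cases "(\<Sum>i\<in>UNIV. \<beta> i) = 0")
    case True
    have "((\<lambda>\<tau>. of_real \<tau> ^ (d * N) * (\<Prod>j\<in>UNIV. eps j ^ \<beta> j) * (of_real \<tau> ^ (d - 1) * Y \<tau> (X \<tau>))) \<longlongrightarrow>
       0 ^ (d * N) * (\<Prod>j\<in>UNIV. eps j ^ \<beta> j) * 0) (at_right 0)"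
      by (intro tendsto_intros tau0 Y_lim)
    then have l: "((\<lambda>\<tau>. of_real \<tau> ^ (d * N) * (\<Prod>j\<in>UNIV. eps j ^ \<beta> j) * (of_real \<tau> ^ (d - 1) * Y \<tau> (X \<tau>))) \<longlongrightarrow>
      (if (\<Sum>i\<in>UNIV. \<beta> i) = Suc N then C (Suc N) * (\<Prod>i\<in>UNIV. \<xi> $ i ^ \<beta> i) else 0)) (at_right 0)"
      using True by simp
    have ex: "d * Suc N - 1 = d * N + (d - 1)" using d by simp
    show ?thesis unfolding ex
      by (rule Lim_transform_eventually[OF l], use evV in eventually_elim)
         (use True in \<open>simp add: mpd_eq power_add mult_ac\<close>)
  next
    case False
    define n where "n = (\<Sum>i\<in>UNIV. \<beta> i)"
    define s where "s = (\<Sum>i\<in>UNIV. \<beta> i * ms i)"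
    define c where "c = (\<Prod>j\<in>UNIV. eps j ^ \<beta> j) * ((-1) ^ n * fact (n - 1))"
    have "((\<lambda>\<tau>. of_real \<tau> ^ (d * (Suc N - n)) * (c * L s n \<tau>)) \<longlongrightarrow> 0 ^ (d * (Suc N - n)) * (c * (w0 ^ s * E n))) (at_right 0)"
      by (intro tendsto_intros tau0 L_lim)
    moreover have "0 ^ (d * (Suc N - n)) * (c * (w0 ^ s * E n)) =
       (if n = Suc N then C (Suc N) * (\<Prod>i\<in>UNIV. \<xi> $ i ^ \<beta> i) else 0)"
      using d le by (auto simp: c_def s_def xi_beta C_def n_def power_0_left simp del: fact_Suc)
    ultimately have l: "((\<lambda>\<tau>. of_real \<tau> ^ (d * (Suc N - n)) * (c * L s n \<tau>)) \<longlongrightarrow>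
       (if n = Suc N then C (Suc N) * (\<Prod>i\<in>UNIV. \<xi> $ i ^ \<beta> i) else 0)) (at_right 0)" by simp
    show ?thesis unfolding n_def[symmetric]
    proof (rule Lim_transform_eventually[OF l])
      show "\<forall>\<^sub>F \<tau> in at_right 0. of_real \<tau> ^ (d * (Suc N - n)) * (c * L s n \<tau>) = of_real \<tau> ^ (d * Suc N - 1) * mpd \<beta> (Y \<tau>) (X \<tau>)"
        using evV
      proof eventually_elim
        case (elim \<tau>)
        then have t: "\<tau> \<in> V" "0 < \<tau>" by auto
        have "d * Suc N = d * (Suc N - n) + d * n" using le n_def by (simp add: add_mult_distrib2[symmetric])
        moreover have "d * Suc N = Suc (d * Suc N - 1)" using d by simp
        ultimately have ex: "of_real \<tau> * of_real \<tau> ^ (d * Suc N - 1) = (of_real \<tau> :: complex) ^ (d * (Suc N - n)) * of_real \<tau> ^ (d * n)"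
          by (metis power_Suc power_add)
        have "of_real \<tau> * (of_real \<tau> ^ (d * Suc N - 1) * mpd \<beta> (Y \<tau>) (X \<tau>)) =
           c * (of_real \<tau> ^ (d * (Suc N - n)) * (of_real \<tau> ^ (d * n) * T \<tau> s n (X \<tau>)))"
          unfolding mult.assoc[symmetric] ex mpd_eq[OF t] n_def[symmetric] s_def[symmetric]
          using False[folded n_def] by (simp add: c_def mult_ac)
        also have "\<dots> = of_real \<tau> * (of_real \<tau> ^ (d * (Suc N - n)) * (c * L s n \<tau>))"
          by (simp add: T_eq[OF t(2)])
        finally show ?case using t(2) by simp
      qed
    qed
  qed
  have symbol: "principal_symbol P p \<xi> = 0" if P: "P \<in> left_ideal (mellin_op m ms)" for P
  proof -
    obtain Q where Q: "\<And>S f x. holo_on f S \<Longrightarrow> x \<in> S \<Longrightarrow>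
       weyl_apply P f x = (\<Sum>j\<in>UNIV. weyl_apply (Q j) (mellin_op m ms j f) x)"
      using P unfolding left_ideal_def by blast
    have ann: "weyl_apply P (Y \<tau>) x = 0" if "0 < \<tau>" "x \<in> Dom \<tau>" for \<tau> x
    proof -
      interpret F: mellin_functional m ms eps "{w0 + of_real \<tau> * u0}" "\<tau> * \<rho>" "2 * (\<tau> * \<rho>)" "\<lambda>_ _. 1" "\<lambda>_ _. 0" 0
        by (rule functional[OF that(1)])
      have Dom: "open (Dom \<tau>)" unfolding Dom_def by (rule open_circ_dom) simp
      have "agree_on (Dom \<tau>) (mellin_op m ms j (Y \<tau>)) (\<lambda>_. 0)" for j
        using F.mellin_op_Y[of "Dom \<tau>" _ j] Dom by (auto simp: agree_on_def Dom_def Y_def)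
      then have "weyl_apply (Q j) (mellin_op m ms j (Y \<tau>)) x = 0" for j
        using weyl_apply_zero that(2) by blast
      then show ?thesis using Q[of "Y \<tau>" "Dom \<tau>" x] F.holo_on_Y that(2) by (simp add: Dom_def Y_def)
    qed
    define cf where "cf ab x = Poly_Mapping.lookup P ab * (\<Prod>i\<in>UNIV. x $ i ^ fst ab i)" for ab and x :: "'n point"
    have wa: "weyl_apply P f x = (\<Sum>ab\<in>Poly_Mapping.keys P. cf ab x * mpd (snd ab) f x)" for f x
      by (simp add: weyl_apply_def cf_def case_prod_unfold)
    have ps: "principal_symbol P p \<xi> = (\<Sum>ab\<in>Poly_Mapping.keys P. if (\<Sum>i\<in>UNIV. snd ab i) = weyl_order P then cf ab p * (\<Prod>i\<in>UNIV. \<xi> $ i ^ snd ab i) else 0)"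
      unfolding principal_symbol_def cf_def
      by (subst sum.inter_filter[symmetric]) (auto simp: case_prod_unfold intro!: sum.cong)
    have ord: "(\<Sum>i\<in>UNIV. snd ab i) \<le> weyl_order P" if "ab \<in> Poly_Mapping.keys P" for ab
      unfolding weyl_order_def using that by (intro Max_ge) (auto simp: case_prod_unfold)
    have cf_lim: "((\<lambda>\<tau>. cf ab (X \<tau>)) \<longlongrightarrow> cf ab p) (at_right 0)" for ab
      unfolding cf_def by (intro tendsto_intros Xlim)
    show ?thesis
    proof (cases "weyl_order P")
      case (Suc N)
      have l: "((\<lambda>\<tau>. \<Sum>ab\<in>Poly_Mapping.keys P. cf ab (X \<tau>) * (of_real \<tau> ^ (d * Suc N - 1) * mpd (snd ab) (Y \<tau>) (X \<tau>))) \<longlongrightarrow>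
         (\<Sum>ab\<in>Poly_Mapping.keys P. cf ab p * (if (\<Sum>i\<in>UNIV. snd ab i) = Suc N then C (Suc N) * (\<Prod>i\<in>UNIV. \<xi> $ i ^ snd ab i) else 0))) (at_right 0)"
        by (intro tendsto_sum tendsto_mult cf_lim mpd_lim) (use ord Suc in auto)
      have "\<forall>\<^sub>F \<tau> in at_right 0. (\<Sum>ab\<in>Poly_Mapping.keys P. cf ab (X \<tau>) * (of_real \<tau> ^ (d * Suc N - 1) * mpd (snd ab) (Y \<tau>) (X \<tau>))) = 0"
        using evV
      proof eventually_elim
        case (elim \<tau>)
        have "(\<Sum>ab\<in>Poly_Mapping.keys P. cf ab (X \<tau>) * (of_real \<tau> ^ (d * Suc N - 1) * mpd (snd ab) (Y \<tau>) (X \<tau>)))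
           = of_real \<tau> ^ (d * Suc N - 1) * weyl_apply P (Y \<tau>) (X \<tau>)"
          unfolding wa sum_distrib_left by (intro sum.cong refl) (simp only: mult_ac)
        then show ?case using ann[of \<tau> "X \<tau>"] XDom[of \<tau>] elim by simp
      qed
      from Lim_transform_eventually[OF l this]
      have "(\<Sum>ab\<in>Poly_Mapping.keys P. cf ab p * (if (\<Sum>i\<in>UNIV. snd ab i) = Suc N then C (Suc N) * (\<Prod>i\<in>UNIV. \<xi> $ i ^ snd ab i) else 0)) = 0"
        by (simp add: tendsto_const_iff)
      moreover have "(\<Sum>ab\<in>Poly_Mapping.keys P. cf ab p * (if (\<Sum>i\<in>UNIV. snd ab i) = Suc N then C (Suc N) * (\<Prod>i\<in>UNIV. \<xi> $ i ^ snd ab i) else 0))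
         = C (Suc N) * principal_symbol P p \<xi>"
        unfolding ps sum_distrib_left Suc by (intro sum.cong refl) (auto simp: mult_ac)
      ultimately show ?thesis using C[of N] by simp
    next
      case 0
      \<comment> \<open>An operator of order 0 is multiplication by a polynomial. If it were nonzero
        at p, the functions \<open>Y \<tau>\<close> and their first derivatives would vanish at
        \<open>X \<tau>\<close> for small tau, against the nonzero limit of
        \<open>L (ms j0) 1\<close>.\<close>
      define qf where "qf x = (\<Sum>ab\<in>Poly_Mapping.keys P. cf ab x)" for x
      have z: "snd ab = (\<lambda>_. 0)" if "ab \<in> Poly_Mapping.keys P" for ab
        using ord[OF that] 0 by (auto simp: fun_eq_iff)
      have m0: "mpd (\<lambda>_. 0) f = f" for f :: "'n cfun"
      proof -
        have "fold (\<lambda>j. pd j ^^ 0) xs f = f" for xs :: "'n list" by (induction xs) auto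
        then show ?thesis by (simp add: mpd_def)
      qed
      have wq: "weyl_apply P f x = qf x * f x" for f x
        unfolding wa qf_def sum_distrib_right by (intro sum.cong refl) (simp add: z m0)
      have pq: "principal_symbol P p \<xi> = qf p"
        unfolding ps qf_def by (intro sum.cong refl) (simp add: z 0)
      have qf_cont: "continuous_on UNIV qf" unfolding qf_def cf_def by (intro continuous_intros)
      show ?thesis
      proof (rule ccontr)
        assume "principal_symbol P p \<xi> \<noteq> 0"
        then have np: "p \<in> {x. qf x \<noteq> 0}" by (simp add: pq)
        have op: "open {x. qf x \<noteq> 0}" by (intro open_Collect_neq qf_cont continuous_intros)
        have "\<forall>\<^sub>F \<tau> in at_right 0. X \<tau> \<in> {x. qf x \<noteq> 0}"
          by (rule topological_tendstoD[OF Xlim op np])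
        then have ev: "\<forall>\<^sub>F \<tau> in at_right 0. L (ms j0) 1 \<tau> = 0"
          using evV
        proof eventually_elim
          case (elim \<tau>)
          then have t: "\<tau> \<in> V" "0 < \<tau>" by auto
          interpret F: mellin_functional m ms eps "{w0 + of_real \<tau> * u0}" "\<tau> * \<rho>" "2 * (\<tau> * \<rho>)" "\<lambda>_ _. 1" "\<lambda>_ _. 0" 0
            by (rule functional[OF t(2)])
          have Dom: "open (Dom \<tau>)" unfolding Dom_def by (rule open_circ_dom) simp
          have "agree_on (Dom \<tau> \<inter> {x. qf x \<noteq> 0}) (Y \<tau>) (\<lambda>_. 0)"
            using ann[OF t(2)] Dom op by (auto simp: agree_on_def wq open_Int)
          from pd_cong[OF this, of j0] have "pd j0 (Y \<tau>) (X \<tau>) = 0"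
            using elim XDom[OF t] by (simp add: agree_on_def pd_zero)
          moreover have "pd j0 (Y \<tau>) (X \<tau>) = - eps j0 * T \<tau> (ms j0) 1 (X \<tau>)"
            using pd_has_gradient[OF F.has_gradient_Y] XDom[OF t] by (simp add: Y_def T_def Dom_def)
          ultimately have "T \<tau> (ms j0) 1 (X \<tau>) = 0" using eps_nonzero by simp
          then show ?case using T_eq[OF t(2), of 1 "ms j0"] t(2) by simp
        qed
        have "w0 ^ ms j0 * E 1 = 0"
          using Lim_transform_eventually[OF L_lim ev] by (simp add: tendsto_const_iff)
        then show False using w0nz E1 by simp
      qed
    qed
  qed
  have "\<xi> $ j0 \<noteq> 0" using w0nz eps_nonzero by (simp add: \<xi>_def)
  then have "\<xi> \<noteq> 0" by auto
  then show "p \<in> singular_locus (mellin_op m ms)"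
    unfolding singular_locus_def char_variety_def using symbol by blast
qed

end

subsection \<open>Local systems of germs\<close>

lemma germ_eq_ball_iff:
  assumes "holo_on f (ball q e)" "holo_on g (ball q e)" "x \<in> ball q e"
  shows "germ x f = germ x g \<longleftrightarrow> (\<forall>y\<in>ball q e. f y = g y)"
  using holo_ball_identity[OF assms] germ_eqI[of "ball q e" x f g] assms(3) by blast

lemma germ_eq_nearby:
  assumes "germ p f = germ p g"
  obtains e where "e > 0" "\<And>x. x \<in> ball p e \<Longrightarrow> germ x f = germ x g"
proof -
  obtain S where S: "open S" "p \<in> S" "\<And>x. x \<in> S \<Longrightarrow> f x = g x"
    using assms unfolding germ_eq_iff eventually_nhds by blast
  obtain e where e: "e > 0" "ball p e \<subseteq> S" using S open_contains_ball by blast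
  show ?thesis
  proof (rule that[OF e(1)])
    fix x assume "x \<in> ball p e"
    then have "x \<in> S" using e(2) by blast
    with S(1) show "germ x f = germ x g" by (rule germ_eqI) (rule S(3))
  qed
qed

text \<open>Equality of the two germs is a locally constant property of the parameter, by the
  identity theorem on a ball around \<open>\<gamma> t\<close>, and the unit interval is
  connected.\<close>

lemma analytic_continuation_unique:
  assumes \<gamma>: "path \<gamma>" and c: "analytic_continuation \<gamma> \<phi> \<psi>" "analytic_continuation \<gamma> \<phi> \<psi>'"
  shows "\<psi> = \<psi>'"
proof -
  obtain F where F: "\<And>t. t \<in> {0..1} \<Longrightarrow> \<exists>S. \<gamma> t \<in> S \<and> holo_on (F t) S"
     "\<And>t. t \<in> {0..1} \<Longrightarrow> \<forall>\<^sub>F s in at t within {0..1}. germ (\<gamma> s) (F s) = germ (\<gamma> s) (F t)"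
     "\<phi> = germ (\<gamma> 0) (F 0)" "\<psi> = germ (\<gamma> 1) (F 1)"
    using c(1) unfolding analytic_continuation_def by blast
  obtain G where G: "\<And>t. t \<in> {0..1} \<Longrightarrow> \<exists>S. \<gamma> t \<in> S \<and> holo_on (G t) S"
     "\<And>t. t \<in> {0..1} \<Longrightarrow> \<forall>\<^sub>F s in at t within {0..1}. germ (\<gamma> s) (G s) = germ (\<gamma> s) (G t)"
     "\<phi> = germ (\<gamma> 0) (G 0)" "\<psi>' = germ (\<gamma> 1) (G 1)"
    using c(2) unfolding analytic_continuation_def by blast
  define P where "P s \<longleftrightarrow> germ (\<gamma> s) (F s) = germ (\<gamma> s) (G s)" for s
  have near: "\<forall>\<^sub>F s in at t within {0..1}. P s = P t" if t: "t \<in> {0..1}" for t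
  proof -
    obtain S S' where S: "\<gamma> t \<in> S" "holo_on (F t) S" "\<gamma> t \<in> S'" "holo_on (G t) S'"
      using F(1)[OF t] G(1)[OF t] by blast
    then have "open (S \<inter> S')" "\<gamma> t \<in> S \<inter> S'" by (auto simp: holo_on_def)
    then obtain e where e: "e > 0" "ball (\<gamma> t) e \<subseteq> S \<inter> S'" using open_contains_ball by blast
    have h: "holo_on (F t) (ball (\<gamma> t) e)" "holo_on (G t) (ball (\<gamma> t) e)"
      using S e by (auto elim!: holo_on_subset)
    have "continuous (at t within {0..1}) \<gamma>"
      using \<gamma> t by (simp add: path_def continuous_on_eq_continuous_within)
    then have "\<forall>\<^sub>F s in at t within {0..1}. \<gamma> s \<in> ball (\<gamma> t) e"
      using e(1) unfolding continuous_within by (intro topological_tendstoD) auto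
    with F(2)[OF t] G(2)[OF t] show ?thesis
    proof eventually_elim
      case (elim s)
      have "P s \<longleftrightarrow> (\<forall>y\<in>ball (\<gamma> t) e. F t y = G t y)"
        unfolding P_def elim(1,2) by (rule germ_eq_ball_iff[OF h elim(3)])
      moreover have "P t \<longleftrightarrow> (\<forall>y\<in>ball (\<gamma> t) e. F t y = G t y)"
        unfolding P_def by (rule germ_eq_ball_iff[OF h]) (use e in simp)
      ultimately show ?case by simp
    qed
  qed
  have "P 0 = P 1"
  proof (rule connected_equivalence_relation[of "{0..1::real}" 0 1 "\<lambda>a b. P a = P b"])
    fix t :: real assume t: "t \<in> {0..1}"
    obtain T where T: "open T" "t \<in> T" "\<forall>s\<in>T. s \<noteq> t \<longrightarrow> s \<in> {0..1} \<longrightarrow> P s = P t"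
      using near[OF t] unfolding eventually_at_topological by blast
    show "\<exists>T. openin (top_of_set {0..1}) T \<and> t \<in> T \<and> (\<forall>x\<in>T. P t = P x)"
      by (rule exI[of _ "{0..1} \<inter> T"]) (use T t in \<open>auto simp: openin_open_Int\<close>)
  qed auto
  moreover have "P 0" unfolding P_def using F(3) G(3) by simp
  ultimately show ?thesis using F(4) G(4) by (simp add: P_def)
qed

text \<open>One family of functions serves a whole ball, which makes E locally constant. The sets
  may be arbitrary, since the branches of the logarithmic solution form a translate of a vector
  space.\<close>

definition local_system :: "('n::finite) point set \<Rightarrow> ('n point \<Rightarrow> 'n cfun set set) \<Rightarrow> bool" where
  "local_system \<Omega> E \<longleftrightarrow> (\<forall>q\<in>\<Omega>. \<exists>e>0. \<exists>\<F>. (\<forall>f\<in>\<F>. holo_on f (ball q e)) \<and> (\<forall>q'\<in>ball q e. E q' = germ q' ` \<F>))"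

lemma local_systemE:
  assumes "local_system \<Omega> E" "q \<in> \<Omega>"
  obtains e \<F> where "e > 0" "\<forall>f\<in>\<F>. holo_on f (ball q e)" "\<forall>q'\<in>ball q e. E q' = germ q' ` \<F>"
  using bspec[OF assms(1)[unfolded local_system_def] assms(2)]
  by (elim exE conjE) (rule that)

text \<open>Continuation over a subinterval, with explicit distances in place of the filter, so that
  pieces can be glued.\<close>

definition continuation_between :: "(real \<Rightarrow> ('n::finite) point) \<Rightarrow> real \<Rightarrow> real \<Rightarrow> 'n cfun set \<Rightarrow> 'n cfun set \<Rightarrow> bool" where
  "continuation_between \<gamma> a b \<phi> \<psi> \<longleftrightarrow> (\<exists>F.
     (\<forall>t\<in>{a..b}. \<exists>S. \<gamma> t \<in> S \<and> holo_on (F t) S) \<and>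
     (\<forall>t\<in>{a..b}. \<exists>d>0. \<forall>s\<in>{a..b}. \<bar>s - t\<bar> < d \<longrightarrow> germ (\<gamma> s) (F s) = germ (\<gamma> s) (F t)) \<and>
     \<phi> = germ (\<gamma> a) (F a) \<and> \<psi> = germ (\<gamma> b) (F b))"

text \<open>At the junction the two witnesses may differ as functions; they share a germ, hence
  agree on a ball that the path does not leave for parameters near b.\<close>

lemma continuation_between_trans:
  assumes c: "continuation_between \<gamma> a b \<phi> \<psi>" "continuation_between \<gamma> b c \<psi> \<omega>"
    and ab: "a \<le> b" "b \<le> c" and \<gamma>: "continuous_on {a..c} \<gamma>"
  shows "continuation_between \<gamma> a c \<phi> \<omega>"
proof -
  obtain F where F: "\<And>t. t \<in> {a..b} \<Longrightarrow> \<exists>S. \<gamma> t \<in> S \<and> holo_on (F t) S"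
     "\<And>t. t \<in> {a..b} \<Longrightarrow> \<exists>d>0. \<forall>s\<in>{a..b}. \<bar>s - t\<bar> < d \<longrightarrow> germ (\<gamma> s) (F s) = germ (\<gamma> s) (F t)"
     "\<phi> = germ (\<gamma> a) (F a)" "\<psi> = germ (\<gamma> b) (F b)"
    using c(1) unfolding continuation_between_def by blast
  obtain G where G: "\<And>t. t \<in> {b..c} \<Longrightarrow> \<exists>S. \<gamma> t \<in> S \<and> holo_on (G t) S"
     "\<And>t. t \<in> {b..c} \<Longrightarrow> \<exists>d>0. \<forall>s\<in>{b..c}. \<bar>s - t\<bar> < d \<longrightarrow> germ (\<gamma> s) (G s) = germ (\<gamma> s) (G t)"
     "\<psi> = germ (\<gamma> b) (G b)" "\<omega> = germ (\<gamma> c) (G c)"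
    using c(2) unfolding continuation_between_def by blast
  define H where "H t = (if t < b then F t else G t)" for t
  have Hb: "germ (\<gamma> b) (H b) = germ (\<gamma> b) (F b)" using F(4) G(3) by (simp add: H_def)
  show ?thesis unfolding continuation_between_def
  proof (intro exI[of _ H] conjI ballI)
    fix t assume "t \<in> {a..c}"
    then show "\<exists>S. \<gamma> t \<in> S \<and> holo_on (H t) S" using F(1) G(1) by (auto simp: H_def)
  next
    fix t assume t: "t \<in> {a..c}"
    consider "t < b" | "t = b" | "t > b" by linarith
    then show "\<exists>d>0. \<forall>s\<in>{a..c}. \<bar>s - t\<bar> < d \<longrightarrow> germ (\<gamma> s) (H s) = germ (\<gamma> s) (H t)"
    proof cases
      case 1
      then obtain d where d: "d > 0" "\<forall>s\<in>{a..b}. \<bar>s - t\<bar> < d \<longrightarrow> germ (\<gamma> s) (F s) = germ (\<gamma> s) (F t)"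
        using F(2)[of t] t by auto
      show ?thesis by (rule exI[of _ "min d (b - t)"]) (use 1 d in \<open>auto simp: H_def\<close>)
    next
      case 3
      then obtain d where d: "d > 0" "\<forall>s\<in>{b..c}. \<bar>s - t\<bar> < d \<longrightarrow> germ (\<gamma> s) (G s) = germ (\<gamma> s) (G t)"
        using G(2)[of t] t by auto
      show ?thesis by (rule exI[of _ "min d (t - b)"]) (use 3 d in \<open>auto simp: H_def\<close>)
    next
      case 2
      obtain d1 where d1: "d1 > 0" "\<forall>s\<in>{a..b}. \<bar>s - b\<bar> < d1 \<longrightarrow> germ (\<gamma> s) (F s) = germ (\<gamma> s) (F b)"
        using F(2)[of b] ab by auto
      obtain d2 where d2: "d2 > 0" "\<forall>s\<in>{b..c}. \<bar>s - b\<bar> < d2 \<longrightarrow> germ (\<gamma> s) (G s) = germ (\<gamma> s) (G b)"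
        using G(2)[of b] ab by auto
      obtain e where e: "e > 0" "\<And>x. x \<in> ball (\<gamma> b) e \<Longrightarrow> germ x (F b) = germ x (G b)"
        using germ_eq_nearby[of "\<gamma> b" "F b" "G b"] F(4) G(3) by metis
      obtain d3 where d3: "d3 > 0" "\<forall>s\<in>{a..c}. dist s b < d3 \<longrightarrow> dist (\<gamma> s) (\<gamma> b) < e"
        using \<gamma> e(1) ab t unfolding continuous_on_iff by (meson atLeastAtMost_iff)
      show ?thesis
      proof (rule exI[of _ "min (min d1 d2) d3"], intro conjI ballI impI)
        fix s assume s: "s \<in> {a..c}" "\<bar>s - t\<bar> < min (min d1 d2) d3"
        then have near: "\<gamma> s \<in> ball (\<gamma> b) e" using d3(2) 2 by (auto simp: dist_real_def dist_commute)
        show "germ (\<gamma> s) (H s) = germ (\<gamma> s) (H t)"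
          using s d1(2) d2(2) e(2)[OF near] 2 by (auto simp: H_def)
      qed (use d1 d2 d3 in auto)
    qed
  next
    show "\<phi> = germ (\<gamma> a) (H a)" using F(3) Hb ab by (cases "a = b") (auto simp: H_def)
    show "\<omega> = germ (\<gamma> c) (H c)" using G(4) ab by (auto simp: H_def)
  qed
qed

text \<open>Bisection of the interval: over a piece short enough to stay in one ball of the local
  system, a single function is its own continuation.\<close>

lemma local_system_continuation:
  assumes E: "local_system \<Omega> E" and \<gamma>: "path \<gamma>" "path_image \<gamma> \<subseteq> \<Omega>" and \<phi>: "\<phi> \<in> E (\<gamma> 0)"
  shows "\<exists>\<psi>\<in>E (\<gamma> 1). analytic_continuation \<gamma> \<phi> \<psi>"
proof -
  define R where "R a b \<longleftrightarrow> (0 \<le> a \<and> b \<le> 1 \<longrightarrow> (\<forall>\<phi>\<in>E (\<gamma> a). \<exists>\<psi>\<in>E (\<gamma> b). continuation_between \<gamma> a b \<phi> \<psi>))" for a b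
  have cont: "continuous_on {0..1} \<gamma>" using \<gamma> by (simp add: path_def)
  have "(0::real) \<le> 1" by simp
  then have "R 0 1"
  proof (induction rule: Bolzano)
    case (trans a b c)
    show ?case unfolding R_def
    proof (intro impI ballI)
      fix \<phi> assume ac: "0 \<le> a \<and> c \<le> 1" and \<phi>: "\<phi> \<in> E (\<gamma> a)"
      then obtain \<psi> where 1: "\<psi> \<in> E (\<gamma> b)" "continuation_between \<gamma> a b \<phi> \<psi>"
        using trans unfolding R_def by fastforce
      then obtain \<omega> where 2: "\<omega> \<in> E (\<gamma> c)" "continuation_between \<gamma> b c \<psi> \<omega>"
        using trans ac unfolding R_def by fastforce
      have "continuous_on {a..c} \<gamma>" using cont ac by (rule_tac continuous_on_subset) auto
      then show "\<exists>\<psi>\<in>E (\<gamma> c). continuation_between \<gamma> a c \<phi> \<psi>"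
        using continuation_between_trans[OF 1(2) 2(2)] trans 2(1) by blast
    qed
  next
    case (local x)
    then have "\<gamma> x \<in> \<Omega>" using \<gamma>(2) by (auto simp: path_image_def)
    then obtain e \<F> where e: "e > 0" "\<forall>f\<in>\<F>. holo_on f (ball (\<gamma> x) e)" "\<forall>q'\<in>ball (\<gamma> x) e. E q' = germ q' ` \<F>"
      by (rule local_systemE[OF E])
    obtain d where d: "d > 0" "\<forall>s\<in>{0..1}. dist s x < d \<longrightarrow> dist (\<gamma> s) (\<gamma> x) < e"
      using cont e(1) local unfolding continuous_on_iff by (meson atLeastAtMost_iff)
    show ?case
    proof (intro exI[of _ d] conjI allI impI)
      fix a b assume ab: "a \<le> x \<and> x \<le> b \<and> b - a < d"
      show "R a b" unfolding R_def
      proof (intro impI ballI)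
        fix \<phi> assume 01: "0 \<le> a \<and> b \<le> 1" and \<phi>: "\<phi> \<in> E (\<gamma> a)"
        have near: "\<gamma> s \<in> ball (\<gamma> x) e" if "s \<in> {a..b}" for s
          using d(2) that ab 01 by (auto simp: dist_real_def dist_commute)
        then obtain f where f: "f \<in> \<F>" "\<phi> = germ (\<gamma> a) f" using \<phi> e(3) ab by fastforce
        have "continuation_between \<gamma> a b \<phi> (germ (\<gamma> b) f)"
          unfolding continuation_between_def
          by (rule exI[of _ "\<lambda>_. f"])
             (use near e(2) f in \<open>auto intro: exI[of _ 1] exI[of _ "ball (\<gamma> x) e"]\<close>)
        moreover have "germ (\<gamma> b) f \<in> E (\<gamma> b)" using near[of b] ab e(3) f by auto
        ultimately show "\<exists>\<psi>\<in>E (\<gamma> b). continuation_between \<gamma> a b \<phi> \<psi>" by blast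
      qed
    qed (use d in simp)
  qed
  then obtain \<psi> where \<psi>: "\<psi> \<in> E (\<gamma> 1)" "continuation_between \<gamma> 0 1 \<phi> \<psi>" using \<phi> by (auto simp: R_def)
  then obtain F where F: "\<forall>t\<in>{0..1}. \<exists>S. \<gamma> t \<in> S \<and> holo_on (F t) S"
     "\<forall>t\<in>{0..1}. \<exists>d>0. \<forall>s\<in>{0..1}. \<bar>s - t\<bar> < d \<longrightarrow> germ (\<gamma> s) (F s) = germ (\<gamma> s) (F t)"
     "\<phi> = germ (\<gamma> 0) (F 0)" "\<psi> = germ (\<gamma> 1) (F 1)"
    unfolding continuation_between_def by blast
  have "\<forall>\<^sub>F s in at t within {0..1}. germ (\<gamma> s) (F s) = germ (\<gamma> s) (F t)" if "t \<in> {0..1}" for t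
    using F(2) that unfolding eventually_at dist_real_def by blast
  then have "analytic_continuation \<gamma> \<phi> \<psi>" unfolding analytic_continuation_def using F by blast
  then show ?thesis using \<psi> by blast
qed

lemma local_system_monodromy_invariant:
  assumes E: "local_system \<Omega> E" and "- singular_locus G \<subseteq> \<Omega>"
  shows "monodromy_invariant G p (E p)"
  unfolding monodromy_invariant_def
proof (intro allI impI ballI)
  fix \<gamma> \<phi>
  assume *: "path \<gamma>" "pathstart \<gamma> = p" "pathfinish \<gamma> = p" "path_image \<gamma> \<subseteq> - singular_locus G" "\<phi> \<in> E p"
  have "path_image \<gamma> \<subseteq> \<Omega>" "\<phi> \<in> E (\<gamma> 0)" using * assms(2) by (auto simp: pathstart_def)
  from local_system_continuation[OF E *(1) this]
  obtain \<psi> where \<psi>: "\<psi> \<in> E (\<gamma> 1)" "analytic_continuation \<gamma> \<phi> \<psi>" by blast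
  have "monodromy \<gamma> \<phi> = \<psi>"
    unfolding monodromy_def using \<psi>(2) analytic_continuation_unique[OF *(1)] by (intro the_equality) blast+
  then show "monodromy \<gamma> \<phi> \<in> E p" using \<psi>(1) * by (simp add: pathfinish_def)
qed

text \<open>On a common ball the inclusion is a statement about the two families of functions alone,
  by the identity theorem; so it is locally constant in the base point.\<close>

lemma local_system_subset_transfer:
  assumes E: "local_system \<Omega> E" and V: "local_system \<Omega>' V"
    and S: "connected S" "S \<subseteq> \<Omega>" "S \<subseteq> \<Omega>'" "p \<in> S" "q \<in> S" and sub: "E p \<subseteq> V p"
  shows "E q \<subseteq> V q"
proof -
  have "(E p \<subseteq> V p) = (E q \<subseteq> V q)"
  proof (rule connected_equivalence_relation[of S p q "\<lambda>a b. (E a \<subseteq> V a) = (E b \<subseteq> V b)"])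
    fix a assume a: "a \<in> S"
    obtain e1 F1 where 1: "e1 > 0" "\<forall>f\<in>F1. holo_on f (ball a e1)" "\<forall>q'\<in>ball a e1. E q' = germ q' ` F1"
      by (rule local_systemE[OF E subsetD[OF S(2) a]])
    obtain e2 F2 where 2: "e2 > 0" "\<forall>f\<in>F2. holo_on f (ball a e2)" "\<forall>q'\<in>ball a e2. V q' = germ q' ` F2"
      by (rule local_systemE[OF V subsetD[OF S(3) a]])
    define e where "e = min e1 e2"
    have e: "e > 0" "ball a e \<subseteq> ball a e1" "ball a e \<subseteq> ball a e2" using 1 2 by (auto simp: e_def)
    have h: "holo_on f (ball a e)" if "f \<in> F1 \<union> F2" for f
      using that 1 2 e by (auto elim!: holo_on_subset)
    have key: "E b \<subseteq> V b \<longleftrightarrow> (\<forall>f\<in>F1. \<exists>g\<in>F2. \<forall>y\<in>ball a e. f y = g y)" if b: "b \<in> ball a e" for b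
    proof -
      have "E b \<subseteq> V b \<longleftrightarrow> (\<forall>f\<in>F1. \<exists>g\<in>F2. germ b f = germ b g)"
      proof -
        have "b \<in> ball a e1" "b \<in> ball a e2" using b e by blast+
        then have "E b = germ b ` F1" "V b = germ b ` F2" using 1(3) 2(3) by blast+
        then show ?thesis by (auto simp: subset_iff image_iff)
      qed
      also have "\<dots> \<longleftrightarrow> (\<forall>f\<in>F1. \<exists>g\<in>F2. \<forall>y\<in>ball a e. f y = g y)"
        by (intro ball_cong bex_cong refl germ_eq_ball_iff h b) auto
      finally show ?thesis .
    qed
    show "\<exists>T. openin (top_of_set S) T \<and> a \<in> T \<and> (\<forall>x\<in>T. (E a \<subseteq> V a) = (E x \<subseteq> V x))"
      by (rule exI[of _ "S \<inter> ball a e"]) (use key a e in \<open>auto simp: openin_open_Int\<close>)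
  qed (use S in auto)
  then show ?thesis using sub by simp
qed

subsection \<open>Roots off the discriminant\<close>

lemma coeff_prod_linear:
  fixes y :: "'a \<Rightarrow> complex"
  assumes "finite A"
  shows "coeff (\<Prod>a\<in>A. [:- y a, 1:]) (card A) = 1 \<and> degree (\<Prod>a\<in>A. [:- y a, 1:]) \<le> card A \<and>
    (A \<noteq> {} \<longrightarrow> coeff (\<Prod>a\<in>A. [:- y a, 1:]) (card A - 1) = - (\<Sum>a\<in>A. y a))"
  using assms
proof (induction A rule: finite_induct)
  case empty
  then show ?case by simp
next
  case (insert a A)
  define q where "q = (\<Prod>a\<in>A. [:- y a, 1:])"
  have e: "(\<Prod>a\<in>insert a A. [:- y a, 1:]) = smult (- y a) q + pCons 0 q"
    using insert by (simp add: q_def)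
  have deg: "degree q \<le> card A" "coeff q (card A) = 1" using insert.IH by (auto simp: q_def)
  have z: "coeff q (Suc (card A)) = 0" using deg(1) by (simp add: coeff_eq_0)
  have "coeff (pCons 0 q) (card A) = - (\<Sum>a\<in>A. y a)"
    using insert.IH insert.hyps by (cases "A = {}") (auto simp: q_def coeff_pCons split: nat.splits)
  moreover have "degree (smult (- y a) q + pCons 0 q) \<le> Suc (card A)"
    using deg(1) by (intro degree_add_le) (auto intro: order_trans[OF degree_smult_le] order_trans[OF degree_pCons_le])
  ultimately show ?case unfolding e using insert.hyps deg z by (simp add: coeff_pCons split: nat.splits)
qed

context mellin_equation
begin

lemma cpoly_degree: "degree (cpoly x) \<le> m" "coeff (cpoly x) m = 1"
proof -
  show "coeff (cpoly x) m = 1"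
    using m_pos less_imp_neq[OF ms_less] by (simp add: cpoly_def coeff_sum)
  show "degree (cpoly x) \<le> m" unfolding cpoly_def
    using ms_less by (intro degree_diff_le degree_add_le degree_sum_le)
      (auto intro: order_trans[OF degree_monom_le] less_imp_le)
qed

lemma cpoly_degree_eq: "degree (cpoly x) = m" "lead_coeff (cpoly x) = 1"
  using cpoly_degree[of x] le_degree[of "cpoly x" m] by auto

text \<open>The modulus of the value at a is the product of the distances from a to the m roots, so
  one distance is smaller than r.\<close>

lemma small_value_root_near:
  assumes "norm (cp x a) < r ^ m" "0 < r"
  shows "\<exists>z\<in>ball a r. cp x z = 0"
proof (rule ccontr)
  assume no: "\<not> ?thesis"
  obtain root where root: "smult (lead_coeff (cpoly x)) (\<Prod>i<degree (cpoly x). [:-root i, 1:]) = cpoly x"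
    by (rule complex_poly_decompose')
  have e: "cp x w = (\<Prod>i<m. w - root i)" for w
    unfolding poly_cpoly[symmetric] by (subst root[symmetric]) (simp add: cpoly_degree cpoly_degree_eq poly_prod)
  have "r \<le> norm (a - root i)" if "i < m" for i
  proof -
    have "cp x (root i) = 0" unfolding e using that by (auto intro!: prod_zero)
    then have "root i \<notin> ball a r" using no by blast
    then show ?thesis by (simp add: dist_norm)
  qed
  then have "(\<Prod>i<m. r) \<le> (\<Prod>i<m. norm (a - root i))"
    using assms(2) by (intro prod_mono) auto
  then show False using assms(1) by (simp add: e prod_norm)
qed

lemma cp_eq_prod:
  assumes A: "finite A" "card A = m" and y: "inj_on y A" "\<And>a. a \<in> A \<Longrightarrow> cp x (y a) = 0"
  shows "cp x w = (\<Prod>a\<in>A. w - y a)" and "A \<noteq> {}"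
    and "(\<Sum>a\<in>A. y a) = - coeff (cpoly x) (m - 1)"
proof -
  show "A \<noteq> {}" using A m_pos by auto
  note c = coeff_prod_linear[OF A(1), of y]
  have e: "cpoly x = (\<Prod>a\<in>A. [:- y a, 1:])"
  proof (rule poly_eqI_degree_lead_coeff[where n=m and A="y ` A"])
    fix z assume "z \<in> y ` A"
    then show "poly (cpoly x) z = poly (\<Prod>a\<in>A. [:- y a, 1:]) z"
      using y A by (auto simp: poly_cpoly poly_prod intro!: prod_zero[symmetric])
  qed (use c A y cpoly_degree in \<open>auto simp: card_image\<close>)
  show "cp x w = (\<Prod>a\<in>A. w - y a)"
    unfolding poly_cpoly[symmetric] e by (simp add: poly_prod)
  show "(\<Sum>a\<in>A. y a) = - coeff (cpoly x) (m - 1)"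
    unfolding e using c \<open>A \<noteq> {}\<close> A by simp
qed

definition roots :: "'n point \<Rightarrow> complex set" where "roots q = {w. cp q w = 0}"

lemma finite_roots: "finite (roots q)"
  unfolding roots_def poly_cpoly[symmetric] using poly_roots_finite[OF cpoly_nonzero] .

lemma card_roots: assumes "q \<notin> discriminant_locus" shows "card (roots q) = m"
proof -
  have "rsquarefree (cpoly q)"
    using assms unfolding rsquarefree_roots poly_cpoly poly_pderiv_cpoly discriminant_locus_def by blast
  from complex_poly_decompose_rsquarefree[OF this]
  have "cpoly q = (\<Prod>z\<in>roots q. [:-z, 1:])" by (simp add: cpoly_degree cpoly_degree_eq roots_def poly_cpoly)
  then have "degree (cpoly q) = (\<Sum>z\<in>roots q. 1)" by (simp add: degree_prod_sum_eq)
  then show ?thesis by (simp add: cpoly_degree_eq)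
qed

end

text \<open>
  Near a point \<open>q\<close> off the discriminant every disc of radius \<open>r\<close> around a root of the equation
  at \<open>q\<close> contains exactly one root \<open>y a x\<close> of the equation at \<open>x\<close>.
\<close>

locale separated_roots = mellin_equation m ms eps
  for m and ms :: "'n::{finite,linorder} \<Rightarrow> nat" and eps +
  fixes q :: "'n point" and r e :: real and y :: "complex \<Rightarrow> 'n point \<Rightarrow> complex"
  assumes r: "0 < r" and e: "0 < e"
    and card: "card (roots q) = m"
    and r_small: "\<And>a. a \<in> roots q \<Longrightarrow> 2 * r < norm a"
    and r_sep: "\<And>a b. a \<in> roots q \<Longrightarrow> b \<in> roots q \<Longrightarrow> a \<noteq> b \<Longrightarrow> 4 * r < dist a b"
    and y_ball: "\<And>a x. a \<in> roots q \<Longrightarrow> x \<in> ball q e \<Longrightarrow> y a x \<in> ball a r"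
    and y_root: "\<And>a x. a \<in> roots q \<Longrightarrow> x \<in> ball q e \<Longrightarrow> cp x (y a x) = 0"

lemma (in mellin_equation) separated_roots_exist:
  assumes q: "q \<notin> discriminant_locus"
  shows "\<exists>r e y. separated_roots m ms eps q r e y"
proof -
  define A where "A = roots q"
  have A: "finite A" "card A = m" using finite_roots card_roots[OF q] by (auto simp: A_def)
  \<comment> \<open>The divisors 3 and 5 give the strict bounds 2 r < |a| and 4 r < |a - b|: discs
    of radius 2 r avoid 0, and no root near another centre can enter them.\<close>
  define B where "B = insert 1 ((\<lambda>a. norm a / 3) ` A \<union> (\<lambda>(a, b). dist a b / 5) ` {(a, b) \<in> A \<times> A. a \<noteq> b})"
  have B: "finite B" "B \<noteq> {}"
    unfolding B_def using A
    by (auto intro!: finite_imageI intro: finite_subset[of _ "A \<times> A"])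
  have Bpos: "0 < b" if "b \<in> B" for b
    using that root_nonzero by (auto simp: B_def A_def roots_def)
  define r where "r = Min B"
  have r: "0 < r" unfolding r_def using B Bpos by simp
  have r1: "2 * r < norm a" if "a \<in> A" for a
  proof -
    have "r \<le> norm a / 3" unfolding r_def using B that by (intro Min_le) (auto simp: B_def)
    then show ?thesis using r by linarith
  qed
  have r2: "4 * r < dist a b" if "a \<in> A" "b \<in> A" "a \<noteq> b" for a b
  proof -
    have "dist a b / 5 \<in> B" using that by (force simp: B_def)
    then have "r \<le> dist a b / 5" unfolding r_def using B by (intro Min_le)
    then show ?thesis using r by linarith
  qed
  have "\<forall>\<^sub>F x in nhds q. \<forall>a\<in>A. norm (cp x a) < r ^ m"
  proof (rule eventually_ball_finite[OF A(1)], intro ballI)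
    fix a assume a: "a \<in> A"
    have c: "continuous_on UNIV (\<lambda>x. norm (cp x a))"
      by (intro continuous_intros cp_continuous_compose)
    have "open {x. norm (cp x a) < r ^ m}" by (intro open_Collect_less c continuous_intros)
    moreover have "q \<in> {x. norm (cp x a) < r ^ m}" using a r by (simp add: A_def roots_def)
    ultimately show "\<forall>\<^sub>F x in nhds q. norm (cp x a) < r ^ m"
      unfolding eventually_nhds by blast
  qed
  then obtain e where e: "e > 0" "\<And>x. dist x q < e \<Longrightarrow> \<forall>a\<in>A. norm (cp x a) < r ^ m"
    unfolding eventually_nhds_metric by blast
  \<comment> \<open>An arbitrary choice. Holomorphy in x follows later, from the expression of the
    chosen root as an integral.\<close>
  define y where "y a x = (SOME z. z \<in> ball a r \<and> cp x z = 0)" for a x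
  have y: "y a x \<in> ball a r \<and> cp x (y a x) = 0" if "a \<in> A" "x \<in> ball q e" for a x
  proof -
    have "norm (cp x a) < r ^ m" using e(2)[of x] that by (simp add: dist_commute)
    from small_value_root_near[OF this r] show ?thesis unfolding y_def by (metis (mono_tags, lifting) someI_ex)
  qed
  have "separated_roots m ms eps q r e y"
    by unfold_locales (use r e r1 r2 y A in \<open>auto simp: A_def\<close>)
  then show ?thesis by blast
qed

section \<open>Roots and their logarithms as circle integrals\<close>

context separated_roots
begin

abbreviation "A \<equiv> roots q"

lemma y_inj: assumes "x \<in> ball q e" shows "inj_on (\<lambda>a. y a x) A"
proof (rule inj_onI, rule ccontr)
  fix a b assume *: "a \<in> A" "b \<in> A" "y a x = y b x" "a \<noteq> b"
  have "dist a b \<le> dist a (y a x) + dist b (y b x)" using *(3) by (metis dist_commute dist_triangle)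
  then show False using r_sep[OF *(1,2,4)] y_ball[OF *(1) assms] y_ball[OF *(2) assms] r by simp
qed

lemma cp_prod: "x \<in> ball q e \<Longrightarrow> cp x w = (\<Prod>a\<in>A. w - y a x)"
  using cp_eq_prod(1)[OF finite_roots card y_inj] y_root by blast

lemma roots_eq: "x \<in> ball q e \<Longrightarrow> roots x = (\<lambda>a. y a x) ` A"
  using cp_prod finite_roots by (auto simp: roots_def)

lemma y_q: assumes "a \<in> A" shows "y a q = a"
proof -
  have q: "q \<in> ball q e" using e by simp
  then obtain b where b: "b \<in> A" "a = y b q" using roots_eq assms by blast
  have "b = a"
  proof (rule ccontr)
    assume "b \<noteq> a"
    then have "4 * r < dist b a" using r_sep b assms by blast
    then show False using y_ball[OF b(1) q] b(2) r by simp
  qed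
  then show ?thesis using b by simp
qed

lemma sphere_nonroot:
  assumes "x \<in> ball q e" "a \<in> A" "b \<in> A" "w \<in> sphere a r" shows "w \<noteq> y b x"
proof
  assume w: "w = y b x"
  have 1: "dist b w < r" using y_ball[OF assms(3,1)] w by simp
  show False
  proof (cases "a = b")
    case False
    then have "4 * r < dist a b" using r_sep assms by blast
    then show False using dist_triangle[of a b w] 1 assms(4) r by (simp add: dist_commute)
  qed (use 1 assms in simp)
qed

lemma ball_subset_circ_dom: "ball q e \<subseteq> circ_dom A r"
  unfolding circ_dom_def using sphere_nonroot by (auto simp: cp_prod finite_roots)

lemma cp'_div_cp:
  assumes x: "x \<in> ball q e" and w: "cp x w \<noteq> 0"
  shows "cp' x w / cp x w = (\<Sum>a\<in>A. 1 / (w - y a x))"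
proof -
  have cpp: "cpoly x = (\<Prod>a\<in>A. [:- y a x, 1:])"
    by (rule poly_eq_poly_eq_iff[THEN iffD1]) (auto simp: poly_cpoly cp_prod[OF x] poly_prod)
  have "cp' x w = (\<Sum>a\<in>A. \<Prod>b\<in>A - {a}. w - y b x)"
    unfolding poly_pderiv_cpoly[symmetric] cpp pderiv_prod
    by (simp add: poly_sum poly_prod pderiv_pCons)
  moreover have "(\<Prod>b\<in>A - {a}. w - y b x) = cp x w * (1 / (w - y a x))" if "a \<in> A" for a
  proof -
    have "cp x w = (w - y a x) * (\<Prod>b\<in>A - {a}. w - y b x)"
      unfolding cp_prod[OF x] by (rule prod.remove[OF finite_roots that])
    moreover have "w - y a x \<noteq> 0" using w y_root[OF that x] by auto
    ultimately show ?thesis by simp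
  qed
  ultimately have "cp' x w = cp x w * (\<Sum>a\<in>A. 1 / (w - y a x))"
    by (simp add: sum_distrib_left)
  then show ?thesis using w by simp
qed

sublocale mellin_circles m ms eps A r "2 * r"
  by unfold_locales (use r finite_roots in auto)

text \<open>The left side integrates g P'/P. This quotient is the sum of 1/(w - y b x), and only the
  root with b = a lies in the disc around a.\<close>

lemma K_log_derivative:
  assumes g: "hol_family g" and x: "x \<in> ball q e"
  shows "of_nat m * K A r (\<lambda>a w. w ^ (m - 1) * g a w) 1 x
    + (\<Sum>j\<in>UNIV. eps j * x $ j * (of_nat (ms j) * K A r (\<lambda>a w. w ^ (ms j - 1) * g a w) 1 x))
    = (\<Sum>a\<in>A. g a (y a x))"
proof -
  have xd: "x \<in> circ_dom A r" using x ball_subset_circ_dom by blast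
  define G where "G a w = of_nat m * (w ^ (m - 1) * g a w) +
     (\<Sum>j\<in>UNIV. (eps j * x $ j * of_nat (ms j)) * (w ^ (ms j - 1) * g a w))" for a w
  have G: "G a w = cp' x w * g a w" for a w
    by (simp add: G_def cp'_def algebra_simps sum_distrib_left)
  have "K A r G 1 x = of_nat m * K A r (\<lambda>a w. w ^ (m - 1) * g a w) 1 x
     + (\<Sum>j\<in>UNIV. (eps j * x $ j * of_nat (ms j)) * K A r (\<lambda>a w. w ^ (ms j - 1) * g a w) 1 x)"
    unfolding G_def
    apply (subst K_add)
    using g xd apply (auto simp: hol_family_def intro!: holomorphic_intros)[3]
    apply (subst K_sum)
    using g xd apply (auto simp: hol_family_def intro!: holomorphic_intros)[3]
    by (simp add: K_cmult)
  moreover have "K A r G 1 x = (\<Sum>a\<in>A. g a (y a x))"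
    unfolding K_def
  proof (intro sum.cong refl)
    fix a assume a: "a \<in> A"
    have "circ_int a r (\<lambda>w. G a w / cp x w ^ 1) = circ_int a r (\<lambda>w. \<Sum>b\<in>A. g a w / (w - y b x))"
    proof (rule circ_int_cong)
      fix w assume "w \<in> sphere a r"
      then have "cp x w \<noteq> 0" using xd a by (auto simp: circ_dom_def)
      then have "G a w / cp x w ^ 1 = g a w * (\<Sum>b\<in>A. 1 / (w - y b x))"
        unfolding cp'_div_cp[OF x \<open>cp x w \<noteq> 0\<close>, symmetric] by (simp add: G mult.commute)
      then show "G a w / cp x w ^ 1 = (\<Sum>b\<in>A. g a w / (w - y b x))" by (simp add: sum_distrib_left)
    qed (use r in simp)
    also have "\<dots> = (\<Sum>b\<in>A. circ_int a r (\<lambda>w. g a w / (w - y b x)))"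
      using sphere_nonroot[OF x a] r
      by (intro circ_int_sum continuous_intros hol_family_cont[OF g a] finite_roots) auto
    also have "\<dots> = (\<Sum>b\<in>A. if a = b then g a (y a x) else 0)"
    proof (intro sum.cong refl)
      fix b assume b: "b \<in> A"
      have ga: "g a holomorphic_on ball a (2 * r)" using g a by (simp add: hol_family_def)
      show "circ_int a r (\<lambda>w. g a w / (w - y b x)) = (if a = b then g a (y a x) else 0)"
      proof (cases "a = b")
        case True
        then show ?thesis using circ_int_Cauchy[OF ga _ y_ball[OF a x]] r by simp
      next
        case False
        have "w \<noteq> y b x" if "w \<in> ball a (2 * r)" for w
          using that r_sep[OF a b False] y_ball[OF b x] dist_triangle[of a b w] r by (auto simp: dist_commute)
        then have "(\<lambda>w. g a w / (w - y b x)) holomorphic_on ball a (2 * r)"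
          using ga by (intro holomorphic_intros) auto
        then show ?thesis using False r by (auto intro!: circ_int_holomorphic)
      qed
    qed
    also have "\<dots> = g a (y a x)" using a finite_roots by simp
    finally show "circ_int a r (\<lambda>w. G a w / cp x w ^ 1) = g a (y a x)" .
  qed
  ultimately show ?thesis by (simp add: mult.assoc)
qed

text \<open>Division by a moves the disc around a into the right half-plane, away from the cut of
  \<open>Ln\<close>.\<close>

definition lg :: "complex \<Rightarrow> complex \<Rightarrow> complex" where "lg a w = Ln (w / a) + Ln a"

lemma in_ball_nonpos: assumes "a \<in> A" "w \<in> ball a (2 * r)" shows "w / a \<notin> \<real>\<^sub>\<le>\<^sub>0" "w \<noteq> 0" "a \<noteq> 0"
proof -
  show a: "a \<noteq> 0" using r_small[OF assms(1)] r by auto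
  have "norm (w - a) < norm a" using r_small[OF assms(1)] assms(2) by (simp add: dist_norm norm_minus_commute)
  moreover have "w / a - 1 = (w - a) / a" using a by (simp add: diff_divide_distrib)
  ultimately have "norm (w / a - 1) < 1" using a by (simp add: norm_divide divide_less_eq)
  then have "Re (w / a) > 0" using abs_Re_le_cmod[of "w / a - 1"] by simp
  then show "w / a \<notin> \<real>\<^sub>\<le>\<^sub>0" "w \<noteq> 0" by (auto simp: complex_nonpos_Reals_iff)
qed

lemma lg_deriv: "a \<in> A \<Longrightarrow> w \<in> ball a (2 * r) \<Longrightarrow> (lg a has_field_derivative 1 / w) (at w)"
  unfolding lg_def[abs_def] using in_ball_nonpos[of a w]
  by (auto intro!: derivative_eq_intros simp: field_simps)

lemma exp_lg: "a \<in> A \<Longrightarrow> w \<in> ball a (2 * r) \<Longrightarrow> exp (lg a w) = w"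
  using in_ball_nonpos[of a w] by (simp add: lg_def exp_add)

text \<open>The extra constant kap cancels against the one in w (h - kap), so that \<open>Y\<close>
  becomes the sum of (c + kap log y) y.\<close>

lemma functional:
  "mellin_functional m ms eps A r (2 * r) (\<lambda>a w. c a + kap + kap * lg a w) (\<lambda>a w. kap / w) kap"
proof unfold_locales
  fix a w assume *: "a \<in> A" "w \<in> ball a (2 * r)"
  show "((\<lambda>w. c a + kap + kap * lg a w) has_field_derivative kap / w) (at w)"
    using * by (auto intro!: derivative_eq_intros lg_deriv)
  show "w * (kap / w) = kap" using in_ball_nonpos[OF *] by simp
qed

definition comb :: "(complex \<Rightarrow> complex) \<Rightarrow> complex \<Rightarrow> 'n cfun" where
  "comb c kap x = (\<Sum>a\<in>A. (c a + kap * lg a (y a x)) * y a x)"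

lemma comb_eq_Y:
  assumes x: "x \<in> ball q e"
  shows "mellin_functional.Y m ms eps A r (\<lambda>a w. c a + kap + kap * lg a w) kap x = comb c kap x"
    and "mellin_functional.U0 m ms eps A r x = (\<Sum>a\<in>A. y a x)"
proof -
  interpret F: mellin_functional m ms eps A r "2 * r" "\<lambda>a w. c a + kap + kap * lg a w" "\<lambda>a w. kap / w" kap
    by (rule functional)
  have pw: "w ^ s = w ^ (s - 1) * w" if "0 < s" for w :: complex and s using that by (cases s) auto
  have "of_nat m * K A r (\<lambda>a w. w ^ (m - 1) * (w * 1)) 1 x
    + (\<Sum>j\<in>UNIV. eps j * x $ j * (of_nat (ms j) * K A r (\<lambda>a w. w ^ (ms j - 1) * (w * 1)) 1 x))
    = (\<Sum>a\<in>A. y a x * 1)"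
    using K_log_derivative[of "\<lambda>a w. w * 1" x] x by (simp add: hol_family_def holomorphic_on_ident)
  then show U0: "mellin_functional.U0 m ms eps A r x = (\<Sum>a\<in>A. y a x)"
    unfolding F.U0_def F.U_def mult_1_right pw[OF m_pos, symmetric] pw[OF ms_pos, symmetric] .
  have "of_nat m * K A r (\<lambda>a w. w ^ (m - 1) * (w * (c a + kap + kap * lg a w))) 1 x
    + (\<Sum>j\<in>UNIV. eps j * x $ j * (of_nat (ms j) * K A r (\<lambda>a w. w ^ (ms j - 1) * (w * (c a + kap + kap * lg a w))) 1 x))
    = (\<Sum>a\<in>A. y a x * (c a + kap + kap * lg a (y a x)))"
    by (rule K_log_derivative[OF hol_family_mult[OF _ F.hol_h] x])
       (simp add: hol_family_def holomorphic_on_ident)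
  then have "F.Y x = (\<Sum>a\<in>A. y a x * (c a + kap + kap * lg a (y a x))) - kap * (\<Sum>a\<in>A. y a x)"
    unfolding F.Y_def F.T_def U0 using m_pos ms_pos by (simp only: mult.assoc[symmetric] pw[symmetric])
  also have "\<dots> = comb c kap x"
    by (simp add: comb_def sum_distrib_left sum_subtractf[symmetric] algebra_simps)
  finally show "F.Y x = comb c kap x" .
qed

lemma agree_comb:
  "agree_on (ball q e) (comb c kap) (mellin_functional.Y m ms eps A r (\<lambda>a w. c a + kap + kap * lg a w) kap)"
  by (simp add: agree_on_def comb_eq_Y)

lemma holo_on_cong: "agree_on S f g \<Longrightarrow> holo_on g S \<Longrightarrow> holo_on f S" for f g :: "'n cfun"
  unfolding holo_on_def agree_on_def
  by (metis has_derivative_transform_within_open)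

lemma holo_comb: "holo_on (comb c kap) (ball q e)"
  by (rule holo_on_cong[OF agree_comb])
     (rule holo_on_subset[OF mellin_functional.holo_on_Y[OF functional] open_ball ball_subset_circ_dom])

text \<open>\<open>U0\<close> is the sum of the roots, hence minus the coefficient of w^(m-1), and
  this is 0 when every exponent is below m - 1.\<close>

lemma mellin_op_comb:
  assumes "kap = 0 \<or> (\<forall>j. ms j < m - 1)" "x \<in> ball q e"
  shows "mellin_op m ms j (comb c kap) x = 0"
proof -
  have U0: "mellin_functional.U0 m ms eps A r x = 0" if "\<forall>j. ms j < m - 1" "x \<in> ball q e" for x
  proof -
    have "(\<Sum>a\<in>A. y a x) = - coeff (cpoly x) (m - 1)"
      using cp_eq_prod(3)[OF finite_roots card y_inj] y_root that by blast
    moreover have "coeff (cpoly x) (m - 1) = 0"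
      using m_ge2 less_imp_neq[OF that(1)[rule_format]] by (simp add: cpoly_def coeff_sum)
    ultimately show ?thesis using comb_eq_Y(2)[OF that(2)] by simp
  qed
  have "mellin_op m ms j (mellin_functional.Y m ms eps A r (\<lambda>a w. c a + kap + kap * lg a w) kap) x = 0"
    by (rule mellin_functional.mellin_op_Y[OF functional open_ball ball_subset_circ_dom _ assms(2)])
       (use assms U0 in blast)
  then show ?thesis using mellin_op_cong[OF agree_comb assms(2)] by metis
qed

lemma mpd_comb:
  assumes "0 < (\<Sum>j\<in>UNIV. \<beta> j)"
  shows "mpd \<beta> (comb c kap) q = (\<Prod>j\<in>UNIV. eps j ^ \<beta> j) * ((-1) ^ (\<Sum>j\<in>UNIV. \<beta> j) * fact ((\<Sum>j\<in>UNIV. \<beta> j) - 1) *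
     mellin_functional.T m ms eps A r (\<lambda>a w. c a + kap + kap * lg a w) (\<Sum>j\<in>UNIV. \<beta> j * ms j) (\<Sum>j\<in>UNIV. \<beta> j) q)"
proof -
  have q: "q \<in> ball q e" using e by simp
  interpret F: mellin_functional m ms eps A r "2 * r" "\<lambda>a w. c a + kap + kap * lg a w" "\<lambda>a w. kap / w" kap
    by (rule functional)
  have "mpd \<beta> (comb c kap) q = mpd \<beta> F.Y q"
    using mpd_cong[OF agree_comb] q by (auto simp: agree_on_def)
  also have "\<dots> = (\<Prod>j\<in>UNIV. eps j ^ \<beta> j) * F.level (\<Sum>j\<in>UNIV. \<beta> j * ms j) (\<Sum>j\<in>UNIV. \<beta> j) q"
  proof -
    have "q \<in> cdom" using q ball_subset_circ_dom by blast
    then show ?thesis using F.mpd_Y[of \<beta>] by (simp add: agree_on_def)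
  qed
  finally show ?thesis using assms unfolding F.level_def by (simp only: if_False less_not_refl2)
qed

end

section \<open>The local systems built from the roots\<close>

context mellin_equation
begin

text \<open>Labels, neighbourhood and branches are arbitrary, so that \<open>root_germs\<close>
  depends on no choice of discs and is the same notion at all base points.\<close>

definition root_frame :: "complex set \<Rightarrow> 'n point set \<Rightarrow> (complex \<Rightarrow> 'n cfun) \<Rightarrow> (complex \<Rightarrow> 'n cfun) \<Rightarrow> bool" where
  "root_frame A S y L \<longleftrightarrow> open S \<and> finite A \<and>
     (\<forall>a\<in>A. continuous_on S (y a) \<and> continuous_on S (L a) \<and> (\<forall>x\<in>S. exp (L a x) = y a x)) \<and>
     (\<forall>x\<in>S. inj_on (\<lambda>a. y a x) A \<and> roots x = (\<lambda>a. y a x) ` A)"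

text \<open>For \<open>kap = 0\<close> this is the linear span of the roots, and for \<open>kap = 1\<close> it is the set of
  all branches of the sum of \<open>y log y\<close> over the roots, translated by that span.\<close>

definition root_germs :: "complex \<Rightarrow> 'n point \<Rightarrow> 'n cfun set set" where
  "root_germs kap p = {germ p (\<lambda>x. \<Sum>a\<in>A. (c a + kap * L a x) * y a x) | A S y L c. root_frame A S y L \<and> p \<in> S}"

text \<open>Near p two frames differ by the bijection \<open>\<pi>\<close> of labels that matches
  the values at p, and by constants \<open>\<delta> a\<close> between the logarithms. These
  constants multiply roots and are absorbed into the coefficients.\<close>

lemma root_frame_match:
  assumes F: "root_frame A S y L" and G: "root_frame B S' Y M" and p: "p \<in> S" "p \<in> S'"
  shows "\<exists>c'. germ p (\<lambda>x. \<Sum>a\<in>A. (c a + kap * L a x) * y a x) = germ p (\<lambda>x. \<Sum>b\<in>B. (c' b + kap * M b x) * Y b x)"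
proof -
  have oS: "open S" "open S'" "finite A" "finite B" using F G by (auto simp: root_frame_def)
  have cont: "\<And>a. a \<in> A \<Longrightarrow> isCont (y a) p" "\<And>a. a \<in> A \<Longrightarrow> isCont (L a) p"
      "\<And>b. b \<in> B \<Longrightarrow> isCont (Y b) p" "\<And>b. b \<in> B \<Longrightarrow> isCont (M b) p"
    using F G p by (auto simp: root_frame_def continuous_on_eq_continuous_at)
  have ex: "\<And>a x. a \<in> A \<Longrightarrow> x \<in> S \<Longrightarrow> exp (L a x) = y a x" "\<And>b x. b \<in> B \<Longrightarrow> x \<in> S' \<Longrightarrow> exp (M b x) = Y b x"
    using F G by (auto simp: root_frame_def)
  have rt: "\<And>x. x \<in> S \<Longrightarrow> roots x = (\<lambda>a. y a x) ` A" "\<And>x. x \<in> S' \<Longrightarrow> roots x = (\<lambda>b. Y b x) ` B"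
    using F G by (auto simp: root_frame_def)
  have bA: "bij_betw (\<lambda>a. y a p) A (roots p)" and bB: "bij_betw (\<lambda>b. Y b p) B (roots p)"
    using F G p by (auto simp: root_frame_def bij_betw_def)
  define \<pi> where "\<pi> = inv_into B (\<lambda>b. Y b p) \<circ> (\<lambda>a. y a p)"
  have bij: "bij_betw \<pi> A B" unfolding \<pi>_def by (rule bij_betw_trans[OF bA bij_betw_inv_into[OF bB]])
  have \<pi>B: "\<pi> a \<in> B" if "a \<in> A" for a using bij that by (auto simp: bij_betw_def)
  have \<pi>p: "Y (\<pi> a) p = y a p" if "a \<in> A" for a
    unfolding \<pi>_def o_def using bA bB that by (intro f_inv_into_f[of _ "\<lambda>b. Y b p"]) (auto simp: bij_betw_def)
  define \<delta> where "\<delta> a = L a p - M (\<pi> a) p" for a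
  have exp\<delta>: "exp (\<delta> a) = 1" if "a \<in> A" for a
  proof -
    have "exp (L a p) = exp (M (\<pi> a) p)" using ex that \<pi>B \<pi>p p by simp
    then show ?thesis by (simp add: \<delta>_def exp_diff)
  qed
  define c' where "c' b = c (inv_into A \<pi> b) + kap * \<delta> (inv_into A \<pi> b)" for b
  have c': "c' (\<pi> a) = c a + kap * \<delta> a" if "a \<in> A" for a
    using bij that by (simp add: c'_def bij_betw_def inv_into_f_f)
  have e1: "\<forall>\<^sub>F x in nhds p. x \<in> S \<inter> S'"
    using oS p by (intro eventually_nhds_in_open) auto
  have e2: "\<forall>\<^sub>F x in nhds p. \<forall>a\<in>A. \<forall>b\<in>B. b \<noteq> \<pi> a \<longrightarrow> y a x \<noteq> Y b x"
  proof (intro eventually_ball_finite oS ballI)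
    fix a b assume ab: "a \<in> A" "b \<in> B"
    show "\<forall>\<^sub>F x in nhds p. b \<noteq> \<pi> a \<longrightarrow> y a x \<noteq> Y b x"
    proof (cases "b = \<pi> a")
      case False
      then have "Y b p \<noteq> Y (\<pi> a) p" using bB ab \<pi>B by (auto simp: bij_betw_def inj_on_def)
      then have nz: "y a p - Y b p \<noteq> 0" using \<pi>p ab by simp
      have "isCont (\<lambda>x. y a x - Y b x) p" using cont ab by (intro continuous_intros)
      then have "\<forall>\<^sub>F x in nhds p. y a x - Y b x \<noteq> 0"
        using nz continuous_at_avoid[of p "\<lambda>x. y a x - Y b x" 0]
        unfolding eventually_nhds_metric by (metis dist_commute)
      then show ?thesis by eventually_elim simp
    qed simp
  qed
  \<comment> \<open>Two logarithms of the same number coincide once their imaginary parts differ by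
    less than 2 pi.\<close>
  have e3: "\<forall>\<^sub>F x in nhds p. \<forall>a\<in>A. \<bar>Im (L a x) - Im (M (\<pi> a) x + \<delta> a)\<bar> < 2 * pi"
  proof (intro eventually_ball_finite oS ballI)
    fix a assume a: "a \<in> A"
    have "isCont (\<lambda>x. \<bar>Im (L a x) - Im (M (\<pi> a) x + \<delta> a)\<bar>) p"
      using cont a \<pi>B by (intro continuous_intros) auto
    then have "\<forall>\<^sub>F x in at p. \<bar>Im (L a x) - Im (M (\<pi> a) x + \<delta> a)\<bar> < 2 * pi"
      unfolding isCont_def by (rule order_tendstoD) (simp add: \<delta>_def)
    then show "\<forall>\<^sub>F x in nhds p. \<bar>Im (L a x) - Im (M (\<pi> a) x + \<delta> a)\<bar> < 2 * pi"
      by (simp add: eventually_nhds_conv_at \<delta>_def)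
  qed
  have "\<forall>\<^sub>F x in nhds p. (\<Sum>a\<in>A. (c a + kap * L a x) * y a x) = (\<Sum>b\<in>B. (c' b + kap * M b x) * Y b x)"
    using e1 e2 e3
  proof eventually_elim
    case (elim x)
    have yY: "y a x = Y (\<pi> a) x" if a: "a \<in> A" for a
    proof -
      have "y a x \<in> (\<lambda>b. Y b x) ` B" using rt elim(1) a by blast
      then show ?thesis using elim(2) a by auto
    qed
    have LM: "L a x = M (\<pi> a) x + \<delta> a" if a: "a \<in> A" for a
    proof (rule exp_complex_eqI)
      show "exp (L a x) = exp (M (\<pi> a) x + \<delta> a)"
        using ex elim(1) a \<pi>B yY exp\<delta> by (simp add: exp_add)
    qed (use elim(3) a in simp)
    have "(\<Sum>a\<in>A. (c a + kap * L a x) * y a x) = (\<Sum>a\<in>A. (c' (\<pi> a) + kap * M (\<pi> a) x) * Y (\<pi> a) x)"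
      by (intro sum.cong refl) (simp add: yY LM c' algebra_simps)
    also have "\<dots> = (\<Sum>b\<in>B. (c' b + kap * M b x) * Y b x)"
      by (rule sum.reindex_bij_betw[OF bij])
    finally show ?case .
  qed
  then show ?thesis unfolding germ_eq_iff by blast
qed

end

context separated_roots
begin

text \<open>This exhibits a single root as an integral and thereby supplies its continuity.\<close>

lemma comb_indicator: "a \<in> A \<Longrightarrow> comb (\<lambda>b. if b = a then 1 else 0) 0 = y a"
proof
  fix x assume a: "a \<in> A"
  have "comb (\<lambda>b. if b = a then 1 else 0) 0 x = (\<Sum>b\<in>A. if b = a then y b x else 0)"
    unfolding comb_def by (intro sum.cong) auto
  then show "comb (\<lambda>b. if b = a then 1 else 0) 0 x = y a x" using a finite_roots by simp
qed

lemma root_frame: "root_frame A (ball q e) y (\<lambda>a x. lg a (y a x))"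
  unfolding root_frame_def
proof (intro conjI ballI)
  fix a assume a: "a \<in> A"
  show c: "continuous_on (ball q e) (y a)"
    using holo_on_continuous[OF holo_comb, of "\<lambda>b. if b = a then 1 else 0" 0] comb_indicator[OF a] by simp
  have sub: "y a x \<in> ball a (2 * r)" if "x \<in> ball q e" for x using y_ball[OF a that] r by simp
  have "continuous_on (ball a (2 * r)) (lg a)"
    using lg_deriv[OF a] by (meson DERIV_isCont continuous_at_imp_continuous_on)
  from continuous_on_compose2[OF this c] sub show "continuous_on (ball q e) (\<lambda>x. lg a (y a x))" by blast
  show "exp (lg a (y a x)) = y a x" if "x \<in> ball q e" for x using exp_lg[OF a sub[OF that]] .
qed (use finite_roots y_inj roots_eq in auto)

lemma root_germs_eq:
  assumes "q' \<in> ball q e" shows "root_germs kap q' = germ q' ` range (\<lambda>c. comb c kap)"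
proof (intro equalityI subsetI)
  fix \<phi> assume "\<phi> \<in> root_germs kap q'"
  then obtain A' S y' L c where *: "\<phi> = germ q' (\<lambda>x. \<Sum>a\<in>A'. (c a + kap * L a x) * y' a x)" "root_frame A' S y' L" "q' \<in> S"
    unfolding root_germs_def by blast
  from root_frame_match[OF *(2) root_frame *(3) assms] obtain c' where
    "\<phi> = germ q' (\<lambda>x. \<Sum>b\<in>A. (c' b + kap * lg b (y b x)) * y b x)" using *(1) by blast
  then have "\<phi> = germ q' (comb c' kap)" by (simp add: comb_def[abs_def])
  then show "\<phi> \<in> germ q' ` range (\<lambda>c. comb c kap)" by blast
next
  fix \<phi> assume "\<phi> \<in> germ q' ` range (\<lambda>c. comb c kap)"
  then obtain c where "\<phi> = germ q' (comb c kap)" by blast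
  then have "\<phi> = germ q' (\<lambda>x. \<Sum>a\<in>A. (c a + kap * lg a (y a x)) * y a x)" by (simp add: comb_def[abs_def])
  then show "\<phi> \<in> root_germs kap q'" unfolding root_germs_def mem_Collect_eq
    by (intro exI[of _ A] exI[of _ "ball q e"] exI[of _ y] exI[of _ "\<lambda>a x. lg a (y a x)"] exI[of _ c]
          conjI root_frame assms)
qed

lemma q_in_ball: "q \<in> ball q e" using e by simp

end

context mellin_equation
begin

lemma local_system_root_germs: "local_system (- discriminant_locus) (root_germs kap)"
  unfolding local_system_def
proof
  fix q assume "q \<in> - discriminant_locus"
  then obtain r e y where "separated_roots m ms eps q r e y" using separated_roots_exist by blast
  then interpret separated_roots m ms eps q r e y .
  show "\<exists>e>0. \<exists>\<F>. (\<forall>f\<in>\<F>. holo_on f (ball q e)) \<and> (\<forall>q'\<in>ball q e. root_germs kap q' = germ q' ` \<F>)"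
    by (rule exI[of _ e], rule conjI[OF e], rule exI[of _ "range (\<lambda>c. comb c kap)"])
       (use holo_comb root_germs_eq in blast)
qed

lemma root_germs_solutions:
  assumes "p \<notin> discriminant_locus" "kap = 0 \<or> (\<forall>j. ms j < m - 1)"
  shows "root_germs kap p \<subseteq> solution_germs (mellin_op m ms) p"
proof -
  obtain r e y where "separated_roots m ms eps p r e y" using separated_roots_exist[OF assms(1)] by blast
  then interpret separated_roots m ms eps p r e y .
  show ?thesis
  proof
    fix \<phi> assume "\<phi> \<in> root_germs kap p"
    then obtain c where "\<phi> = germ p (comb c kap)" using root_germs_eq[OF q_in_ball] by blast
    then show "\<phi> \<in> solution_germs (mellin_op m ms) p"
      unfolding solution_germs_def using holo_comb mellin_op_comb[OF assms(2)] q_in_ball by blast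
  qed
qed

lemma root_germs_subspace:
  assumes "p \<notin> discriminant_locus"
  shows "germ_subspace p (root_germs 0 p)"
proof -
  obtain r e y where "separated_roots m ms eps p r e y" using separated_roots_exist[OF assms(1)] by blast
  then interpret separated_roots m ms eps p r e y .
  note eq = root_germs_eq[OF q_in_ball, of 0]
  show ?thesis unfolding germ_subspace_def
  proof (intro conjI allI impI)
    have "comb (\<lambda>_. 0) 0 = (\<lambda>_. 0)" by (auto simp: comb_def)
    then show "germ p (\<lambda>_. 0) \<in> root_germs 0 p" unfolding eq by (metis image_eqI rangeI)
    fix f g a b assume "germ p f \<in> root_germs 0 p" "germ p g \<in> root_germs 0 p"
    then obtain c d where cd: "germ p f = germ p (comb c 0)" "germ p g = germ p (comb d 0)" unfolding eq by blast
    have "\<forall>\<^sub>F x in nhds p. a * f x + b * g x = comb (\<lambda>i. a * c i + b * d i) 0 x"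
      using cd unfolding germ_eq_iff
    proof eventually_elim
      case (elim x)
      then show ?case by (simp add: comb_def sum_distrib_left sum.distrib[symmetric] algebra_simps)
    qed
    then have "germ p (\<lambda>x. a * f x + b * g x) = germ p (comb (\<lambda>i. a * c i + b * d i) 0)"
      by (simp add: germ_eq_iff)
    then show "germ p (\<lambda>x. a * f x + b * g x) \<in> root_germs 0 p" unfolding eq by blast
  qed
qed

lemma root_germ_exists:
  assumes "p \<notin> discriminant_locus"
  obtains f e where "germ p f \<in> root_germs 0 p" "e > 0" "\<And>x. x \<in> ball p e \<Longrightarrow> cp x (f x) = 0"
proof -
  obtain r e y where "separated_roots m ms eps p r e y" using separated_roots_exist[OF assms(1)] by blast
  then interpret separated_roots m ms eps p r e y .
  have "A \<noteq> {}" using card m_pos by auto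
  then obtain a where a: "a \<in> A" by blast
  have "germ p (y a) \<in> root_germs 0 p"
    unfolding root_germs_eq[OF q_in_ball] comb_indicator[OF a, symmetric] by blast
  then show ?thesis using that e y_root[OF a] by blast
qed

lemma root_germs_nontrivial:
  assumes "p \<notin> discriminant_locus"
  shows "root_germs 0 p \<noteq> {germ p (\<lambda>_. 0)}"
proof
  assume *: "root_germs 0 p = {germ p (\<lambda>_. 0)}"
  obtain f e where f: "germ p f \<in> root_germs 0 p" "e > 0" "\<And>x. x \<in> ball p e \<Longrightarrow> cp x (f x) = 0"
    using root_germ_exists[OF assms] by blast
  then have "\<forall>\<^sub>F x in nhds p. f x = 0" using * by (auto simp: germ_eq_iff)
  then have "f p = 0" by (rule eventually_nhds_x_imp_x)
  then show False using f(2) f(3)[of p] root_nonzero by force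
qed

end

subsection \<open>Values at the origin\<close>

context mellin_functional
begin

lemma T_by_parts_0:
  assumes "0 \<in> cdom"
  shows "of_nat (Suc s) * T s k 0 + kap * U s k 0 = of_nat k * (of_nat m * T (s + m) (Suc k) 0)"
  using T_by_parts[OF assms, of s k] by simp

lemma T_expand_0:
  assumes "0 \<in> cdom"
  shows "T s k 0 = T (s + m) (Suc k) 0 - T s (Suc k) 0"
  using T_expand[OF assms, of s k] by simp

text \<open>At order 1, the vanishing of \<open>T s 0\<close> makes the expansion read
  \<open>T (s + m) 1 0 = T s 1 0\<close>, so all positive multiples of m give the same value.
  Expansion and integration by parts together then raise the order at fixed exponent, one factor at
  a time.\<close>

lemma T_multiple_0:
  assumes "0 \<in> cdom" "kap = 0"
  shows "T (m * Suc n) (Suc k) 0 = (\<Prod>i\<in>{1..k}. of_nat (m * Suc n + 1) / of_nat (m * i) - 1) * T m 1 0"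
proof (induction k)
  case 0
  show ?case
  proof (induction n)
    case (Suc n)
    have "T (m * Suc n + m) (Suc 0) 0 = T (m * Suc n) (Suc 0) 0"
      using T_expand_0[OF assms(1), of "m * Suc n" 0] by (simp add: T_0)
    then show ?case using Suc by (simp add: add.commute)
  qed simp
next
  case (Suc k)
  define s where "s = m * Suc n"
  have "T (s + m) (Suc (Suc k)) 0 = of_nat (s + 1) / of_nat (m * Suc k) * T s (Suc k) 0"
  proof -
    have nz: "of_nat (m * Suc k) \<noteq> (0 :: complex)"
      using m_pos by (simp only: of_nat_eq_0_iff) simp
    have "T (s + m) (Suc (Suc k)) 0 * of_nat (m * Suc k) = of_nat (s + 1) * T s (Suc k) 0"
      using T_by_parts_0[OF assms(1), of s "Suc k"] assms(2) by (simp add: mult_ac del: of_nat_Suc mult_Suc_right)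
    then show ?thesis by (simp only: times_divide_eq_left nonzero_eq_divide_eq[OF nz])
  qed
  note e1 = this
  have e2: "T s (Suc (Suc k)) 0 = T (s + m) (Suc (Suc k)) 0 - T s (Suc k) 0"
    using T_expand_0[OF assms(1), of s "Suc k"] by simp
  have "T s (Suc (Suc k)) 0 = (of_nat (s + 1) / of_nat (m * Suc k) - 1) * T s (Suc k) 0"
    by (simp only: e1 e2 left_diff_distrib mult_1)
  moreover define f :: "nat \<Rightarrow> complex" where "f i = of_nat (m * Suc n + 1) / of_nat (m * i) - 1" for i
  ultimately have "T (m * Suc n) (Suc (Suc k)) 0 = f (Suc k) * T (m * Suc n) (Suc k) 0"
    by (simp only: s_def)
  moreover have "(\<Prod>i\<in>{1..Suc k}. f i) = (\<Prod>i\<in>{1..k}. f i) * f (Suc k)"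
    by (simp add: prod.cl_ivl_Suc)
  ultimately show ?case unfolding f_def[symmetric] using Suc[folded f_def]
    by (simp only: mult_ac)
qed

end

text \<open>A zero factor would make m divide 1.\<close>

lemma (in mellin_equation) multiple_factor_nonzero:
  "(\<Prod>i\<in>{1..k}. of_nat (m * Suc n + 1) / of_nat (m * i) - 1) \<noteq> (0 :: complex)"
proof -
  have "of_nat (m * Suc n + 1) / of_nat (m * i) \<noteq> (1 :: complex)" if "i \<in> {1..k}" for i
  proof
    assume "of_nat (m * Suc n + 1) / of_nat (m * i) = (1 :: complex)"
    moreover have "of_nat (m * i) \<noteq> (0 :: complex)" using m_pos that by (simp del: of_nat_mult)
    ultimately have "m * Suc n + 1 = m * i"
      by (simp only: divide_eq_1_iff of_nat_eq_iff)
    then have "m dvd 1" by (metis dvd_add_right_iff dvd_triv_left)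
    then show False using m_ge2 by simp
  qed
  then show ?thesis
    by (simp only: prod_zero_iff[OF finite_atLeastAtMost] right_minus_eq) blast
qed

context separated_roots
begin

text \<open>The roots at the origin are m-th roots of unity, and an exponent divisible by m does not
  see which of them is taken. So the derivative is the same multiple of the value for all of them,
  and the twist shows only in the product of the \<open>eps j ^ \<beta> j\<close>.\<close>

lemma value_derivative_ratio_0:
  assumes q: "q = 0" and \<beta>: "(\<Sum>j\<in>UNIV. \<beta> j * ms j) = m * Suc n" "(\<Sum>j\<in>UNIV. \<beta> j) = Suc k"
  shows "mpd \<beta> (comb c 0) 0 = (\<Prod>j\<in>UNIV. eps j ^ \<beta> j) * ((-1) ^ Suc k * fact k *
     ((\<Prod>i\<in>{1..k}. of_nat (m * Suc n + 1) / of_nat (m * i) - 1) / of_nat m)) * comb c 0 0"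
proof -
  interpret F: mellin_functional m ms eps A r "2 * r" "\<lambda>a w. c a + 0 + 0 * lg a w" "\<lambda>a w. 0 / w" 0
    by (rule functional)
  have d: "0 \<in> cdom" using ball_subset_circ_dom q_in_ball q by blast
  have "of_nat m * F.T m 1 0 = comb c 0 0"
    using comb_eq_Y(1)[of 0 c 0] q_in_ball q unfolding F.Y_def by simp
  then have T1: "F.T m 1 0 = comb c 0 0 / of_nat m" using m_pos by (simp add: field_simps)
  have "mpd \<beta> (comb c 0) 0 = (\<Prod>j\<in>UNIV. eps j ^ \<beta> j) * ((-1) ^ Suc k * fact k * F.T (m * Suc n) (Suc k) 0)"
    using mpd_comb[of \<beta> c 0] \<beta> unfolding q by simp
  then show ?thesis unfolding F.T_multiple_0[OF d refl] T1 by simp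
qed

text \<open>The exponent is -1 modulo m. At order 2 integration by parts meets only the derivative
  kap / w of h, so the constants c drop out, and the recursions preserve this. One
  \<open>\<rho>\<close> for all c and kap is demanded because the instance kap = 0 removes the
  \<open>U\<close>-terms in the induction step.\<close>

lemma T_coprime_0:
  assumes q: "q = 0" and L: "1 \<le> L" "L < k"
  shows "\<exists>\<rho>\<noteq>0. \<forall>c kap. mellin_functional.T m ms eps A r (\<lambda>a w. c a + kap + kap * lg a w) (m * L - 1) k 0 = kap * \<rho>"
  using L
proof (induction k arbitrary: L)
  case 0
  then show ?case by simp
next
  case (Suc k)
  have d: "0 \<in> cdom" using ball_subset_circ_dom q_in_ball q by blast
  define TT where "TT c kap = mellin_functional.T m ms eps A r (\<lambda>a w. c a + kap + kap * lg a w)" for c and kap :: complex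
  have U_TT: "mellin_functional.U m ms eps A r = TT (\<lambda>_. 1) 0"
  proof -
    interpret F: mellin_functional m ms eps A r "2 * r" "\<lambda>a w. 1 + 0 + 0 * lg a w" "\<lambda>a w. 0 / w" 0
      by (rule functional)
    show ?thesis unfolding TT_def by (intro ext, unfold F.U_def F.T_def) simp
  qed
  have mL: "Suc (m * L - 1) = m * L" if "1 \<le> L" for L using that m_pos by simp
  have step: "of_nat (m * L) * TT c kap (m * L - 1) k 0 = of_nat (k * m) * TT c kap (m * Suc L - 1) (Suc k) 0"
      "TT c kap (m * L - 1) (Suc k) 0 = TT c kap (m * Suc L - 1) (Suc k) 0 - TT c kap (m * L - 1) k 0"
    if L: "1 \<le> L" and IH: "\<exists>\<rho>\<noteq>0. \<forall>c kap. TT c kap (m * L - 1) k 0 = kap * \<rho>" for c kap L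
  proof -
    interpret F: mellin_functional m ms eps A r "2 * r" "\<lambda>a w. c a + kap + kap * lg a w" "\<lambda>a w. kap / w" kap
      by (rule functional)
    \<comment> \<open>\<open>U\<close> is the instance c = 1, kap = 0 of the induction
      hypothesis.\<close>
    have U: "F.U (m * L - 1) k 0 = 0" unfolding U_TT using IH by auto
    have e: "m * L - 1 + m = m * Suc L - 1" using mL[OF L] by simp
    show "of_nat (m * L) * TT c kap (m * L - 1) k 0 = of_nat (k * m) * TT c kap (m * Suc L - 1) (Suc k) 0"
      using F.T_by_parts_0[OF d, of "m * L - 1" k] unfolding mL[OF L] U e TT_def by simp
    show "TT c kap (m * L - 1) (Suc k) 0 = TT c kap (m * Suc L - 1) (Suc k) 0 - TT c kap (m * L - 1) k 0"
      using F.T_expand_0[OF d, of "m * L - 1" k] unfolding e TT_def by simp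
  qed
  consider "k = 1" | "k \<ge> 2" "L \<ge> 2" | "k \<ge> 2" "L = 1" using Suc.prems by linarith
  then have "\<exists>\<rho>\<noteq>0. \<forall>c kap. TT c kap (m * L - 1) (Suc k) 0 = kap * \<rho>"
  proof cases
    case 1
    then have L1: "L = 1" using Suc.prems by simp
    have hinv: "hol_family (\<lambda>a w. 1 / w)"
      unfolding hol_family_def
      by (intro ballI holomorphic_intros) (use in_ball_nonpos(2) in blast)
    \<comment> \<open>At the origin P = w^m - 1, so 1/w may be exchanged for w^(m-1) up to a
      holomorphic term; m times the result is the integral of P'/P and counts the m roots.\<close>
    have "K A r (\<lambda>a w. 1 / w) 1 0 = K A r (\<lambda>a w. w ^ m * (1 / w)) 1 0"
      using K_expand[OF hinv d, of 0] K_0[OF hinv] by simp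
    also have "\<dots> = K A r (\<lambda>a w. w ^ (m - 1) * 1) 1 0"
    proof (rule K_cong)
      fix a w assume *: "a \<in> A" "w \<in> sphere a r"
      then have "w \<noteq> 0" using in_ball_nonpos[of a w] r by auto
      then show "w ^ m * (1 / w) / cp 0 w ^ 1 = w ^ (m - 1) * 1 / cp 0 w ^ 1"
        using m_pos by (cases m) auto
    qed
    also have "of_nat m * \<dots> = of_nat m"
      using K_log_derivative[of "\<lambda>_ _. 1" 0] hol_family_const[of "\<lambda>_. 1"] q_in_ball q card by simp
    finally have K1: "K A r (\<lambda>a w. 1 / w) 1 0 = 1" using m_pos by simp
    show ?thesis
    proof (intro exI[of _ "1 / of_nat m"] conjI allI)
      fix c kap
      interpret F: mellin_functional m ms eps A r "2 * r" "\<lambda>a w. c a + kap + kap * lg a w" "\<lambda>a w. kap / w" kap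
        by (rule functional)
      have "hol_family (\<lambda>a w. kap / w)"
        unfolding hol_family_def
        by (intro ballI holomorphic_intros) (use in_ball_nonpos(2) in blast)
      from K_by_parts[OF F.h_deriv this d, where k=1]
      have "K A r (\<lambda>a w. kap / w) 1 0 = of_nat m * F.T (m - 1) 2 0" by (simp add: F.T_def numeral_2_eq_2)
      moreover have "K A r (\<lambda>a w. kap / w) 1 0 = kap * K A r (\<lambda>a w. 1 / w) 1 0"
        by (simp add: K_cmult[symmetric])
      ultimately show "TT c kap (m * L - 1) (Suc k) 0 = kap * (1 / of_nat m)"
        unfolding TT_def using m_pos K1 L1 1 by (simp add: field_simps numeral_2_eq_2)
    qed (use m_pos in simp)
  next
    case 2
    obtain L' where L': "L = Suc L'" "1 \<le> L'" "L' < k" using 2 Suc.prems by (cases L) auto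
    obtain \<rho> where \<rho>: "\<rho> \<noteq> 0" "\<forall>c kap. TT c kap (m * L' - 1) k 0 = kap * \<rho>"
      using Suc.IH[OF L'(2,3)] unfolding TT_def by blast
    have "TT c kap (m * L - 1) (Suc k) 0 = kap * (of_nat (m * L') / of_nat (k * m) * \<rho>)" for c kap
    proof -
      have ex: "\<exists>\<rho>\<noteq>0. \<forall>c kap. TT c kap (m * L' - 1) k 0 = kap * \<rho>" using \<rho> by blast
      have nz: "of_nat (k * m) \<noteq> (0 :: complex)" using 2 m_pos by simp
      have "of_nat (m * L') * (kap * \<rho>) = of_nat (k * m) * TT c kap (m * L - 1) (Suc k) 0"
        using step(1)[OF L'(2) ex, of c kap] \<rho>(2) L'(1) by simp
      then have "TT c kap (m * L - 1) (Suc k) 0 = of_nat (m * L') * (kap * \<rho>) / of_nat (k * m)"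
        unfolding nonzero_eq_divide_eq[OF nz] by (simp only: mult.commute)
      then show ?thesis by simp
    qed
    then show ?thesis using \<rho>(1) m_pos L' 2 by (intro exI[of _ "of_nat (m * L') / of_nat (k * m) * \<rho>"]) auto
  next
    case 3
    obtain \<rho> where \<rho>: "\<rho> \<noteq> 0" "\<forall>c kap. TT c kap (m * 1 - 1) k 0 = kap * \<rho>"
      using Suc.IH[of 1] 3 unfolding TT_def by auto
    have "TT c kap (m * L - 1) (Suc k) 0 = kap * ((1 / of_nat k - 1) * \<rho>)" for c kap
    proof -
      have ex: "\<exists>\<rho>\<noteq>0. \<forall>c kap. TT c kap (m * 1 - 1) k 0 = kap * \<rho>" using \<rho> by blast
      have "TT c kap (m * Suc 1 - 1) (Suc k) 0 = 1 / of_nat k * (kap * \<rho>)"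
        using step(1)[OF order_refl ex, of c kap] \<rho>(2) 3 m_pos by (auto simp: field_simps)
      then show ?thesis using step(2)[OF order_refl ex, of c kap] \<rho>(2) 3 by (simp add: algebra_simps)
    qed
    \<comment> \<open>The order k = 1, where this factor would vanish, was treated as the base
      case.\<close>
    moreover have "1 / of_nat k - 1 \<noteq> (0 :: complex)" using 3 by (simp add: divide_eq_1_iff)
    ultimately show ?thesis using \<rho>(1) by (intro exI[of _ "(1 / of_nat k - 1) * \<rho>"]) auto
  qed
  then show ?case by (simp only: TT_def)
qed

end

subsection \<open>Reducibility\<close>

context mellin_equation
begin

lemma zero_not_discriminant: "0 \<notin> discriminant_locus"
  using m_pos by (auto simp: discriminant_locus_def cp_def cp'_def power_0_left)

text \<open>Elimination of z: on the line the equation and its w-derivative are linear in z, and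
  together they give a polynomial Q in the multiple root w. Each of the finitely many zeros of Q
  determines z through one of the two equations.\<close>

lemma finite_discriminant_line:
  assumes inj: "inj ms"
  shows "finite {z. z *s p \<in> discriminant_locus}"
proof (cases "p = 0")
  case True
  then show ?thesis using zero_not_discriminant by simp
next
  case False
  then obtain j where j: "p $ j \<noteq> 0" by (auto simp: vec_eq_iff)
  define g g' where "g w = (\<Sum>j\<in>UNIV. eps j * p $ j * w ^ ms j)"
    and "g' w = (\<Sum>j\<in>UNIV. eps j * p $ j * (of_nat (ms j) * w ^ (ms j - 1)))" for w
  have cpz: "cp (z *s p) w = w ^ m + z * g w - 1" for z w
    by (simp add: cp_def g_def sum_distrib_left mult_ac)
  have cpz': "cp' (z *s p) w = of_nat m * w ^ (m - 1) + z * g' w" for z w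
    by (simp add: cp'_def g'_def sum_distrib_left mult_ac)
  define Q where "Q = (\<Sum>j\<in>UNIV. monom (eps j * p $ j * of_nat (m - ms j)) (m + ms j - 1)
      + monom (eps j * p $ j * of_nat (ms j)) (ms j - 1))"
  have Q: "poly Q w = of_nat m * w ^ (m - 1) * g w + (1 - w ^ m) * g' w" for w
  proof -
    have "poly Q w = (\<Sum>j\<in>UNIV. of_nat m * w ^ (m - 1) * (eps j * p $ j * w ^ ms j)
        + (1 - w ^ m) * (eps j * p $ j * (of_nat (ms j) * w ^ (ms j - 1))))"
      unfolding Q_def poly_sum
    proof (intro sum.cong refl)
      fix j
      have "m + ms j - 1 = (m - 1) + ms j" "m + ms j - 1 = m + (ms j - 1)" using m_pos ms_pos[of j] by auto
      then have "w ^ (m + ms j - 1) = w ^ (m - 1) * w ^ ms j" "w ^ (m + ms j - 1) = w ^ m * w ^ (ms j - 1)"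
        by (metis power_add)+
      then show "poly (monom (eps j * p $ j * of_nat (m - ms j)) (m + ms j - 1)
          + monom (eps j * p $ j * of_nat (ms j)) (ms j - 1)) w
        = of_nat m * w ^ (m - 1) * (eps j * p $ j * w ^ ms j)
        + (1 - w ^ m) * (eps j * p $ j * (of_nat (ms j) * w ^ (ms j - 1)))"
        using ms_less[of j] by (simp add: poly_monom of_nat_diff algebra_simps)
    qed
    then show ?thesis by (simp add: g_def g'_def sum.distrib sum_distrib_left)
  qed
  \<comment> \<open>Q is nonzero: distinct exponents keep this coefficient from mixing with others,
    and the second kind of monomial has degree at least m.\<close>
  have "coeff Q (ms j - 1) = (\<Sum>i\<in>UNIV. if i = j then eps j * p $ j * of_nat (ms j) else 0)"
    unfolding Q_def coeff_sum
  proof (intro sum.cong refl)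
    fix i
    have "m + ms i - 1 \<noteq> ms j - 1" using ms_less[of j] ms_pos[of i] by linarith
    moreover have "ms i - 1 = ms j - 1 \<longleftrightarrow> i = j"
      using ms_pos[of i] ms_pos[of j] inj by (auto simp: inj_def)
    ultimately show "coeff (monom (eps i * p $ i * of_nat (m - ms i)) (m + ms i - 1)
      + monom (eps i * p $ i * of_nat (ms i)) (ms i - 1)) (ms j - 1)
      = (if i = j then eps j * p $ j * of_nat (ms j) else 0)" by auto
  qed
  then have "coeff Q (ms j - 1) \<noteq> 0" using j eps_nonzero ms_pos[of j] by simp
  then have "Q \<noteq> 0" by auto
  then have W: "finite {w. poly Q w = 0}" by (rule poly_roots_finite)
  have "{z. z *s p \<in> discriminant_locus} \<subseteq>
     (\<lambda>w. (1 - w ^ m) / g w) ` {w. poly Q w = 0} \<union> (\<lambda>w. - (of_nat m * w ^ (m - 1)) / g' w) ` {w. poly Q w = 0}"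
  proof
    fix z assume "z \<in> {z. z *s p \<in> discriminant_locus}"
    then obtain w where w: "cp (z *s p) w = 0" "cp' (z *s p) w = 0" by (auto simp: discriminant_locus_def)
    have 1: "z * g w = 1 - w ^ m" using w(1) unfolding cpz by (simp add: algebra_simps)
    have 2: "z * g' w = - (of_nat m * w ^ (m - 1))" using w(2) unfolding cpz' by (simp add: eq_neg_iff_add_eq_0 add.commute)
    have "poly Q w = of_nat m * w ^ (m - 1) * g w + (z * g w) * g' w" unfolding Q 1 ..
    also have "\<dots> = (of_nat m * w ^ (m - 1) + z * g' w) * g w" by (simp add: algebra_simps)
    also have "\<dots> = 0" by (simp add: 2)
    finally have wQ: "poly Q w = 0" .
    show "z \<in> (\<lambda>w. (1 - w ^ m) / g w) ` {w. poly Q w = 0} \<union> (\<lambda>w. - (of_nat m * w ^ (m - 1)) / g' w) ` {w. poly Q w = 0}"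
    proof (cases "g w = 0")
      case False
      then have "z = (1 - w ^ m) / g w" using 1 by (simp add: field_simps)
      then show ?thesis using wQ by blast
    next
      case True
      have "w \<noteq> 0" using root_nonzero[OF w(1)] .
      then have "g' w \<noteq> 0" using 2 m_pos by auto
      then have "z = - (of_nat m * w ^ (m - 1)) / g' w" using 2 by (simp add: field_simps)
      then show ?thesis using wQ by blast
    qed
  qed
  then show ?thesis using W by (meson finite_UnI finite_imageI finite_subset)
qed

end

text \<open>A complex line minus finitely many points is connected; it joins p to the origin off
  both discriminants.\<close>

lemma line_subset_transfer:
  fixes E V :: "'n::finite point \<Rightarrow> 'n cfun set set"
  assumes E: "local_system (- D) E" and V: "local_system (- D') V"
    and fin: "finite {z. z *s p \<in> D}" "finite {z. z *s p \<in> D'}"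
    and p: "p \<notin> D" "p \<notin> D'" "0 \<notin> D" "0 \<notin> D'" and sub: "E p \<subseteq> V p"
  shows "E 0 \<subseteq> V 0"
proof -
  define S where "S = (\<lambda>z. z *s p) ` (- ({z. z *s p \<in> D} \<union> {z. z *s p \<in> D'}))"
  have "continuous_on UNIV (\<lambda>z. 0 + z *s p)"
    unfolding continuous_on_eq_continuous_at[OF open_UNIV] using isCont_line by blast
  then have c: "continuous_on UNIV (\<lambda>z. z *s p)" by simp
  have "connected (- ({z. z *s p \<in> D} \<union> {z. z *s p \<in> D'}))"
    using fin by (intro path_connected_imp_connected path_connected_complement_countable) (auto intro: countable_finite)
  then have "connected S" unfolding S_def by (intro connected_continuous_image continuous_on_subset[OF c]) auto
  moreover have "p \<in> S" unfolding S_def by (rule image_eqI[of _ _ 1]) (use p in auto)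
  moreover have "0 \<in> S" unfolding S_def by (rule image_eqI[of _ _ 0]) (use p in auto)
  ultimately show ?thesis using local_system_subset_transfer[OF E V _ _ _ _ _ sub, of S 0] by (auto simp: S_def)
qed

lemma reducibleI:
  fixes E :: "'n::{finite,linorder} point \<Rightarrow> 'n cfun set set"
  assumes "local_system \<Omega> E" "- singular_locus G \<subseteq> \<Omega>" "E p \<subseteq> solution_germs G p"
    "germ_subspace p (E p)" "E p \<noteq> {germ p (\<lambda>_. 0)}" "E p \<noteq> solution_germs G p"
  shows "monodromy_reducible G p"
  unfolding monodromy_reducible_def using local_system_monodromy_invariant[OF assms(1,2)] assms(3-6) by blast

context mellin_equation
begin

text \<open>x_j is an eigenfunction of the Euler operator with weights m - \<open>ms i\<close>, with
  eigenvalue m - \<open>ms j\<close> = 1. So the factor with k = 0, which acts first, kills it, and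
  the m-th derivatives vanish because m is at least 2.\<close>

lemma mellin_op_coordinate:
  assumes j: "Suc (ms j) = m"
  shows "mellin_op m ms i (\<lambda>x. c * x $ j) x = 0"
proof -
  define f where "f = (\<lambda>x::'n point. c * x $ j)"
  have grad: "has_gradient f (\<lambda>i. c * (if i = j then 1 else 0)) x" for x
    unfolding f_def by (intro has_gradient_cmult has_gradient_coord)
  have th: "theta_lin (\<lambda>i. m - ms i) (of_nat (m * 0) - 1) f = (\<lambda>_. 0)"
  proof
    fix x
    have "(\<Sum>i\<in>UNIV. of_nat (m - ms i) * (x $ i * (c * (if i = j then 1 else 0)))) = (\<Sum>i\<in>UNIV. if i = j then of_nat (m - ms i) * (x $ i * c) else 0)"
      by (intro sum.cong) auto
    moreover have "m - ms j = 1" using j by linarith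
    ultimately show "theta_lin (\<lambda>i. m - ms i) (of_nat (m * 0) - 1) f x = 0"
      unfolding theta_lin_has_gradient[OF grad] by (simp add: f_def)
  qed
  have z: "fold (\<lambda>k. theta_lin a (h k)) xs (\<lambda>_. 0) = (\<lambda>_. 0 :: complex)" for a :: "'n \<Rightarrow> nat" and h xs
    by (induction xs) (auto simp: theta_lin_zero)
  have "[0..<m - ms i] = 0 # [1..<m - ms i]" using ms_less[of i] by (simp add: upt_conv_Cons)
  then have 1: "fold (\<lambda>k. theta_lin ms (of_nat (m * k) + 1)) [0..<ms i]
       (fold (\<lambda>k. theta_lin (\<lambda>i. m - ms i) (of_nat (m * k) - 1)) [0..<m - ms i] f) = (\<lambda>_. 0)"
    by (simp only: fold_Cons o_def th z)
  have p1: "pd i f = (\<lambda>_. c * (if i = j then 1 else 0))" using pd_has_gradient[OF grad] by blast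
  have p2: "pd i (pd i f) = (\<lambda>_. 0)" unfolding p1 by (rule ext) (rule pd_has_gradient[OF has_gradient_const])
  have "(pd i ^^ (k + 2)) f = (\<lambda>_. 0)" for k
    by (induction k) (auto simp: p2 pd_zero)
  from this[of "m - 2"] have "(pd i ^^ m) f = (\<lambda>_. 0)" unfolding le_add_diff_inverse2[OF m_ge2] .
  then show ?thesis using 1 unfolding mellin_op_def f_def[symmetric] by simp
qed

text \<open>Along the j-th coordinate line the equation would become a polynomial identity in x_j,
  but the constant term of that polynomial is -1.\<close>

lemma no_linear_root:
  assumes f: "\<forall>\<^sub>F x in nhds p. cp x (f x) = 0" and g: "\<forall>\<^sub>F x in nhds p. f x = c * x $ j"
  shows False
proof -
  define R where "R = monom (c ^ m) m + (\<Sum>i\<in>UNIV. if i = j then monom (eps j * c ^ ms j) (Suc (ms j))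
     else monom (eps i * p $ i * c ^ ms i) (ms i)) - 1"
  have R0: "poly R 0 = -1"
  proof -
    have "poly (if i = j then monom (eps j * c ^ ms j) (Suc (ms j)) else monom (eps i * p $ i * c ^ ms i) (ms i)) 0 = 0" for i
      using ms_pos[of i] by (auto simp: poly_monom)
    then show ?thesis using m_pos by (simp add: R_def poly_sum poly_monom)
  qed
  have "\<forall>\<^sub>F x in nhds p. cp x (c * x $ j) = 0" using f g by eventually_elim simp
  then obtain S where S: "open S" "p \<in> S" "\<And>x. x \<in> S \<Longrightarrow> cp x (c * x $ j) = 0" unfolding eventually_nhds by blast
  define l where "l z = p + z *s axis j 1" for z :: complex
  have cl: "continuous_on UNIV l" unfolding l_def continuous_on_eq_continuous_at[OF open_UNIV] using isCont_line by blast
  have "open (l -` S)" using open_vimage[OF S(1) cl] .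
  moreover have "0 \<in> l -` S" using S(2) by (simp add: l_def)
  ultimately obtain e where e: "e > 0" "ball 0 e \<subseteq> l -` S" using open_contains_ball by blast
  have "poly R (p $ j + z) = 0" if "z \<in> ball 0 e" for z
  proof -
    have "cp (l z) (c * l z $ j) = 0" using S(3) e(2) that by blast
    moreover have "l z $ i = (if i = j then p $ j + z else p $ i)" for i by (auto simp: l_def axis_def)
    moreover have "eps i * (if i = j then p $ j + z else p $ i) * (c * (p $ j + z)) ^ ms i =
      poly (if i = j then monom (eps j * c ^ ms j) (Suc (ms j)) else monom (eps i * p $ i * c ^ ms i) (ms i)) (p $ j + z)" for i
      by (auto simp: poly_monom power_mult_distrib)
    ultimately show ?thesis by (simp add: R_def poly_sum poly_monom cp_def power_mult_distrib)
  qed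
  then have "(\<lambda>z. z - p $ j) -` ball 0 e \<subseteq> {z. poly R z = 0}" by force
  moreover have "ball (p $ j) e \<subseteq> (\<lambda>z. z - p $ j) -` ball 0 e" by (auto simp: dist_norm norm_minus_commute)
  ultimately have "ball (p $ j) e \<subseteq> {z. poly R z = 0}" by blast
  moreover have "R \<noteq> 0" using R0 by auto
  ultimately have "finite (ball (p $ j) e)" using poly_roots_finite finite_subset by blast
  then show False using uncountable_ball[OF e(1), of "p $ j"] countable_finite by blast
qed

text \<open>The multiples of x_j form a local system on the whole space, and the germ of a root is a
  solution that is none of them.\<close>

lemma reducible_linear:
  assumes j: "Suc (ms j) = m" and p: "p \<notin> discriminant_locus"
  shows "monodromy_reducible (mellin_op m ms) p"
proof -
  define \<F> :: "'n cfun set" where "\<F> = range (\<lambda>c x. c * x $ j)"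
  define E where "E q = germ q ` \<F>" for q
  have holo: "holo_on f S" if "f \<in> \<F>" "open S" for f S
    using that has_gradient_cmult[OF has_gradient_coord] unfolding \<F>_def holo_on_iff_has_gradient by blast
  have sol: "E p \<subseteq> solution_germs (mellin_op m ms) p"
  proof
    fix \<phi> assume "\<phi> \<in> E p"
    then obtain f where f: "f \<in> \<F>" "\<phi> = germ p f" by (auto simp: E_def)
    then have "\<forall>i. \<forall>x\<in>UNIV. mellin_op m ms i f x = 0" using mellin_op_coordinate[OF j] by (auto simp: \<F>_def)
    then show "\<phi> \<in> solution_germs (mellin_op m ms) p"
      unfolding solution_germs_def using f holo[OF f(1) open_UNIV] by blast
  qed
  obtain f e where f: "germ p f \<in> root_germs 0 p" "e > 0" "\<And>x. x \<in> ball p e \<Longrightarrow> cp x (f x) = 0"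
    using root_germ_exists[OF p] by blast
  have evf: "\<forall>\<^sub>F x in nhds p. cp x (f x) = 0"
    unfolding eventually_nhds_metric using f(2,3) by (metis dist_commute mem_ball)
  show ?thesis
  proof (rule reducibleI[of UNIV E])
    show "local_system UNIV E" unfolding local_system_def
      using holo by (auto simp: E_def intro!: exI[of _ 1] exI[of _ \<F>])
    show "germ_subspace p (E p)" unfolding germ_subspace_def
    proof (intro conjI allI impI)
      have "(\<lambda>_. 0) \<in> \<F>" unfolding \<F>_def by (rule range_eqI[of _ _ 0]) simp
      then show "germ p (\<lambda>_. 0) \<in> E p" by (simp add: E_def)
      fix f g a b assume "germ p f \<in> E p" "germ p g \<in> E p"
      then obtain c d where cd: "germ p f = germ p (\<lambda>x. c * x $ j)" "germ p g = germ p (\<lambda>x. d * x $ j)"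
        by (auto simp: E_def \<F>_def)
      have "\<forall>\<^sub>F x in nhds p. a * f x + b * g x = (a * c + b * d) * x $ j"
        using cd unfolding germ_eq_iff by eventually_elim (simp add: algebra_simps)
      then have "germ p (\<lambda>x. a * f x + b * g x) = germ p (\<lambda>x. (a * c + b * d) * x $ j)" by (simp add: germ_eq_iff)
      then show "germ p (\<lambda>x. a * f x + b * g x) \<in> E p" by (auto simp: E_def \<F>_def)
    qed
    show "E p \<noteq> {germ p (\<lambda>_. 0)}"
    proof
      assume *: "E p = {germ p (\<lambda>_. 0)}"
      have "germ p (\<lambda>x. 1 * x $ j) \<in> E p" unfolding E_def \<F>_def by blast
      then have "\<forall>\<^sub>F x in nhds p. 1 * x $ j = 0" using * by (simp add: germ_eq_iff)
      then obtain S where S: "open S" "p \<in> S" "\<And>x. x \<in> S \<Longrightarrow> 1 * x $ j = 0"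
        unfolding eventually_nhds by blast
      then have "agree_on S (pd j (\<lambda>x. 1 * x $ j)) (pd j (\<lambda>_. 0))" by (intro pd_cong) (auto simp: agree_on_def)
      then have "pd j (\<lambda>x. 1 * x $ j) p = 0" using S(2) by (simp add: agree_on_def pd_zero)
      then show False using pd_has_gradient[OF has_gradient_cmult[OF has_gradient_coord, of 1 j p], of j] by simp
    qed
    show "E p \<noteq> solution_germs (mellin_op m ms) p"
    proof
      assume "E p = solution_germs (mellin_op m ms) p"
      then have "germ p f \<in> E p" using root_germs_solutions[OF p, of 0] f(1) by blast
      then obtain c where "germ p f = germ p (\<lambda>x. c * x $ j)" by (auto simp: E_def \<F>_def)
      then show False using no_linear_root[OF evf] by (simp add: germ_eq_iff)
    qed
  qed (use sol in auto)
qed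

lemma reducible_root_germs:
  assumes p: "p \<notin> discriminant_locus" and ne: "root_germs 0 p \<noteq> solution_germs (mellin_op m ms) p"
  shows "monodromy_reducible (mellin_op m ms) p"
proof (rule reducibleI[OF local_system_root_germs])
  show "- singular_locus (mellin_op m ms) \<subseteq> - discriminant_locus"
    using discriminant_subset_singular by blast
  show "root_germs 0 p \<subseteq> solution_germs (mellin_op m ms) p" using root_germs_solutions[OF p] by blast
  show "root_germs 0 p \<noteq> {germ p (\<lambda>_. 0)}" using root_germs_nontrivial[OF p] .
qed (use root_germs_subspace[OF p] ne in auto)

lemma sum_single: "(\<Sum>i\<in>UNIV. (if i = j then b else 0) * f i) = b * f j" for b :: nat and f :: "'n \<Rightarrow> nat"
proof -
  have "(\<Sum>i\<in>UNIV. (if i = j then b else 0) * f i) = (\<Sum>i\<in>UNIV. if i = j then b * f i else 0)"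
    by (intro sum.cong) auto
  then show ?thesis by simp
qed

text \<open>The \<open>b\<close>-th derivative in \<open>x\<^sub>j\<close> at the origin with \<open>b ms j = -1\<close> modulo \<open>m\<close> kills every root,
  but not the logarithmic solution.\<close>

lemma reducible_coprime:
  assumes j: "coprime (ms j) m" and inj: "inj ms" and p: "p \<notin> discriminant_locus"
    and small: "\<forall>j. ms j < m - 1"
  shows "monodromy_reducible (mellin_op m ms) p"
proof (rule reducible_root_germs[OF p], rule)
  assume "root_germs 0 p = solution_germs (mellin_op m ms) p"
  then have "root_germs 1 p \<subseteq> root_germs 0 p" using root_germs_solutions[OF p] small by blast
  from line_subset_transfer[OF local_system_root_germs local_system_root_germs
      finite_discriminant_line[OF inj] finite_discriminant_line[OF inj] p p zero_not_discriminant zero_not_discriminant this]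
  have sub: "root_germs 1 0 \<subseteq> root_germs 0 0" .
  obtain r e y where "separated_roots m ms eps 0 r e y" using separated_roots_exist[OF zero_not_discriminant] by blast
  then interpret separated_roots m ms eps 0 r e y .
  obtain x v where xv: "ms j * x = m * v + 1"
    using bezout_nat[of "ms j" m] ms_pos[of j] j by auto
  \<comment> \<open>Multiplication of the Bezout relation by m - 1 turns the residue 1 modulo m into
    -1; L is the quotient (b \<open>ms j\<close> + 1) / m.\<close>
  define b L where "b = x * (m - 1)" and "L = v * (m - 1) + 1"
  have bL: "b * ms j + 1 = m * L"
  proof -
    have "b * ms j = (m * v + 1) * (m - 1)" unfolding b_def xv[symmetric] by (simp add: mult_ac)
    then show ?thesis using m_pos by (cases m) (simp_all add: L_def algebra_simps)
  qed
  have b: "0 < b"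
  proof (rule ccontr)
    assume "\<not> 0 < b"
    then have "m * L = 1" using bL by simp
    then show False using m_ge2 by simp
  qed
  \<comment> \<open>This is where \<open>ms j\<close> is at most m - 2: otherwise m b would be at
    most b (m - 2) + 1.\<close>
  have "L < b"
  proof (rule ccontr)
    assume "\<not> L < b"
    then have "m * b \<le> m * L" by simp
    then have "m * b \<le> b * ms j + 1" using bL by simp
    moreover have "ms j + 2 \<le> m" using small[rule_format, of j] by linarith
    then have "b * (ms j + 2) \<le> b * m" by (rule mult_le_mono2)
    ultimately show False using b by (simp add: algebra_simps)
  qed
  then obtain \<rho> where \<rho>: "\<rho> \<noteq> 0" "\<And>c kap. mellin_functional.T m ms eps A r (\<lambda>a w. c a + kap + kap * lg a w) (m * L - 1) b 0 = kap * \<rho>"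
    using T_coprime_0[OF refl, of L b] by (auto simp: L_def)
  define \<beta> where "\<beta> i = (if i = j then b else 0)" for i
  have \<beta>: "(\<Sum>i\<in>UNIV. \<beta> i) = b" "(\<Sum>i\<in>UNIV. \<beta> i * ms i) = m * L - 1"
    using bL sum_single[of j b "\<lambda>_. 1"] sum_single[of j b ms] by (simp_all add: \<beta>_def)
  have D: "mpd \<beta> (comb c kap) 0 = (\<Prod>j\<in>UNIV. eps j ^ \<beta> j) * ((-1) ^ b * fact (b - 1) * (kap * \<rho>))" for c kap
    using mpd_comb[of \<beta> c kap] b unfolding \<beta> \<rho>(2) by simp
  have "germ 0 (comb (\<lambda>_. 0) 1) \<in> germ 0 ` range (\<lambda>c. comb c 0)"
    using sub unfolding root_germs_eq[OF q_in_ball] by blast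
  then obtain c where "germ 0 (comb (\<lambda>_. 0) 1) = germ 0 (comb c 0)" by blast
  then obtain S where "open S" "0 \<in> S" "\<And>x. x \<in> S \<Longrightarrow> comb (\<lambda>_. 0) 1 x = comb c 0 x"
    unfolding germ_eq_iff eventually_nhds by blast
  then have "mpd \<beta> (comb (\<lambda>_. 0) 1) 0 = mpd \<beta> (comb c 0) 0"
    using mpd_cong[of S "comb (\<lambda>_. 0) 1" "comb c 0" \<beta>] by (simp add: agree_on_def)
  then show False unfolding D using \<rho>(1) eps_nonzero by simp
qed

end

text \<open>Rescaling the variables by \<open>m\<close>-th roots of unity preserves the Mellin system. If \<open>ms j\<close> is not
  prime to \<open>m\<close>, the roots of the rescaled equation are not in the span of those of the original one:
  at the origin, a suitable derivative is a fixed multiple of the value on either span, with distinct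
  multiples.\<close>

lemma reducible_not_coprime:
  fixes m :: nat and ms :: "'n::{finite,linorder} \<Rightarrow> nat" and p :: "'n point"
  assumes M1: "mellin_equation m ms (\<lambda>_. 1)" and j: "\<not> coprime (ms j) m" and inj: "inj ms"
    and p: "p \<notin> singular_locus (mellin_op m ms)"
  shows "monodromy_reducible (mellin_op m ms) p"
proof -
  interpret M: mellin_equation m ms "\<lambda>_. 1" by (rule M1)
  define \<zeta> where "\<zeta> = exp (2 * of_real pi * \<i> / of_nat m)"
  have \<zeta>k: "\<zeta> ^ k = 1 \<longleftrightarrow> m dvd k" for k
  proof -
    have "\<zeta> ^ k = exp (2 * of_real pi * \<i> * of_nat k / of_nat m)"
      unfolding \<zeta>_def exp_of_nat_mult[symmetric] by (simp add: mult_ac)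
    then show ?thesis using M.m_pos complex_root_unity_eq_1[of m k] by simp
  qed
  interpret N: mellin_equation m ms "\<lambda>_. \<zeta>"
    by unfold_locales (use M.ms_less M.ms_pos \<zeta>k in auto)
  have pM: "p \<notin> M.discriminant_locus" using p M.discriminant_subset_singular by blast
  have pN: "p \<notin> N.discriminant_locus" using p N.discriminant_subset_singular by blast
  show ?thesis
  proof (rule M.reducible_root_germs[OF pM], rule)
    assume "M.root_germs 0 p = solution_germs (mellin_op m ms) p"
    then have "N.root_germs 0 p \<subseteq> M.root_germs 0 p" using N.root_germs_solutions[OF pN] by blast
    from line_subset_transfer[OF N.local_system_root_germs M.local_system_root_germs
        N.finite_discriminant_line[OF inj] M.finite_discriminant_line[OF inj] pN pM N.zero_not_discriminant M.zero_not_discriminant this]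
    have sub: "N.root_germs 0 0 \<subseteq> M.root_germs 0 0" .
    obtain r e y where "separated_roots m ms (\<lambda>_. 1) 0 r e y" using M.separated_roots_exist[OF M.zero_not_discriminant] by blast
    then interpret MS: separated_roots m ms "\<lambda>_. 1" 0 r e y .
    obtain r' e' y' where "separated_roots m ms (\<lambda>_. \<zeta>) 0 r' e' y'" using N.separated_roots_exist[OF N.zero_not_discriminant] by blast
    then interpret NS: separated_roots m ms "\<lambda>_. \<zeta>" 0 r' e' y' .
    define d where "d = gcd (ms j) m"
    have d: "d dvd ms j" "d dvd m" "d \<noteq> 1" using j by (auto simp: d_def coprime_iff_gcd_eq_1)
    \<comment> \<open>b = m / gcd (\<open>ms j\<close>, m) is the least positive order for which b
      \<open>ms j\<close> is a multiple of m. It is smaller than m, so zeta^b differs from 1 and the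
      two ratios of derivative to value are distinct.\<close>
    obtain b where b: "m = d * b" using d(2) by blast
    obtain n' where n': "ms j = d * n'" using d(1) by blast
    have "0 < b" "0 < n'" "0 < d" using M.m_pos M.ms_pos[of j] b n' by (auto intro: gr0I)
    then obtain k n where k: "b = Suc k" and n: "n' = Suc n" by (meson gr0_implies_Suc)
    have "b < m" using d(3) \<open>0 < d\<close> \<open>0 < b\<close> b by (cases d) auto
    then have "\<not> m dvd b" using \<open>0 < b\<close> by (meson dvd_imp_le leD)
    define \<beta> where "\<beta> i = (if i = j then b else 0)" for i
    have "b * ms j = m * n'" using b n' by simp
    then have \<beta>: "(\<Sum>i\<in>UNIV. \<beta> i) = Suc k" "(\<Sum>i\<in>UNIV. \<beta> i * ms i) = m * Suc n"
      unfolding \<beta>_def M.sum_single k[symmetric] n[symmetric] by simp_all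
    have prod: "(\<Prod>i\<in>UNIV. \<zeta> ^ \<beta> i) = \<zeta> ^ b" using \<beta>(1) k by (simp add: power_sum[symmetric])
    define C :: complex where "C = (-1) ^ Suc k * fact k * ((\<Prod>i\<in>{1..k}. of_nat (m * Suc n + 1) / of_nat (m * i) - 1) / of_nat m)"
    have C: "C \<noteq> 0" unfolding C_def using M.multiple_factor_nonzero[where k=k and n=n] M.m_pos by (simp del: of_nat_mult of_nat_Suc of_nat_add)
    have MD: "mpd \<beta> (MS.comb c 0) 0 = C * MS.comb c 0 0" for c
      using MS.value_derivative_ratio_0[OF refl \<beta>(2,1), of c] by (simp add: C_def)
    have ND: "mpd \<beta> (NS.comb c 0) 0 = \<zeta> ^ b * C * NS.comb c 0 0" for c
      using NS.value_derivative_ratio_0[OF refl \<beta>(2,1), of c] unfolding prod C_def .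
    obtain a where a: "a \<in> NS.A" using NS.card M.m_pos by (metis card.empty equals0I less_irrefl)
    define f where "f = NS.comb (\<lambda>b. if b = a then 1 else 0) 0"
    have f0: "f 0 \<noteq> 0" unfolding f_def NS.comb_indicator[OF a] NS.y_q[OF a]
      using a N.root_nonzero by (auto simp: N.roots_def)
    have "germ 0 f \<in> germ 0 ` range (\<lambda>c. MS.comb c 0)"
      using sub unfolding NS.root_germs_eq[OF NS.q_in_ball] MS.root_germs_eq[OF MS.q_in_ball] f_def by blast
    then obtain c where "germ 0 f = germ 0 (MS.comb c 0)" by blast
    then obtain S where S: "open S" "0 \<in> S" "\<And>x. x \<in> S \<Longrightarrow> f x = MS.comb c 0 x"
      unfolding germ_eq_iff eventually_nhds by blast
    then have "mpd \<beta> f 0 = mpd \<beta> (MS.comb c 0) 0"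
      using mpd_cong[of S f "MS.comb c 0" \<beta>] by (simp add: agree_on_def)
    then have "\<zeta> ^ b * C * f 0 = C * f 0"
      using ND MD S(2) S(3)[of 0] by (auto simp: f_def)
    then have "\<zeta> ^ b = 1" using C f0 by simp
    then show False using \<zeta>k \<open>\<not> m dvd b\<close> by blast
  qed
qed

theorem corollary4p5:
  fixes m :: nat and ms :: "'n::{finite,linorder} \<Rightarrow> nat" and p :: "'n point"
  assumes "\<And>j. ms j < m"
    and "\<And>i j. i < j \<Longrightarrow> ms j < ms i"
    and "\<And>j. 0 < ms j"
    and "p \<notin> singular_locus (mellin_op m ms)"
  shows "monodromy_reducible (mellin_op m ms) p"
proof -
  interpret mellin_equation m ms "\<lambda>_. 1" by unfold_locales (use assms in auto)
  have inj: "inj ms"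
    by (rule injI) (metis assms(2) less_irrefl neqE)
  have p: "p \<notin> discriminant_locus" using assms(4) discriminant_subset_singular by blast
  consider j where "Suc (ms j) = m" | j where "\<not> coprime (ms j) m"
    | j where "coprime (ms j) m" "\<forall>j. ms j < m - 1"
  proof -
    have "ms j < m - 1" if "Suc (ms j) \<noteq> m" for j using ms_less[of j] that by linarith
    then show ?thesis using that by blast
  qed
  then show ?thesis
  proof cases
    case 1
    then show ?thesis by (rule reducible_linear[OF _ p])
  next
    case 2
    then show ?thesis by (rule reducible_not_coprime[OF mellin_equation_axioms _ inj assms(4)])
  next
    case 3
    then show ?thesis using reducible_coprime[OF _ inj p] by blast
  qed
qed

end
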